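(* Let $n\ge1$ and $\mu>-n+\frac12$. Then $$\|\mathcal S^*_{\omega_\mu}(f,g)\|_{1}\lesssim\|f\|_2\,\|g\|_2$$ for all Schwartz functions $f,g$ on $\mathbb R^n$, with an implicit constant independent of $f,g$.
   Context: Fourier transform: $\hat f(\xi)=\int_{\mathbb R^n}f(x)e^{-2\pi i x\cdot\xi}\,dx$; $|(\xi,\eta)|^2=|\xi|^2+|\eta|^2$. For $s>0$ the generalised bilinear spherical means are $$\mathcal S_{\omega_\mu,s}(f,g)(x)=\int_{\mathbb R^n}\int_{\mathbb R^n}\omega_\mu\big(s^2|(\xi,\eta)|^2\big)\hat f(\xi)\hat g(\eta)e^{2\pi i x\cdot(\xi+\eta)}\,d\xi\,d\eta,$$ where $$\omega_\mu(t)=2^{\mu+n-1}\,\Gamma(\mu+n+1)\,\frac{J_{\mu+n}(|t|^{1/2})}{|t|^{\frac12(\mu+n)}},\qquad \mu\ne-n-1,-n-2,\dots,$$ $J_\nu$ is the Bessel function of the first kind of order $\nu$, and the generalised bilinear spherical maximal function is $\mathcal S^*_{\omega_\mu}(f,g)(x)=\sup_{s>0}|\mathcal S_{\omega_\mu,s}(f,g)(x)|$. *)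

theory Defs
  imports "HOL-Analysis.Analysis"
begin

section \<open>Schwartz functions\<close>

definition partial_deriv :: "'n \<Rightarrow> (real ^ 'n::finite \<Rightarrow> complex) \<Rightarrow> real ^ 'n \<Rightarrow> complex" where
  "partial_deriv i f x = frechet_derivative f (at x) (axis i 1)"

text \<open>
  Higher partial derivatives are indexed by lists of coordinates; every multi-index is
  represented by (possibly several) such lists.
\<close>

definition iter_partial_deriv ::
    "'n list \<Rightarrow> (real ^ 'n::finite \<Rightarrow> complex) \<Rightarrow> real ^ 'n \<Rightarrow> complex" where
  "iter_partial_deriv is f = foldr partial_deriv is f"

text \<open>
  The junk value of \<open>frechet_derivative\<close> at points of non-differentiability plays no role,
  since all iterated partial derivatives are required to be differentiable everywhere.
\<close>

definition schwartz :: "(real ^ 'n::finite \<Rightarrow> complex) \<Rightarrow> bool" where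
  "schwartz f \<longleftrightarrow>
     (\<forall>is x. iter_partial_deriv is f differentiable (at x)) \<and>
     (\<forall>is (k::nat). bounded (range (\<lambda>x. norm x ^ k *\<^sub>R iter_partial_deriv is f x)))"


section \<open>Fourier transform and norms\<close>

definition fourier_transform :: "(real ^ 'n::finite \<Rightarrow> complex) \<Rightarrow> real ^ 'n \<Rightarrow> complex" where
  "fourier_transform f \<xi> =
     (\<integral>x. f x * exp (- 2 * of_real pi * \<i> * of_real (x \<bullet> \<xi>)) \<partial>lborel)"

definition norm_L2 :: "(real ^ 'n::finite \<Rightarrow> complex) \<Rightarrow> real" where
  "norm_L2 f = sqrt (\<integral>x. (norm (f x))\<^sup>2 \<partial>lborel)"

text \<open>The \<open>L\<^sup>1\<close> norm of a function with values in \<open>[0, \<infinity>]\<close>.\<close>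

definition norm_L1 :: "(real ^ 'n::finite \<Rightarrow> ennreal) \<Rightarrow> ennreal" where
  "norm_L1 F = (\<integral>\<^sup>+x. F x \<partial>lborel)"


section \<open>Bessel functions and the bilinear spherical maximal function\<close>

text \<open>
  The power series of \<open>J\<^sub>\<nu>\<close>, meant for \<open>x > 0\<close>. The entire function \<open>rGamma\<close> is \<open>1 / \<Gamma>\<close>, with
  value \<open>0\<close> at the poles of \<open>\<Gamma>\<close>, so negative integers \<open>\<nu>\<close> are covered as usual.
\<close>

definition Bessel_J :: "real \<Rightarrow> real \<Rightarrow> real" where
  "Bessel_J \<nu> x =
     (\<Sum>k. (-1) ^ k / fact k * rGamma (real k + \<nu> + 1) * (x / 2) powr (2 * real k + \<nu>))"

text \<open>
  At \<open>t = 0\<close> the formula is to be read as its limit; here it evaluates to \<open>0\<close> instead. In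
  \<open>bilinear_mean\<close> below this only concerns the null set \<open>{(0, 0)}\<close>.
\<close>

definition omega :: "nat \<Rightarrow> real \<Rightarrow> real \<Rightarrow> real" where
  "omega n \<mu> t =
     2 powr (\<mu> + real n - 1) * Gamma (\<mu> + real n + 1) *
       (Bessel_J (\<mu> + real n) (\<bar>t\<bar> powr (1 / 2)) / \<bar>t\<bar> powr ((\<mu> + real n) / 2))"

definition bilinear_mean ::
    "real \<Rightarrow> real \<Rightarrow> (real ^ 'n::finite \<Rightarrow> complex) \<Rightarrow> (real ^ 'n \<Rightarrow> complex) \<Rightarrow> real ^ 'n \<Rightarrow> complex"
  where
  "bilinear_mean \<mu> s f g x =
     (\<integral>\<xi>. (\<integral>\<eta>. of_real (omega CARD('n) \<mu> (s\<^sup>2 * (norm (\<xi>, \<eta>))\<^sup>2)) *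
                 fourier_transform f \<xi> * fourier_transform g \<eta> *
                 exp (2 * of_real pi * \<i> * of_real (x \<bullet> (\<xi> + \<eta>))) \<partial>lborel) \<partial>lborel)"

definition bilinear_maximal ::
    "real \<Rightarrow> (real ^ 'n::finite \<Rightarrow> complex) \<Rightarrow> (real ^ 'n \<Rightarrow> complex) \<Rightarrow> real ^ 'n \<Rightarrow> ennreal"
  where
  "bilinear_maximal \<mu> f g x = (SUP s\<in>{0<..}. ennreal (norm (bilinear_mean \<mu> s f g x)))"

end

theory Submission
  imports Defs "HOL-Probability.Probability"
begin

text \<open>
  Let \<open>\<nu> = \<mu> + n > 1 / 2\<close> and \<open>a = (\<nu> - 1) / 2 > - 1 / 4\<close>. Up to constants, \<open>J\<^sub>\<nu> x / x powr \<nu>\<close> is an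
  entire function \<open>besselB \<nu>\<close> of \<open>x\<^sup>2\<close>, and the symbol of the bilinear mean at scale \<open>s\<close> is
  \<open>besselB \<nu> (s\<^sup>2 |\<xi>|\<^sup>2 + s\<^sup>2 |\<eta>|\<^sup>2)\<close>. Sonine's second integral (\<open>besselB_sonine\<close>)
  \<open>besselB \<nu> (p + q) = \<integral>\<^sub>0\<^sup>1 besselB a (p u) * besselB a (q (1 - u)) * (u (1 - u)) powr a du\<close>
  separates the two frequencies. The bilinear mean at \<open>x\<close> is therefore an integral over \<open>u\<close> of products
  \<open>F\<^sub>r x * G\<^sub>q x\<close> of linear means at \<open>r = s\<^sup>2 u\<close> and \<open>q = s\<^sup>2 (1 - u)\<close>, where \<open>F\<^sub>r\<close> is the Fourier
  multiplier operator with symbol \<open>besselB a (r |\<xi>|\<^sup>2)\<close> applied to \<open>f\<close>, and \<open>G\<^sub>q\<close> likewise for \<open>g\<close>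
  (\<open>bilinear_mean_eq\<close>). Since \<open>a \<ge> - 1 / 4\<close>, the weight is at most \<open>(u (1 - u)) powr (- 1 / 4)\<close>, and the
  Cauchy-Schwarz inequality in \<open>u\<close> leaves two quadratic means of the form
  \<open>\<integral>\<^sub>0\<^sup>1 |F\<^sub>r x|\<^sup>2 * u powr (- 1 / 2) du\<close> with \<open>r = s\<^sup>2 u\<close> (\<open>bilinear_mean_le\<close>). It remains to show
  that their supremum over \<open>s\<close> has an integral in \<open>x\<close> of at most a constant times \<open>\<parallel>f\<parallel>\<^sub>2\<^sup>2\<close>.

  For this purpose \<open>besselB a r\<close> is compared with the Gaussian \<open>besselB a 0 * exp (- \<pi> r)\<close>. The
  Gaussian contributes the heat flow of \<open>f\<close>, which is dominated by the heat maximal function. Its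
  boundedness on \<open>L\<^sup>2\<close> (\<open>heat_max2_L1\<close>) follows from an argument that composes a linearised maximal
  operator with its adjoint: the composition is again bounded by linearised maximal operators, so the
  square of the norm is at most a constant times the norm.

  The difference \<open>besselD a\<close> of the two symbols satisfies \<open>\<integral>\<^sub>0\<^sup>\<infinity> (besselD a r)\<^sup>2 dr / r < \<infinity>\<close>
  (\<open>besselD_norm_finite\<close>): it vanishes at the origin, and at infinity an energy estimate for Bessel's
  equation applies. Because \<open>u powr (- 1 / 2) \<le> 1 / u\<close> on the unit interval and \<open>du / u\<close> is invariant
  under dilations, its quadratic means at all scales are bounded by one square function, whose
  integral is controlled by Plancherel's inequality (\<open>rest_square_L1\<close>).

  For Schwartz functions all integrals involved converge absolutely, since the Fourier transform
  decays rapidly (\<open>schwartz_fourier_rapid\<close>).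
\<close>

section \<open>Fubini's theorem for bounded kernels\<close>

lemma cis_measurable[measurable]: "cis \<in> borel_measurable borel"
  by (intro borel_measurable_continuous_onI continuous_intros)

lemma cnj_measurable[measurable]: "cnj \<in> borel_measurable borel"
  by (intro borel_measurable_continuous_onI continuous_intros)

lemma norm_squared_Basis: "(norm (x::'a::euclidean_space))\<^sup>2 = (\<Sum>b\<in>Basis. (x \<bullet> b)\<^sup>2)"
  unfolding power2_norm_eq_inner by (subst euclidean_inner) (simp add: power2_eq_square)

text \<open>
  The exchanges of oscillatory integrals below all have this shape: two integrable functions are
  coupled by a bounded kernel.
\<close>

lemma fubini_bounded_kernel:
  fixes K :: "'a \<times> 'b \<Rightarrow> complex"
  assumes "sigma_finite_measure M" "sigma_finite_measure N"
    and a: "integrable M a" and b: "integrable N b"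
    and K[measurable]: "K \<in> borel_measurable (M \<Otimes>\<^sub>M N)"
    and K_le: "\<And>x y. x \<in> space M \<Longrightarrow> y \<in> space N \<Longrightarrow> norm (K (x, y)) \<le> C"
  shows "(\<integral>x. a x * (\<integral>y. K (x, y) * b y \<partial>N) \<partial>M) = (\<integral>y. (\<integral>x. a x * K (x, y) \<partial>M) * b y \<partial>N)"
proof -
  interpret M: sigma_finite_measure M by fact
  interpret N: sigma_finite_measure N by fact
  interpret pair_sigma_finite M N ..
  have [measurable]: "a \<in> borel_measurable M" "b \<in> borel_measurable N"
    using a b by auto
  have ab: "integrable (M \<Otimes>\<^sub>M N) (\<lambda>(x, y). a x * b y)"
    using a b
    by (subst Fubini_integrable) (auto simp: norm_mult)
  have int: "integrable (M \<Otimes>\<^sub>M N) (\<lambda>(x, y). a x * K (x, y) * b y)"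
  proof (rule Bochner_Integration.integrable_bound[OF integrable_mult_right[OF integrable_norm[OF ab], of C]])
    show "AE z in M \<Otimes>\<^sub>M N. norm (case z of (x, y) \<Rightarrow> a x * K (x, y) * b y)
        \<le> norm (C * norm (case z of (x, y) \<Rightarrow> a x * b y))"
    proof (rule AE_I2)
      fix z assume z: "z \<in> space (M \<Otimes>\<^sub>M N)"
      obtain x y where xy: "z = (x, y)" by (cases z)
      with z have "norm (K (x, y)) \<le> \<bar>C\<bar>"
        using K_le[of x y] by (auto simp: space_pair_measure)
      from mult_right_mono[OF this, of "norm (a x * b y)"]
      show "norm (case z of (x, y) \<Rightarrow> a x * K (x, y) * b y)
          \<le> norm (C * norm (case z of (x, y) \<Rightarrow> a x * b y))"
        by (simp add: xy norm_mult abs_mult ac_simps)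
    qed
  qed measurable
  have "(\<integral>x. a x * (\<integral>y. K (x, y) * b y \<partial>N) \<partial>M) = (\<integral>x. (\<integral>y. a x * K (x, y) * b y \<partial>N) \<partial>M)"
    by (simp add: mult.assoc)
  also have "\<dots> = (\<integral>y. (\<integral>x. a x * K (x, y) * b y \<partial>M) \<partial>N)"
    by (rule Fubini_integral[OF int, symmetric])
  finally show ?thesis by simp
qed

text \<open>
  Lebesgue measure is the image of a product measure indexed by the basis, so integrals of tensor
  products factor. This reduces Gaussians and decay estimates to one dimension.
\<close>

lemma
  fixes f :: "'a::euclidean_space \<Rightarrow> real \<Rightarrow> complex"
  assumes int: "\<And>b. b \<in> Basis \<Longrightarrow> integrable lborel (f b)"
  shows lborel_integrable_prod_Basis: "integrable lborel (\<lambda>x. \<Prod>b\<in>Basis. f b (x \<bullet> b))"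
    and lborel_integral_prod_Basis:
      "(\<integral>x. (\<Prod>b\<in>Basis. f b (x \<bullet> b)) \<partial>lborel) = (\<Prod>b\<in>Basis. \<integral>t. f b t \<partial>lborel)"
proof -
  interpret product_sigma_finite "\<lambda>_::'a. lborel :: real measure" by standard
  have [measurable]: "f b \<in> borel_measurable borel" if "b \<in> Basis" for b
    using int[OF that] by (auto dest: borel_measurable_integrable)
  have eq: "(\<Prod>b\<in>Basis. f b ((\<Sum>c\<in>Basis. z c *\<^sub>R c) \<bullet> b)) = (\<Prod>b\<in>Basis. f b (z b))" for z :: "'a \<Rightarrow> real"
    by (intro prod.cong refl) (simp add: inner_sum_left inner_Basis if_distrib sum.delta' cong: if_cong)
  have meas: "(\<lambda>z. \<Sum>c\<in>Basis. z c *\<^sub>R c) \<in> (\<Pi>\<^sub>M b\<in>(Basis::'a set). (lborel::real measure)) \<rightarrow>\<^sub>M borel"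
    by measurable
  show "integrable lborel (\<lambda>x. \<Prod>b\<in>Basis. f b (x \<bullet> b))"
    using product_integrable_prod[OF finite_Basis int]
    by (subst lborel_eq, subst integrable_distr_eq[OF meas]) (simp_all add: eq)
  show "(\<integral>x. (\<Prod>b\<in>Basis. f b (x \<bullet> b)) \<partial>lborel) = (\<Prod>b\<in>Basis. \<integral>t. f b t \<partial>lborel)"
    using product_integral_prod[OF finite_Basis int]
    by (subst lborel_eq, subst integral_distr[OF meas]) (simp_all add: eq)
qed

section \<open>Gaussians and the heat kernel\<close>

text \<open>
  The characteristic function of the standard normal distribution, rescaled by
  \<open>c = sqrt (2 \<pi> r)\<close> so that \<open>x\<^sup>2 / 2\<close> becomes \<open>\<pi> r t\<^sup>2\<close>.
\<close>

lemma
  assumes r: "r > (0::real)"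
  shows gaussian_real_integrable: "integrable lborel (\<lambda>t. of_real (exp (- pi * r * t\<^sup>2)) * cis (2 * pi * t * s))"
    and gaussian_real_fourier:
     "(\<integral>t. of_real (exp (- pi * r * t\<^sup>2)) * cis (2 * pi * t * s) \<partial>lborel)
       = of_real (r powr (- 1 / 2) * exp (- pi * s\<^sup>2 / r))"
proof -
  define c where "c = sqrt (2 * pi * r)"
  have c: "c > 0" "c\<^sup>2 = 2 * pi * r" using r by (auto simp: c_def)
  define g :: "real \<Rightarrow> complex" where "g x = std_normal_density x *\<^sub>R cis (2 * pi * s / c * x)" for x
  have "integrable lborel (\<lambda>x. std_normal_density x)"
    using integrable_std_normal_moment[of 0] by simp
  then have int: "integrable lborel g"
    unfolding g_def by (rule Bochner_Integration.integrable_bound) auto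
  have "char std_normal_distribution (2 * pi * s / c) = (\<integral>x. g x \<partial>lborel)"
    unfolding char_def g_def
    by (subst integral_density) (auto simp: cis_conv_exp normal_density_nonneg)
  then have "(\<integral>x. g x \<partial>lborel) = of_real (exp (- ((2 * pi * s / c)\<^sup>2) / 2))"
    by (simp add: char_std_normal_distribution)
  also have "(2 * pi * s / c)\<^sup>2 / 2 = pi * s\<^sup>2 / r"
    using r unfolding power_divide c(2) by (simp add: field_simps power2_eq_square)
  then have "- ((2 * pi * s / c)\<^sup>2) / 2 = - pi * s\<^sup>2 / r" by simp
  finally have 1: "(\<integral>x. g x \<partial>lborel) = of_real (exp (- pi * s\<^sup>2 / r))" .
  have gc: "g (0 + c * t) = of_real (1 / sqrt (2 * pi)) * (of_real (exp (- pi * r * t\<^sup>2)) * cis (2 * pi * t * s))" for t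
  proof -
    have "(c * t)\<^sup>2 / 2 = pi * r * t\<^sup>2"
      unfolding power_mult_distrib c(2) by simp
    then show ?thesis
      using c unfolding g_def std_normal_density_def by (simp add: scaleR_conv_of_real ac_simps)
  qed
  have "integrable lborel (\<lambda>t. g (0 + c * t))"
    using int c by (subst lborel_integrable_real_affine_iff) auto
  then have "integrable lborel (\<lambda>t. of_real (sqrt (2 * pi)) * g (0 + c * t))"
    by (intro integrable_mult_right)
  then show "integrable lborel (\<lambda>t. of_real (exp (- pi * r * t\<^sup>2)) * cis (2 * pi * t * s))"
    unfolding gc by simp
  have "of_real (exp (- pi * s\<^sup>2 / r)) = c *\<^sub>R (\<integral>t. g (0 + c * t) \<partial>lborel)"
    using lborel_integral_real_affine[of c g 0] c 1 by simp
  also have "\<dots> = of_real (c / sqrt (2 * pi)) * (\<integral>t. of_real (exp (- pi * r * t\<^sup>2)) * cis (2 * pi * t * s) \<partial>lborel)"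
    unfolding gc by (simp add: scaleR_conv_of_real)
  also have "c / sqrt (2 * pi) = r powr (1 / 2)"
    using r by (simp add: c_def real_sqrt_mult powr_half_sqrt)
  finally show "(\<integral>t. of_real (exp (- pi * r * t\<^sup>2)) * cis (2 * pi * t * s) \<partial>lborel)
       = of_real (r powr (- 1 / 2) * exp (- pi * s\<^sup>2 / r))"
    using r by (simp add: powr_minus field_simps)
qed

text \<open>
  The heat kernel at time \<open>r / (4 \<pi>)\<close>. In this parametrisation it is the Fourier transform of
  \<open>exp (- \<pi> r |\<xi>|\<^sup>2)\<close>.
\<close>

definition heat :: "real \<Rightarrow> 'a::euclidean_space \<Rightarrow> real" where
  "heat r z = r powr (- (real DIM('a) / 2)) * exp (- pi * (norm z)\<^sup>2 / r)"

lemma heat_measurable[measurable]: "heat r \<in> borel_measurable borel"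
  unfolding heat_def by measurable

lemma heat_measurable_raw[measurable (raw)]:
  assumes [measurable]: "p \<in> borel_measurable M" "q \<in> borel_measurable M"
  shows "(\<lambda>x. heat (p x) (q x)) \<in> borel_measurable M"
  unfolding heat_def by measurable

lemma heat_nonneg[simp]: "heat r z \<ge> 0"
  by (simp add: heat_def)

lemma heat_commute: "heat r (x - y) = heat r (y - x)"
  by (simp add: heat_def norm_minus_commute)

lemma
  fixes z :: "'a::euclidean_space"
  assumes r: "r > 0"
  shows gaussian_integrable: "integrable lborel (\<lambda>\<xi>::'a. of_real (exp (- pi * r * (norm \<xi>)\<^sup>2)) * cis (2 * pi * (z \<bullet> \<xi>)))"
    and gaussian_fourier:
      "(\<integral>\<xi>. of_real (exp (- pi * r * (norm \<xi>)\<^sup>2)) * cis (2 * pi * (z \<bullet> \<xi>)) \<partial>lborel) = of_real (heat r z)"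
proof -
  define f where "f b t = of_real (exp (- pi * r * t\<^sup>2)) * cis (2 * pi * t * (z \<bullet> b))" for b t
  have int: "integrable lborel (f b)" for b
    unfolding f_def using gaussian_real_integrable[OF r] .
  have eq: "of_real (exp (- pi * r * (norm \<xi>)\<^sup>2)) * cis (2 * pi * (z \<bullet> \<xi>)) = (\<Prod>b\<in>Basis. f b (\<xi> \<bullet> b))" for \<xi>
  proof -
    have "(norm \<xi>)\<^sup>2 = (\<Sum>b\<in>Basis. (\<xi> \<bullet> b)\<^sup>2)"
      by (rule norm_squared_Basis)
    then have "exp (- pi * r * (norm \<xi>)\<^sup>2) = (\<Prod>b\<in>Basis. exp (- pi * r * (\<xi> \<bullet> b)\<^sup>2))"
      by (simp add: exp_sum sum_distrib_left flip: sum_negf)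
    moreover have "cis (2 * pi * (z \<bullet> \<xi>)) = (\<Prod>b\<in>Basis. cis (2 * pi * (\<xi> \<bullet> b) * (z \<bullet> b)))"
      unfolding euclidean_inner[of z \<xi>]
      by (simp add: cis_conv_exp exp_sum[symmetric] sum_distrib_left sum_distrib_right ac_simps)
    ultimately show ?thesis by (simp add: f_def prod.distrib)
  qed
  show "integrable lborel (\<lambda>\<xi>::'a. of_real (exp (- pi * r * (norm \<xi>)\<^sup>2)) * cis (2 * pi * (z \<bullet> \<xi>)))"
    unfolding eq by (rule lborel_integrable_prod_Basis) (rule int)
  have "(\<integral>\<xi>. of_real (exp (- pi * r * (norm \<xi>)\<^sup>2)) * cis (2 * pi * (z \<bullet> \<xi>)) \<partial>lborel)
      = (\<Prod>b\<in>Basis. of_real (r powr (- 1 / 2) * exp (- pi * (z \<bullet> b)\<^sup>2 / r)))"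
    unfolding eq by (subst lborel_integral_prod_Basis[OF int]) (simp only: f_def[abs_def] gaussian_real_fourier[OF r])
  also have "\<dots> = of_real (heat r z)"
  proof -
    have "(norm z)\<^sup>2 = (\<Sum>b\<in>Basis. (z \<bullet> b)\<^sup>2)"
      by (rule norm_squared_Basis)
    then have "exp (- pi * (norm z)\<^sup>2 / r) = (\<Prod>b\<in>Basis. exp (- pi * (z \<bullet> b)\<^sup>2 / r))"
      by (simp add: exp_sum sum_distrib_left sum_divide_distrib flip: sum_negf)
    moreover have "r powr (- (real DIM('a) / 2)) = (\<Prod>b\<in>(Basis::'a set). r powr (- 1 / 2))"
      using r by (simp add: powr_powr flip: powr_realpow)
    ultimately show ?thesis by (simp add: heat_def prod.distrib)
  qed
  finally show "(\<integral>\<xi>. of_real (exp (- pi * r * (norm \<xi>)\<^sup>2)) * cis (2 * pi * (z \<bullet> \<xi>)) \<partial>lborel) = of_real (heat r z)" .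
qed

lemma nn_integral_heat:
  fixes x :: "'a::euclidean_space"
  assumes r: "r > 0"
  shows "(\<integral>\<^sup>+ z. ennreal (heat r (x - z)) \<partial>lborel) = 1"
proof -
  have int: "integrable lborel (\<lambda>z::'a. of_real (exp (- pi * (1 / r) * (norm z)\<^sup>2)) * cis (2 * pi * (0 \<bullet> z)))"
    by (rule gaussian_integrable) (use r in simp)
  have i2: "integrable lborel (\<lambda>z::'a. exp (- pi * (1 / r) * (norm z)\<^sup>2))"
    using integrable_norm[OF int] by (simp add: norm_mult)
  have v: "(\<integral>z. exp (- pi * (1 / r) * (norm (z::'a))\<^sup>2) \<partial>lborel) = (1 / r) powr (- (real DIM('a) / 2))"
    using gaussian_fourier[of "1 / r" "0::'a"] r by (simp add: heat_def flip: of_real_exp)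
  have h: "heat r z = r powr (- (real DIM('a) / 2)) * exp (- pi * (1 / r) * (norm z)\<^sup>2)" for z :: 'a
    by (simp add: heat_def)
  have "(\<integral>\<^sup>+ z. ennreal (heat r (z::'a)) \<partial>lborel) = ennreal (\<integral>z. heat r (z::'a) \<partial>lborel)"
    unfolding h using i2 by (intro nn_integral_eq_integral integrable_mult_right) (auto intro!: AE_I2)
  also have "(\<integral>z. heat r (z::'a) \<partial>lborel) = 1"
    unfolding h using r v by (simp add: powr_divide powr_minus)
  finally have 1: "(\<integral>\<^sup>+ z. ennreal (heat r (z::'a)) \<partial>lborel) = 1" by simp
  have "(\<integral>\<^sup>+ z. ennreal (heat r (z::'a)) \<partial>lborel) = (\<integral>\<^sup>+ z. ennreal (heat r z) \<partial>distr lborel borel ((+) (- x)))"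
    by (simp add: lborel_distr_plus)
  also have "\<dots> = (\<integral>\<^sup>+ z. ennreal (heat r (x - z)) \<partial>lborel)"
    by (subst nn_integral_distr) (auto simp: heat_commute[of r x])
  finally show ?thesis using 1 by simp
qed

lemma nn_integral_heat':
  "r > 0 \<Longrightarrow> (\<integral>\<^sup>+ x. ennreal (heat r (x - y)) \<partial>lborel) = 1"
  using nn_integral_heat[of r y] by (simp add: heat_commute[of r y])

section \<open>Plancherel's inequality\<close>

definition ift :: "('a::euclidean_space \<Rightarrow> complex) \<Rightarrow> 'a \<Rightarrow> complex" where
  "ift A x = (\<integral>\<xi>. A \<xi> * cis (2 * pi * (x \<bullet> \<xi>)) \<partial>lborel)"

lemma ift_measurable[measurable (raw)]:
  assumes [measurable]: "(\<lambda>(z, \<xi>). A z \<xi>) \<in> borel_measurable (M \<Otimes>\<^sub>M borel)"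
    and [measurable]: "p \<in> borel_measurable M"
  shows "(\<lambda>z. ift (A z) (p z)) \<in> borel_measurable M"
  unfolding ift_def by measurable

lemma norm_ift_le_real:
  assumes "integrable lborel A"
  shows "norm (ift A x) \<le> (\<integral>\<xi>. norm (A \<xi>) \<partial>lborel)"
  unfolding ift_def using integral_norm_bound[of lborel "\<lambda>\<xi>. A \<xi> * cis (2 * pi * (x \<bullet> \<xi>))"]
  by (simp add: norm_mult)

lemma integrable_mult_cis:
  fixes A :: "'a::euclidean_space \<Rightarrow> complex"
  assumes "integrable lborel A" and [measurable]: "p \<in> borel_measurable borel"
  shows "integrable lborel (\<lambda>\<xi>. A \<xi> * cis (p \<xi>))"
proof -
  have [measurable]: "A \<in> borel_measurable borel" using assms(1) by auto
  show ?thesis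
    by (rule Bochner_Integration.integrable_bound[OF assms(1)]) (auto simp: norm_mult)
qed

text \<open>
  Schur's test: the heat kernel is symmetric with total mass one, so
  \<open>2 g x * g y \<le> (g x)\<^sup>2 + (g y)\<^sup>2\<close> bounds its quadratic form by the square of the \<open>L\<^sup>2\<close> norm.
\<close>

lemma heat_schur:
  fixes g :: "'a::euclidean_space \<Rightarrow> ennreal"
  assumes r: "r > 0" and [measurable]: "g \<in> borel_measurable borel"
  shows "(\<integral>\<^sup>+x. g x * (\<integral>\<^sup>+y. ennreal (heat r (x - y)) * g y \<partial>lborel) \<partial>lborel) \<le> (\<integral>\<^sup>+x. (g x)\<^sup>2 \<partial>lborel)"
    (is "?L \<le> ?R")
proof -
  have "2 * ?L = (\<integral>\<^sup>+x. (\<integral>\<^sup>+y. ennreal (heat r (x - y)) * (2 * g x * g y) \<partial>lborel) \<partial>lborel)"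
    by (simp add: nn_integral_cmult[symmetric] ac_simps)
  also have "\<dots> \<le> (\<integral>\<^sup>+x. (\<integral>\<^sup>+y. ennreal (heat r (x - y)) * ((g x)\<^sup>2 + (g y)\<^sup>2) \<partial>lborel) \<partial>lborel)"
    by (intro nn_integral_mono mult_left_mono sum_of_squares_ge_ennreal) auto
  also have "\<dots> = (\<integral>\<^sup>+x. (\<integral>\<^sup>+y. ennreal (heat r (x - y)) * (g x)\<^sup>2 \<partial>lborel) \<partial>lborel)
      + (\<integral>\<^sup>+x. (\<integral>\<^sup>+y. ennreal (heat r (x - y)) * (g y)\<^sup>2 \<partial>lborel) \<partial>lborel)"
    by (simp add: distrib_left nn_integral_add)
  also have "(\<integral>\<^sup>+x. (\<integral>\<^sup>+y. ennreal (heat r (x - y)) * (g y)\<^sup>2 \<partial>lborel) \<partial>lborel)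
      = (\<integral>\<^sup>+y. (\<integral>\<^sup>+x. ennreal (heat r (x - y)) * (g y)\<^sup>2 \<partial>lborel) \<partial>lborel)"
    by (rule lborel_pair.Fubini') measurable
  also have "\<dots> = ?R"
    by (simp add: nn_integral_multc nn_integral_heat'[OF r])
  also have "(\<integral>\<^sup>+x. (\<integral>\<^sup>+y. ennreal (heat r (x - y)) * (g x)\<^sup>2 \<partial>lborel) \<partial>lborel) = ?R"
    by (simp add: nn_integral_multc nn_integral_heat[OF r])
  finally have "2 * ?L \<le> 2 * ?R" by (simp add: mult_2)
  then show ?thesis
    by (subst (asm) ennreal_mult_le_mult_iff) auto
qed

lemma norm_integral_le_nn:
  fixes f :: "'a \<Rightarrow> complex"
  shows "ennreal (norm (integral\<^sup>L M f)) \<le> (\<integral>\<^sup>+ x. ennreal (norm (f x)) \<partial>M)"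
  by (cases "integrable M f") (auto intro: integral_norm_bound_ennreal simp: not_integrable_integral_eq)

text \<open>
  Inserting the factor \<open>exp (- \<pi> r |x|\<^sup>2)\<close> makes all integrals absolutely convergent. Expanding the
  square and integrating in \<open>x\<close> first turns the left-hand side into the quadratic form of the heat
  kernel at \<open>G\<close>, to which Schur's test applies.
\<close>

lemma plancherel_regularised:
  fixes G :: "'a::euclidean_space \<Rightarrow> complex"
  assumes G: "integrable lborel G" and r: "r > 0"
  shows "(\<integral>\<^sup>+x. ennreal ((norm (ift G x))\<^sup>2 * exp (- pi * r * (norm x)\<^sup>2)) \<partial>lborel)
      \<le> (\<integral>\<^sup>+\<xi>. (ennreal (norm (G \<xi>)))\<^sup>2 \<partial>lborel)"
proof -
  define w where "w x = exp (- pi * r * (norm x)\<^sup>2)" for x :: 'a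
  define L where "L = (\<integral>\<xi>. norm (G \<xi>) \<partial>lborel)"
  have [measurable]: "G \<in> borel_measurable borel" using G by auto
  have [measurable]: "w \<in> borel_measurable borel" unfolding w_def by measurable
  have w_nn: "w x \<ge> 0" for x by (simp add: w_def)
  have int_w: "integrable lborel (\<lambda>x. complex_of_real (w x))"
    using gaussian_integrable[OF r, of "0::'a"] by (simp add: w_def)
  have int_wr: "integrable lborel w"
    using integrable_norm[OF int_w] by (simp add: w_nn)
  have PL: "norm (ift G x) \<le> L" for x
    unfolding L_def by (rule norm_ift_le_real[OF G])
  have L0: "L \<ge> 0" using PL[of 0] norm_ge_zero order_trans by blast
  have int_Pw: "integrable lborel (\<lambda>x. cnj (ift G x) * of_real (w x))"
    by (rule Bochner_Integration.integrable_bound[OF integrable_mult_right[OF int_wr, of L]])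
       (auto simp: norm_mult abs_mult w_nn L0 intro!: mult_right_mono PL)
  have int_Pw2: "integrable lborel (\<lambda>x. (norm (ift G x))\<^sup>2 * w x)"
    by (rule Bochner_Integration.integrable_bound[OF integrable_mult_right[OF int_wr, of "L\<^sup>2"]])
       (auto simp: norm_mult abs_mult w_nn L0 intro!: mult_right_mono power_mono PL)
  have sf: "sigma_finite_measure (lborel :: 'a measure)" by (rule lborel.sigma_finite_measure_axioms)
  \<comment> \<open>The Gaussian factor enters here: its Fourier transform is the heat kernel.\<close>
  have inner: "(\<integral>x. cis (2 * pi * (x \<bullet> \<xi>)) * (cnj (ift G x) * of_real (w x)) \<partial>lborel)
      = (\<integral>\<eta>. of_real (heat r (\<xi> - \<eta>)) * cnj (G \<eta>) \<partial>lborel)" for \<xi>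
  proof -
    have "cnj (ift G x) = (\<integral>\<eta>. cis (- (2 * pi * (x \<bullet> \<eta>))) * cnj (G \<eta>) \<partial>lborel)" for x
      unfolding ift_def
      using Bochner_Integration.integral_cnj[of lborel "\<lambda>\<eta>. G \<eta> * cis (2 * pi * (x \<bullet> \<eta>))", symmetric]
      by (simp only: complex_cnj_mult cis_cnj mult.commute)
    then have "(\<integral>x. cis (2 * pi * (x \<bullet> \<xi>)) * (cnj (ift G x) * of_real (w x)) \<partial>lborel)
      = (\<integral>x. (of_real (w x) * cis (2 * pi * (x \<bullet> \<xi>))) *
          (\<integral>\<eta>. cis (- (2 * pi * (x \<bullet> \<eta>))) * cnj (G \<eta>) \<partial>lborel) \<partial>lborel)"
      by (simp add: ac_simps)
    also have "\<dots> = (\<integral>\<eta>. (\<integral>x. (of_real (w x) * cis (2 * pi * (x \<bullet> \<xi>))) * cis (- (2 * pi * (x \<bullet> \<eta>))) \<partial>lborel)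
        * cnj (G \<eta>) \<partial>lborel)"
      using fubini_bounded_kernel[OF sf sf integrable_mult_cis[OF int_w, of "\<lambda>x. 2 * pi * (x \<bullet> \<xi>)"] integrable_cnj[OF G],
          of "\<lambda>(x, \<eta>). cis (- (2 * pi * (x \<bullet> \<eta>)))" 1]
      by simp
    also have "(\<lambda>\<eta>. (\<integral>x. (of_real (w x) * cis (2 * pi * (x \<bullet> \<xi>))) * cis (- (2 * pi * (x \<bullet> \<eta>))) \<partial>lborel))
        = (\<lambda>\<eta>. of_real (heat r (\<xi> - \<eta>)))"
    proof
      fix \<eta>
      have e1: "(of_real (w x) * cis (2 * pi * (x \<bullet> \<xi>))) * cis (- (2 * pi * (x \<bullet> \<eta>)))
          = of_real (w x) * cis (2 * pi * ((\<xi> - \<eta>) \<bullet> x))" for x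
        by (simp add: cis_mult inner_commute inner_diff algebra_simps)
      show "(\<integral>x. (of_real (w x) * cis (2 * pi * (x \<bullet> \<xi>))) * cis (- (2 * pi * (x \<bullet> \<eta>))) \<partial>lborel)
          = of_real (heat r (\<xi> - \<eta>))"
        unfolding e1 using gaussian_fourier[OF r, of "\<xi> - \<eta>"] by (simp add: w_def)
    qed
    finally show ?thesis .
  qed
  have "of_real (\<integral>x. (norm (ift G x))\<^sup>2 * w x \<partial>lborel)
      = (\<integral>x. ift G x * (cnj (ift G x) * of_real (w x)) \<partial>lborel)"
    by (subst integral_complex_of_real[symmetric])
       (simp add: complex_norm_square mult.assoc del: of_real_power)
  also have "\<dots> = (\<integral>\<xi>. G \<xi> * (\<integral>x. cis (2 * pi * (x \<bullet> \<xi>)) * (cnj (ift G x) * of_real (w x)) \<partial>lborel) \<partial>lborel)"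
    unfolding ift_def[of G]
    using fubini_bounded_kernel[OF sf sf G int_Pw, of "\<lambda>(\<xi>, x). cis (2 * pi * (x \<bullet> \<xi>))" 1]
    by (simp add: ift_def)
  also have "\<dots> = (\<integral>\<xi>. G \<xi> * (\<integral>\<eta>. of_real (heat r (\<xi> - \<eta>)) * cnj (G \<eta>) \<partial>lborel) \<partial>lborel)"
    unfolding inner ..
  finally have eq: "complex_of_real (\<integral>x. (norm (ift G x))\<^sup>2 * w x \<partial>lborel) = \<dots>" .
  have "(\<integral>\<^sup>+x. ennreal ((norm (ift G x))\<^sup>2 * w x) \<partial>lborel) = ennreal (\<integral>x. (norm (ift G x))\<^sup>2 * w x \<partial>lborel)"
    by (rule nn_integral_eq_integral[OF int_Pw2]) (auto simp: w_nn)
  also have "\<dots> \<le> ennreal (norm (complex_of_real (\<integral>x. (norm (ift G x))\<^sup>2 * w x \<partial>lborel)))"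
    by (rule ennreal_leI) (simp only: norm_of_real abs_ge_self)
  also have "\<dots> \<le> (\<integral>\<^sup>+\<xi>. ennreal (norm (G \<xi> * (\<integral>\<eta>. of_real (heat r (\<xi> - \<eta>)) * cnj (G \<eta>) \<partial>lborel))) \<partial>lborel)"
    unfolding eq by (rule norm_integral_le_nn)
  also have "\<dots> \<le> (\<integral>\<^sup>+\<xi>. ennreal (norm (G \<xi>)) * (\<integral>\<^sup>+\<eta>. ennreal (heat r (\<xi> - \<eta>)) * ennreal (norm (G \<eta>)) \<partial>lborel) \<partial>lborel)"
  proof (rule nn_integral_mono)
    fix \<xi>
    have "ennreal (norm (\<integral>\<eta>. of_real (heat r (\<xi> - \<eta>)) * cnj (G \<eta>) \<partial>lborel))
        \<le> (\<integral>\<^sup>+\<eta>. ennreal (heat r (\<xi> - \<eta>)) * ennreal (norm (G \<eta>)) \<partial>lborel)"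
      using norm_integral_le_nn[of lborel "\<lambda>\<eta>. of_real (heat r (\<xi> - \<eta>)) * cnj (G \<eta>)"]
      by (simp add: norm_mult ennreal_mult)
    then show "ennreal (norm (G \<xi> * (\<integral>\<eta>. of_real (heat r (\<xi> - \<eta>)) * cnj (G \<eta>) \<partial>lborel)))
        \<le> ennreal (norm (G \<xi>)) * (\<integral>\<^sup>+\<eta>. ennreal (heat r (\<xi> - \<eta>)) * ennreal (norm (G \<eta>)) \<partial>lborel)"
      by (simp add: norm_mult ennreal_mult mult_left_mono)
  qed
  also have "\<dots> \<le> (\<integral>\<^sup>+\<xi>. (ennreal (norm (G \<xi>)))\<^sup>2 \<partial>lborel)"
    by (rule heat_schur[OF r]) measurable
  finally show ?thesis unfolding w_def .
qed

text \<open>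
  The limit \<open>r \<rightarrow> 0\<close> of the regularised inequality, by Fatou's lemma.
\<close>

lemma plancherel_le:
  fixes G :: "'a::euclidean_space \<Rightarrow> complex"
  assumes G: "integrable lborel G"
  shows "(\<integral>\<^sup>+x. (ennreal (norm (ift G x)))\<^sup>2 \<partial>lborel) \<le> (\<integral>\<^sup>+\<xi>. (ennreal (norm (G \<xi>)))\<^sup>2 \<partial>lborel)"
proof -
  have [measurable]: "G \<in> borel_measurable borel" using G by auto
  define W where "W k x = ennreal ((norm (ift G x))\<^sup>2 * exp (- pi * (1 / Suc k) * (norm x)\<^sup>2))" for k x
  have [measurable]: "W k \<in> borel_measurable borel" for k unfolding W_def by measurable
  have "(\<lambda>k. W k x) \<longlonglongrightarrow> (ennreal (norm (ift G x)))\<^sup>2" for x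
  proof -
    have "(\<lambda>k. (norm (ift G x))\<^sup>2 * exp (- pi * (1 / Suc k) * (norm x)\<^sup>2))
        \<longlonglongrightarrow> (norm (ift G x))\<^sup>2 * exp (- pi * 0 * (norm x)\<^sup>2)"
      by (intro tendsto_intros LIMSEQ_Suc[OF lim_1_over_n])
    from tendsto_ennrealI[OF this] show ?thesis
      unfolding W_def by (simp add: ennreal_power)
  qed
  then have "(\<integral>\<^sup>+x. (ennreal (norm (ift G x)))\<^sup>2 \<partial>lborel) = (\<integral>\<^sup>+x. liminf (\<lambda>k. W k x) \<partial>lborel)"
    by (intro nn_integral_cong) (metis lim_imp_Liminf sequentially_bot)
  also have "\<dots> \<le> liminf (\<lambda>k. \<integral>\<^sup>+x. W k x \<partial>lborel)"
    by (rule nn_integral_liminf) measurable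
  also have "\<dots> \<le> (\<integral>\<^sup>+\<xi>. (ennreal (norm (G \<xi>)))\<^sup>2 \<partial>lborel)"
    unfolding W_def using plancherel_regularised[OF G, of "1 / Suc k" for k]
    by (intro Liminf_le) (auto intro!: always_eventually)
  finally show ?thesis .
qed

section \<open>The heat maximal function on \<open>L\<^sup>2\<close>\<close>

lemma ennreal_am_gm:
  fixes a b :: ennreal
  assumes l: "l > (0::real)"
  shows "2 * (a * b) \<le> ennreal l * a\<^sup>2 + ennreal (1 / l) * b\<^sup>2"
proof -
  have s: "(ennreal (sqrt l))\<^sup>2 = ennreal l" "(ennreal (sqrt (1 / l)))\<^sup>2 = ennreal (1 / l)"
      "ennreal (sqrt l) * ennreal (sqrt (1 / l)) = 1"
    using l by (simp_all add: ennreal_power real_sqrt_divide power_divide flip: ennreal_mult)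
  have "2 * (a * b) = 2 * (ennreal (sqrt l) * a) * (ennreal (sqrt (1 / l)) * b)"
    using s(3) by (metis (no_types, lifting) mult.assoc mult.left_commute mult.left_neutral)
  also have "\<dots> \<le> (ennreal (sqrt l) * a)\<^sup>2 + (ennreal (sqrt (1 / l)) * b)\<^sup>2"
    by (rule sum_of_squares_ge_ennreal)
  finally show ?thesis by (simp only: power_mult_distrib s)
qed

lemma nn_integral_am_gm:
  assumes l: "l > (0::real)" and [measurable]: "f \<in> borel_measurable M" "g \<in> borel_measurable M"
  shows "2 * (\<integral>\<^sup>+x. f x * g x \<partial>M) \<le> ennreal l * (\<integral>\<^sup>+x. (f x)\<^sup>2 \<partial>M) + ennreal (1 / l) * (\<integral>\<^sup>+x. (g x)\<^sup>2 \<partial>M)"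
proof -
  have "2 * (\<integral>\<^sup>+x. f x * g x \<partial>M) = (\<integral>\<^sup>+x. 2 * (f x * g x) \<partial>M)"
    by (simp add: nn_integral_cmult)
  also have "\<dots> \<le> (\<integral>\<^sup>+x. ennreal l * (f x)\<^sup>2 + ennreal (1 / l) * (g x)\<^sup>2 \<partial>M)"
    by (intro nn_integral_mono ennreal_am_gm l)
  also have "\<dots> = ennreal l * (\<integral>\<^sup>+x. (f x)\<^sup>2 \<partial>M) + ennreal (1 / l) * (\<integral>\<^sup>+x. (g x)\<^sup>2 \<partial>M)"
    by (simp add: nn_integral_add nn_integral_cmult)
  finally show ?thesis .
qed

text \<open>
  Half of the exponent in \<open>x - z\<close> is kept for the integration in \<open>z\<close>. The other half is only
  smaller when \<open>a\<close> is replaced by \<open>b\<close>, and together with the exponent in \<open>y - z\<close> it controls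
  \<open>|x - y|\<^sup>2 \<le> 2 |x - z|\<^sup>2 + 2 |y - z|\<^sup>2\<close>.
\<close>

lemma heat_mult_le:
  fixes x y z :: "'a::euclidean_space"
  assumes a: "0 < a" and ab: "a \<le> b"
  shows "heat a (x - z) * heat b (y - z)
    \<le> 8 powr (real DIM('a) / 2) * heat (2 * a) (x - z) * heat (4 * b) (x - y)"
proof -
  define u v w where "u = (norm (x - z))\<^sup>2" and "v = (norm (y - z))\<^sup>2" and "w = (norm (x - y))\<^sup>2"
  have b: "0 < b" using a ab by simp
  have "norm (x - y) \<le> norm (x - z) + norm (y - z)"
    by (metis dist_norm dist_triangle2)
  then have "w \<le> (norm (x - z) + norm (y - z))\<^sup>2"
    unfolding w_def by (intro power_mono) auto
  also have "\<dots> \<le> 2 * u + 2 * v"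
    unfolding u_def v_def using sum_squares_bound[of "norm (x - z)" "norm (y - z)"]
    by (simp add: power2_sum)
  finally have w: "w \<le> 2 * u + 2 * v" .
  have "u / (2 * b) \<le> u / (2 * a)"
    using a ab by (intro divide_left_mono) (auto simp: u_def)
  moreover have "w / (4 * b) \<le> (2 * u + 2 * v) / (4 * b)"
    using w b by (intro divide_right_mono) auto
  moreover have "(2 * u + 2 * v) / (4 * b) = u / (2 * b) + v / (2 * b)" "v / b = v / (2 * b) + v / (2 * b)"
    "u / a = u / (2 * a) + u / (2 * a)" "v / (2 * b) \<ge> 0"
    using a b by (auto simp: field_simps v_def)
  ultimately have "u / (2 * a) + w / (4 * b) \<le> u / a + v / b" by linarith
  then have "pi * (u / (2 * a) + w / (4 * b)) \<le> pi * (u / a + v / b)"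
    by (intro mult_left_mono) auto
  then have e: "exp (- pi * u / a) * exp (- pi * v / b) \<le> exp (- pi * u / (2 * a)) * exp (- pi * w / (4 * b))"
    by (simp add: exp_add[symmetric] algebra_simps)
  have "8 powr (real DIM('a) / 2) * ((2 * a) powr (- (real DIM('a) / 2)) * (4 * b) powr (- (real DIM('a) / 2)))
      = a powr (- (real DIM('a) / 2)) * b powr (- (real DIM('a) / 2))"
  proof -
    have "(8::real) powr p = 2 powr p * 4 powr p" for p
      by (subst powr_mult[symmetric]) auto
    then show ?thesis using a b by (simp add: powr_mult powr_minus field_simps)
  qed
  then show ?thesis
    using mult_left_mono[OF e, of "a powr (- (real DIM('a) / 2)) * b powr (- (real DIM('a) / 2))"]
    unfolding heat_def u_def[symmetric] v_def[symmetric] w_def[symmetric]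
    by (simp add: ac_simps)
qed

text \<open>
  The composition of two heat kernels is at most a multiple of the flatter one at four times its
  time. The exact value is the kernel at time \<open>a + b\<close>, but here each summand depends on one time
  only, which is what allows treating \<open>t x\<close> and \<open>t y\<close> separately in \<open>linearised_adjoint_L2_le\<close>.
\<close>

lemma heat_conv_le:
  fixes x y :: "'a::euclidean_space"
  assumes a: "0 < a" and b: "0 < b"
  shows "(\<integral>\<^sup>+z. ennreal (heat a (x - z)) * ennreal (heat b (y - z)) \<partial>lborel)
    \<le> ennreal (8 powr (real DIM('a) / 2)) * (ennreal (heat (4 * a) (x - y)) + ennreal (heat (4 * b) (x - y)))"
proof -
  have *: "(\<integral>\<^sup>+z. ennreal (heat a (x - z)) * ennreal (heat b (y - z)) \<partial>lborel)
    \<le> ennreal (8 powr (real DIM('a) / 2)) * ennreal (heat (4 * b) (x - y))"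
    if a: "0 < a" "a \<le> b" for a b and x y :: 'a
  proof -
    have "(\<integral>\<^sup>+z. ennreal (heat a (x - z)) * ennreal (heat b (y - z)) \<partial>lborel)
      \<le> (\<integral>\<^sup>+z. ennreal (8 powr (real DIM('a) / 2) * heat (4 * b) (x - y)) * ennreal (heat (2 * a) (x - z)) \<partial>lborel)"
      using heat_mult_le[OF a, of x _ y]
      by (intro nn_integral_mono) (simp add: ac_simps flip: ennreal_mult)
    also have "\<dots> = ennreal (8 powr (real DIM('a) / 2) * heat (4 * b) (x - y))"
      using a by (simp add: nn_integral_cmult nn_integral_heat)
    finally show ?thesis by (simp add: ennreal_mult)
  qed
  show ?thesis
  proof (cases "a \<le> b")
    case True
    show ?thesis
      by (rule order_trans[OF *[OF a True]]) (auto intro!: mult_left_mono)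
  next
    case False
    have "(\<integral>\<^sup>+z. ennreal (heat a (x - z)) * ennreal (heat b (y - z)) \<partial>lborel)
        \<le> ennreal (8 powr (real DIM('a) / 2)) * ennreal (heat (4 * a) (y - x))"
      using *[OF b, of a y x] False by (simp add: mult.commute)
    also have "\<dots> = ennreal (8 powr (real DIM('a) / 2)) * ennreal (heat (4 * a) (x - y))"
      by (simp add: heat_commute)
    also have "\<dots> \<le> ennreal (8 powr (real DIM('a) / 2)) * (ennreal (heat (4 * a) (x - y)) + ennreal (heat (4 * b) (x - y)))"
      by (auto intro!: mult_left_mono)
    finally show ?thesis .
  qed
qed

definition hconv :: "real \<Rightarrow> ('a::euclidean_space \<Rightarrow> ennreal) \<Rightarrow> 'a \<Rightarrow> ennreal" where
  "hconv r f x = (\<integral>\<^sup>+y. ennreal (heat r (x - y)) * f y \<partial>lborel)"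

lemma hconv_measurable[measurable (raw)]:
  assumes [measurable]: "f \<in> borel_measurable borel" "p \<in> borel_measurable M" "q \<in> borel_measurable M"
  shows "(\<lambda>x. hconv (p x) f (q x)) \<in> borel_measurable M"
  unfolding hconv_def by measurable

lemma hconv_L2_le:
  fixes f :: "'a::euclidean_space \<Rightarrow> ennreal"
  assumes r: "r > 0" and [measurable]: "f \<in> borel_measurable borel"
  shows "(\<integral>\<^sup>+x. (hconv r f x)\<^sup>2 \<partial>lborel) \<le> (\<integral>\<^sup>+x. (f x)\<^sup>2 \<partial>lborel)"
proof -
  have *: "(hconv r f x)\<^sup>2 \<le> (\<integral>\<^sup>+y. ennreal (heat r (x - y)) * (f y)\<^sup>2 \<partial>lborel)" for x
  proof -
    let ?M = "density lborel (\<lambda>y. ennreal (heat r (x - y)))"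
    have "(\<integral>\<^sup>+y. f y * 1 \<partial>?M)\<^sup>2 \<le> (\<integral>\<^sup>+y. (f y)\<^sup>2 \<partial>?M) * (\<integral>\<^sup>+y. 1\<^sup>2 \<partial>?M)"
      by (rule Cauchy_Schwarz_nn_integral) measurable
    also have "(\<integral>\<^sup>+y. 1\<^sup>2 \<partial>?M) = 1"
      by (subst nn_integral_density) (simp_all add: nn_integral_heat[OF r])
    finally show ?thesis
      by (simp add: nn_integral_density hconv_def)
  qed
  have "(\<integral>\<^sup>+x. (hconv r f x)\<^sup>2 \<partial>lborel)
      \<le> (\<integral>\<^sup>+x. (\<integral>\<^sup>+y. ennreal (heat r (x - y)) * (f y)\<^sup>2 \<partial>lborel) \<partial>lborel)"
    by (intro nn_integral_mono *)
  also have "\<dots> = (\<integral>\<^sup>+y. (\<integral>\<^sup>+x. ennreal (heat r (x - y)) * (f y)\<^sup>2 \<partial>lborel) \<partial>lborel)"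
    by (rule lborel_pair.Fubini') measurable
  also have "\<dots> = (\<integral>\<^sup>+y. (f y)\<^sup>2 \<partial>lborel)"
    by (simp add: nn_integral_multc nn_integral_heat'[OF r])
  finally show ?thesis .
qed

text \<open>
  Choosing a time \<open>t x\<close> for every point linearises the maximal function. The kernel of this operator
  composed with its adjoint is \<open>\<integral> heat (t x) (x - z) * heat (t y) (y - z) dz\<close>, which is at most
  the sum of a part depending on \<open>t x\<close> and one depending on \<open>t y\<close>. By symmetry both contribute equally, and each is
  again a linearised maximal operator, at the times \<open>4 * t x\<close>.
\<close>

lemma linearised_adjoint_L2_le:
  fixes g :: "'a::euclidean_space \<Rightarrow> ennreal" and t :: "'a \<Rightarrow> real"
  assumes [measurable]: "g \<in> borel_measurable borel" "t \<in> borel_measurable borel"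
    and t: "\<And>x. t x > 0"
  shows "(\<integral>\<^sup>+z. (\<integral>\<^sup>+x. ennreal (heat (t x) (x - z)) * g x \<partial>lborel)\<^sup>2 \<partial>lborel)
    \<le> ennreal (2 * 8 powr (real DIM('a) / 2)) * (\<integral>\<^sup>+x. g x * hconv (4 * t x) g x \<partial>lborel)"
proof -
  let ?K = "ennreal (8 powr (real DIM('a) / 2))"
  have K2: "ennreal (2 * 8 powr (real DIM('a) / 2)) = ?K + ?K"
    by (subst ennreal_plus[symmetric]) auto
  let ?W = "\<integral>\<^sup>+x. g x * hconv (4 * t x) g x \<partial>lborel"
  have W: "?W = (\<integral>\<^sup>+x. (\<integral>\<^sup>+y. ennreal (heat (4 * t x) (x - y)) * (g x * g y) \<partial>lborel) \<partial>lborel)"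
    unfolding hconv_def by (simp add: nn_integral_cmult[symmetric] ac_simps)
  also have "\<dots> = (\<integral>\<^sup>+y. (\<integral>\<^sup>+x. ennreal (heat (4 * t x) (x - y)) * (g x * g y) \<partial>lborel) \<partial>lborel)"
    by (rule lborel_pair.Fubini') measurable
  finally have W': "?W = (\<integral>\<^sup>+x. (\<integral>\<^sup>+y. ennreal (heat (4 * t y) (x - y)) * (g x * g y) \<partial>lborel) \<partial>lborel)"
    by (simp add: heat_commute mult.commute)
  have "(\<integral>\<^sup>+z. (\<integral>\<^sup>+x. ennreal (heat (t x) (x - z)) * g x \<partial>lborel)\<^sup>2 \<partial>lborel)
      = (\<integral>\<^sup>+z. (\<integral>\<^sup>+x. (\<integral>\<^sup>+y. ennreal (heat (t x) (x - z)) * ennreal (heat (t y) (y - z)) * (g x * g y) \<partial>lborel) \<partial>lborel) \<partial>lborel)"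
  proof (intro nn_integral_cong)
    fix z
    let ?A = "\<lambda>x. ennreal (heat (t x) (x - z)) * g x"
    have "(\<integral>\<^sup>+x. ?A x \<partial>lborel)\<^sup>2 = (\<integral>\<^sup>+x. (\<integral>\<^sup>+y. ?A x * ?A y \<partial>lborel) \<partial>lborel)"
      by (simp add: power2_eq_square nn_integral_cmult nn_integral_multc)
    also have "\<dots> = (\<integral>\<^sup>+x. (\<integral>\<^sup>+y. ennreal (heat (t x) (x - z)) * ennreal (heat (t y) (y - z)) * (g x * g y) \<partial>lborel) \<partial>lborel)"
      by (simp add: ac_simps)
    finally show "(\<integral>\<^sup>+x. ?A x \<partial>lborel)\<^sup>2
      = (\<integral>\<^sup>+x. (\<integral>\<^sup>+y. ennreal (heat (t x) (x - z)) * ennreal (heat (t y) (y - z)) * (g x * g y) \<partial>lborel) \<partial>lborel)" .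
  qed
  also have "\<dots> = (\<integral>\<^sup>+x. (\<integral>\<^sup>+z. (\<integral>\<^sup>+y. ennreal (heat (t x) (x - z)) * ennreal (heat (t y) (y - z)) * (g x * g y) \<partial>lborel) \<partial>lborel) \<partial>lborel)"
    by (rule lborel_pair.Fubini') measurable
  also have "\<dots> = (\<integral>\<^sup>+x. (\<integral>\<^sup>+y. (\<integral>\<^sup>+z. ennreal (heat (t x) (x - z)) * ennreal (heat (t y) (y - z)) * (g x * g y) \<partial>lborel) \<partial>lborel) \<partial>lborel)"
    by (intro nn_integral_cong lborel_pair.Fubini') measurable
  also have "\<dots> = (\<integral>\<^sup>+x. (\<integral>\<^sup>+y. (\<integral>\<^sup>+z. ennreal (heat (t x) (x - z)) * ennreal (heat (t y) (y - z)) \<partial>lborel) * (g x * g y) \<partial>lborel) \<partial>lborel)"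
    by (intro nn_integral_cong nn_integral_multc) measurable
  also have "\<dots> \<le> (\<integral>\<^sup>+x. (\<integral>\<^sup>+y. ?K * (ennreal (heat (4 * t x) (x - y)) + ennreal (heat (4 * t y) (x - y))) * (g x * g y) \<partial>lborel) \<partial>lborel)"
    by (intro nn_integral_mono mult_right_mono heat_conv_le t) auto
  also have "\<dots> = (\<integral>\<^sup>+x. (\<integral>\<^sup>+y. ?K * (ennreal (heat (4 * t x) (x - y)) * (g x * g y))
      + ?K * (ennreal (heat (4 * t y) (x - y)) * (g x * g y)) \<partial>lborel) \<partial>lborel)"
    by (simp add: distrib_left distrib_right mult.assoc)
  also have "\<dots> = ?K * ?W + ?K * ?W"
    by (subst (1) W, subst W') (simp add: nn_integral_add nn_integral_cmult)
  also have "\<dots> = ennreal (2 * 8 powr (real DIM('a) / 2)) * ?W"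
    by (subst K2) (rule distrib_right[symmetric])
  finally show ?thesis .
qed

text \<open>
  The linearisation needs a measurable choice of a time at which the maximum over a finite set of
  times is attained.
\<close>

lemma measurable_argmax:
  fixes u :: "'r \<Rightarrow> 'a \<Rightarrow> ennreal"
  assumes "finite S" "S \<noteq> {}" and [measurable]: "\<And>r. u r \<in> borel_measurable M"
  shows "\<exists>t. t \<in> measurable M (count_space UNIV) \<and> (\<lambda>x. u (t x) x) \<in> borel_measurable M
      \<and> (\<forall>x. t x \<in> S \<and> (\<forall>q\<in>S. u q x \<le> u (t x) x))"
  using assms(1,2)
proof (induction rule: finite_ne_induct)
  case (singleton s)
  show ?case by (intro exI[of _ "\<lambda>_. s"]) auto
next
  case (insert s S)
  then obtain t where t[measurable]: "t \<in> measurable M (count_space UNIV)"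
      "(\<lambda>x. u (t x) x) \<in> borel_measurable M"
    and tS: "\<And>x. t x \<in> S" "\<And>x q. q \<in> S \<Longrightarrow> u q x \<le> u (t x) x" by blast
  let ?t = "\<lambda>x. if u (t x) x \<le> u s x then s else t x"
  have "?t \<in> measurable M (count_space UNIV)" by measurable
  moreover have "(\<lambda>x. u (?t x) x) = (\<lambda>x. if u (t x) x \<le> u s x then u s x else u (t x) x)" by auto
  then have "(\<lambda>x. u (?t x) x) \<in> borel_measurable M" by simp
  moreover have "?t x \<in> insert s S \<and> (\<forall>q\<in>insert s S. u q x \<le> u (?t x) x)" for x
    using tS by (auto intro: order_trans)
  ultimately show ?case by (intro exI[of _ ?t]) blast
qed

text \<open>
  The bound \<open>C\<close> is required simultaneously for all sets of at most \<open>N\<close> times, because the argument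
  below passes from a set of times to its dilate by \<open>4\<close>. The dilate is a different set of the same
  cardinality.
\<close>

definition heat_max_bound :: "'a::euclidean_space itself \<Rightarrow> nat \<Rightarrow> real \<Rightarrow> bool" where
  "heat_max_bound _ N C \<longleftrightarrow> (\<forall>S. finite S \<and> S \<noteq> {} \<and> S \<subseteq> {0<..} \<and> card S \<le> N \<longrightarrow>
     (\<forall>f \<in> borel_measurable borel. (\<integral>\<^sup>+x. (SUP r\<in>S. (hconv r f (x::'a))\<^sup>2) \<partial>lborel)
        \<le> ennreal C * (\<integral>\<^sup>+x. (f x)\<^sup>2 \<partial>lborel)))"

lemma heat_max_bound_card: "heat_max_bound TYPE('a::euclidean_space) N (real N)"
  unfolding heat_max_bound_def
proof (intro allI impI ballI, elim conjE)
  fix S :: "real set" and f :: "'a \<Rightarrow> ennreal"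
  assume S: "finite S" "S \<noteq> {}" "S \<subseteq> {0<..}" "card S \<le> N" and [measurable]: "f \<in> borel_measurable borel"
  have "(\<integral>\<^sup>+x. (SUP r\<in>S. (hconv r f x)\<^sup>2) \<partial>lborel) \<le> (\<integral>\<^sup>+x. (\<Sum>r\<in>S. (hconv r f x)\<^sup>2) \<partial>lborel)"
    using S by (intro nn_integral_mono SUP_least member_le_sum) auto
  also have "\<dots> = (\<Sum>r\<in>S. \<integral>\<^sup>+x. (hconv r f x)\<^sup>2 \<partial>lborel)"
    by (rule nn_integral_sum) measurable
  also have "\<dots> \<le> (\<Sum>r\<in>S. \<integral>\<^sup>+x. (f x)\<^sup>2 \<partial>lborel)"
    using S by (intro sum_mono hconv_L2_le) auto
  also have "\<dots> = of_nat (card S) * (\<integral>\<^sup>+x. (f x)\<^sup>2 \<partial>lborel)" by simp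
  also have "\<dots> \<le> ennreal (real N) * (\<integral>\<^sup>+x. (f x)\<^sup>2 \<partial>lborel)"
    using S by (intro mult_right_mono) (auto simp: ennreal_of_nat_eq_real_of_nat)
  finally show "(\<integral>\<^sup>+x. (SUP r\<in>S. (hconv r f x)\<^sup>2) \<partial>lborel) \<le> ennreal (real N) * (\<integral>\<^sup>+x. (f x)\<^sup>2 \<partial>lborel)" .
qed

text \<open>
  With \<open>X = \<parallel>M f\<parallel>\<^sup>2\<close> and \<open>F = \<parallel>f\<parallel>\<^sup>2\<close> (squared \<open>L\<^sup>2\<close> norms), duality and the bound for the
  linearised adjoint give, up to constants, \<open>X\<^sup>2 \<le> F * \<langle>M f, M' (M f)\<rangle> \<le> F * sqrt C * X\<close>, where
  \<open>M'\<close> is the maximal function over the dilated set of times and also has bound \<open>C\<close>. Hence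
  \<open>sqrt C\<close>, up to a constant, is a bound as well. For large \<open>C\<close> this is better than \<open>C / 2\<close>. The
  square roots are avoided by weighted arithmetic-geometric means.
\<close>

lemma heat_max_bound_half:
  assumes C: "heat_max_bound TYPE('a::euclidean_space) N C"
    and C_ge: "C \<ge> 16 * (8 powr (real DIM('a) / 2))\<^sup>2"
  shows "heat_max_bound TYPE('a) N (C / 2)"
  unfolding heat_max_bound_def
proof (intro allI impI ballI, elim conjE)
  fix S :: "real set" and f :: "'a \<Rightarrow> ennreal"
  assume S: "finite S" "S \<noteq> {}" "S \<subseteq> {0<..}" "card S \<le> N" and f[measurable]: "f \<in> borel_measurable borel"
  define D where "D = 2 * 8 powr (real DIM('a) / 2)"
  have D0: "D > 0" by (simp add: D_def)
  have CD: "C \<ge> 4 * D\<^sup>2" using C_ge by (simp add: D_def power_mult_distrib)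
  with D0 have C0: "C > 0" by (smt (verit) zero_less_power)
  \<comment> \<open>The maximum is attained at the time \<open>t x\<close>, so \<open>g\<close> is the maximal function itself.\<close>
  obtain t where t0: "t \<in> measurable borel (count_space UNIV)"
      "(\<lambda>x. hconv (t x) f x) \<in> borel_measurable borel"
    and tS: "\<And>x. t x \<in> S" "\<And>x q. q \<in> S \<Longrightarrow> hconv q f x \<le> hconv (t x) f x"
    using measurable_argmax[OF S(1,2), of "\<lambda>r. hconv r f" borel] by (auto simp: f)
  have [measurable]: "t \<in> borel_measurable borel"
    using measurable_compose[OF t0(1), of "\<lambda>x. x" borel] by simp
  have t: "t x > 0" for x using tS(1)[of x] S(3) by auto
  define g where "g x = hconv (t x) f x" for x
  have [measurable]: "g \<in> borel_measurable borel" unfolding g_def by measurable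
  have sup: "(SUP r\<in>S. (hconv r f x)\<^sup>2) = (g x)\<^sup>2" for x
    unfolding g_def using tS by (intro antisym SUP_least SUP_upper2[of "t x"] power_mono) auto
  define X F Y W Z where "X = (\<integral>\<^sup>+x. (g x)\<^sup>2 \<partial>lborel)" and "F = (\<integral>\<^sup>+x. (f x)\<^sup>2 \<partial>lborel)"
    and "Y = (\<integral>\<^sup>+z. (\<integral>\<^sup>+x. ennreal (heat (t x) (x - z)) * g x \<partial>lborel)\<^sup>2 \<partial>lborel)"
    and "W = (\<integral>\<^sup>+x. g x * hconv (4 * t x) g x \<partial>lborel)"
    and "Z = (\<integral>\<^sup>+x. (hconv (4 * t x) g x)\<^sup>2 \<partial>lborel)"
  have XF: "X \<le> ennreal C * F"
    using C S f unfolding heat_max_bound_def X_def F_def sup[symmetric] by blast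
  have ZX: "Z \<le> ennreal C * X"
  proof -
    have "Z \<le> (\<integral>\<^sup>+x. (SUP r\<in>(*) 4 ` S. (hconv r g x)\<^sup>2) \<partial>lborel)"
      unfolding Z_def using tS by (intro nn_integral_mono SUP_upper) auto
    also have "\<dots> \<le> ennreal C * X"
      using C S unfolding heat_max_bound_def X_def
      by (auto elim!: allE[of _ "(*) 4 ` S"] simp: card_image inj_on_def dest!: bspec[of _ _ g])
    finally show ?thesis .
  qed
  have YW: "Y \<le> ennreal D * W"
    unfolding Y_def W_def D_def by (rule linearised_adjoint_L2_le) (auto simp: t)
  \<comment> \<open>The weight \<open>2 * D\<close> makes the total factor of \<open>X\<close> on the right of the last estimate at most one when \<open>C \<ge> 4 * D\<^sup>2\<close>.\<close>
  have W: "2 * W \<le> ennreal (2 * D) * X + ennreal (1 / (2 * D)) * Z"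
    unfolding W_def X_def Z_def using D0 by (intro nn_integral_am_gm) auto
  have "X = (\<integral>\<^sup>+x. (\<integral>\<^sup>+z. g x * (ennreal (heat (t x) (x - z)) * f z) \<partial>lborel) \<partial>lborel)"
    unfolding X_def power2_eq_square by (simp add: nn_integral_cmult) (simp add: g_def hconv_def)
  also have "\<dots> = (\<integral>\<^sup>+z. (\<integral>\<^sup>+x. g x * (ennreal (heat (t x) (x - z)) * f z) \<partial>lborel) \<partial>lborel)"
    by (rule lborel_pair.Fubini') measurable
  also have "\<dots> = (\<integral>\<^sup>+z. f z * (\<integral>\<^sup>+x. ennreal (heat (t x) (x - z)) * g x \<partial>lborel) \<partial>lborel)"
    by (intro nn_integral_cong, subst nn_integral_cmult[symmetric]) (auto simp: ac_simps)
  finally have X_eq: "X = (\<integral>\<^sup>+z. f z * (\<integral>\<^sup>+x. ennreal (heat (t x) (x - z)) * g x \<partial>lborel) \<partial>lborel)" .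
  have X2: "2 * X \<le> ennreal (C / 2) * F + ennreal (1 / (C / 2)) * Y"
    unfolding X_eq F_def Y_def using C0 by (intro nn_integral_am_gm) auto
  show "(\<integral>\<^sup>+x. (SUP r\<in>S. (hconv r f x)\<^sup>2) \<partial>lborel) \<le> ennreal (C / 2) * (\<integral>\<^sup>+x. (f x)\<^sup>2 \<partial>lborel)"
  proof (cases "F = \<infinity>")
    case True
    then show ?thesis using C0 by (simp add: F_def[symmetric] ennreal_mult_top)
  next
    case False
    \<comment> \<open>If \<open>F\<close> is finite, so is \<open>X\<close>, by the bound \<open>C\<close>. This allows absorbing \<open>X\<close> on the right.\<close>
    obtain F' where F': "F = ennreal F'" "F' \<ge> 0" using False by (cases F) auto
    have "X < \<infinity>" by (rule le_less_trans[OF XF]) (simp add: F' ennreal_mult_less_top)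
    then obtain X' where X': "X = ennreal X'" "X' \<ge> 0" by (cases X) auto
    have "Z < \<infinity>" by (rule le_less_trans[OF ZX]) (simp add: X' ennreal_mult_less_top)
    then obtain Z' where Z': "Z = ennreal Z'" "Z' \<ge> 0" by (cases Z) auto
    have "2 * W < \<infinity>"
      by (rule le_less_trans[OF W]) (use X' Z' D0 in \<open>simp add: ennreal_mult_less_top\<close>)
    then obtain W' where W': "W = ennreal W'" "W' \<ge> 0" by (cases W) (auto simp: ennreal_mult_top)
    have "Y < \<infinity>" by (rule le_less_trans[OF YW]) (simp add: W' ennreal_mult_less_top)
    then obtain Y' where Y': "Y = ennreal Y'" "Y' \<ge> 0" by (cases Y) auto
    have two: "(2::ennreal) = ennreal 2" by simp
    have r1: "Z' \<le> C * X'" using ZX X' Z' C0 by (simp add: ennreal_mult[symmetric])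
    have r2: "Y' \<le> D * W'" using YW Y' W' D0 by (simp add: ennreal_mult[symmetric])
    have r3: "2 * W' \<le> 2 * D * X' + 1 / (2 * D) * Z'"
      using W X' Z' W' D0 unfolding two by (simp add: ennreal_mult[symmetric] ennreal_plus[symmetric] del: ennreal_plus ennreal_numeral)
    have r4: "2 * X' \<le> C / 2 * F' + 1 / (C / 2) * Y'"
      using X2 X' F' Y' C0 unfolding two by (simp add: ennreal_mult[symmetric] ennreal_plus[symmetric] del: ennreal_plus ennreal_numeral)
    have "4 * D * W' \<le> 4 * D\<^sup>2 * X' + Z'"
      using mult_left_mono[OF r3, of "2 * D"] D0 by (simp add: power2_eq_square algebra_simps)
    also have "\<dots> \<le> C * X' + C * X'"
      using r1 mult_right_mono[OF CD X'(2)] by linarith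
    finally have "2 * Y' \<le> C * X'" using r2 by linarith
    then have "1 / (C / 2) * Y' \<le> X'" using C0 by (simp add: field_simps)
    with r4 have "X' \<le> C / 2 * F'" by linarith
    then show ?thesis
      unfolding sup X_def[symmetric] F_def[symmetric] using X' F' C0 by (simp add: ennreal_mult[symmetric])
  qed
qed

text \<open>
  Starting from the trivial bound \<open>N\<close>, halving can be repeated until the bound falls below a
  constant depending on the dimension only.
\<close>

lemma heat_max_bound_uniform:
  "heat_max_bound TYPE('a::euclidean_space) N (16 * (8 powr (real DIM('a) / 2))\<^sup>2)"
proof -
  define D where "D = 16 * (8 powr (real DIM('a) / 2))\<^sup>2"
  have D: "D > 0" by (simp add: D_def)
  obtain k :: nat where "real N / D < 2 ^ k" using real_arch_pow[of 2 "real N / D"] by auto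
  then have k: "real N \<le> D * 2 ^ k" using D by (simp add: field_simps)
  have "heat_max_bound TYPE('a) N (D * 2 ^ k)"
    using heat_max_bound_card[where 'a='a, of N] ennreal_leI[OF k] unfolding heat_max_bound_def
    by (meson mult_right_mono order_trans zero_le)
  then have "heat_max_bound TYPE('a) N D"
  proof (induction k)
    case (Suc k)
    have "D * 1 \<le> D * 2 ^ Suc k" using D by (intro mult_left_mono one_le_power) auto
    then have "heat_max_bound TYPE('a) N (D * 2 ^ Suc k / 2)"
      using heat_max_bound_half[OF Suc.prems] by (simp only: D_def mult_1_right)
    then show ?case by (intro Suc.IH) simp
  qed simp
  then show ?thesis by (simp add: D_def)
qed

text \<open>
  The square of the maximal function over dyadic times. Squaring inside the supremum keeps the
  passage to the limit over finite sets of times a plain monotone convergence argument.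
\<close>

definition heat_max2 :: "('a::euclidean_space \<Rightarrow> ennreal) \<Rightarrow> 'a \<Rightarrow> ennreal" where
  "heat_max2 f x = (SUP k::int. (hconv (2 powr of_int k) f x)\<^sup>2)"

lemma heat_max2_measurable[measurable (raw)]:
  assumes [measurable]: "f \<in> borel_measurable borel"
  shows "heat_max2 f \<in> borel_measurable borel"
  unfolding heat_max2_def by measurable

lemma heat_max2_L1:
  fixes f :: "'a::euclidean_space \<Rightarrow> ennreal"
  assumes [measurable]: "f \<in> borel_measurable borel"
  shows "(\<integral>\<^sup>+x. heat_max2 f x \<partial>lborel) \<le> ennreal (16 * (8 powr (real DIM('a) / 2))\<^sup>2) * (\<integral>\<^sup>+x. (f x)\<^sup>2 \<partial>lborel)"
proof -
  define A where "A n x = (SUP k\<in>{- int n..int n}. (hconv (2 powr of_int k) f x)\<^sup>2)" for n x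
  have [measurable]: "A n \<in> borel_measurable borel" for n unfolding A_def by measurable
  have "heat_max2 f x = (SUP n. A n x)" for x
  proof (rule antisym)
    show "heat_max2 f x \<le> (SUP n. A n x)"
      unfolding heat_max2_def A_def
    proof (rule SUP_least)
      fix k :: int
      show "(hconv (2 powr of_int k) f x)\<^sup>2 \<le> (SUP n. SUP k\<in>{- int n..int n}. (hconv (2 powr of_int k) f x)\<^sup>2)"
        by (rule SUP_upper2[of "nat \<bar>k\<bar>"], simp, rule SUP_upper) auto
    qed
    show "(SUP n. A n x) \<le> heat_max2 f x"
      unfolding heat_max2_def A_def by (intro SUP_least SUP_upper) auto
  qed
  then have "(\<integral>\<^sup>+x. heat_max2 f x \<partial>lborel) = (\<integral>\<^sup>+x. (SUP n. A n x) \<partial>lborel)" by simp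
  also have "\<dots> = (SUP n. \<integral>\<^sup>+x. A n x \<partial>lborel)"
    by (rule nn_integral_monotone_convergence_SUP)
       (auto simp: incseq_def le_fun_def A_def intro!: SUP_subset_mono)
  also have "\<dots> \<le> ennreal (16 * (8 powr (real DIM('a) / 2))\<^sup>2) * (\<integral>\<^sup>+x. (f x)\<^sup>2 \<partial>lborel)"
  proof (rule SUP_least)
    fix n
    let ?S = "(\<lambda>k::int. 2 powr real_of_int k) ` {- int n..int n}"
    have "(\<integral>\<^sup>+x. A n x \<partial>lborel) = (\<integral>\<^sup>+x. (SUP r\<in>?S. (hconv r f x)\<^sup>2) \<partial>lborel)"
      by (simp add: A_def image_comp)
    also have "\<dots> \<le> ennreal (16 * (8 powr (real DIM('a) / 2))\<^sup>2) * (\<integral>\<^sup>+x. (f x)\<^sup>2 \<partial>lborel)"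
      using heat_max_bound_uniform[where 'a='a, of "card ?S"] assms
      unfolding heat_max_bound_def by (auto elim!: allE[of _ ?S])
    finally show "(\<integral>\<^sup>+x. A n x \<partial>lborel) \<le> ennreal (16 * (8 powr (real DIM('a) / 2))\<^sup>2) * (\<integral>\<^sup>+x. (f x)\<^sup>2 \<partial>lborel)" .
  qed
  finally show ?thesis .
qed

text \<open>
  Rounding \<open>r\<close> up to a power of two decreases the normalising power by a factor of at most
  \<open>2 powr (n / 2)\<close> and increases the exponential.
\<close>

lemma hconv_le_heat_max2:
  fixes f :: "'a::euclidean_space \<Rightarrow> ennreal"
  assumes r: "r > 0" and [measurable]: "f \<in> borel_measurable borel"
  shows "(hconv r f x)\<^sup>2 \<le> ennreal (2 powr real DIM('a)) * heat_max2 f x"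
proof -
  define k where "k = \<lceil>log 2 r\<rceil>"
  define q where "q = 2 powr real_of_int k"
  have "log 2 r \<le> real_of_int k" "real_of_int k < log 2 r + 1" unfolding k_def by linarith+
  then have q: "r \<le> q" "q \<le> 2 * r" "q > 0"
    using r by (auto simp: q_def log_le_iff le_log_iff powr_add less_imp_le log_less_iff less_log_iff
        intro: order_trans[OF less_imp_le[OF powr_less_mono[of _ "log 2 r + 1" 2]]])
  have "heat r z \<le> 2 powr (real DIM('a) / 2) * heat q z" for z :: 'a
  proof -
    have "r powr (- (real DIM('a) / 2)) \<le> (q / 2) powr (- (real DIM('a) / 2))"
      using q r by (intro powr_mono2') auto
    also have "\<dots> = 2 powr (real DIM('a) / 2) * q powr (- (real DIM('a) / 2))"
      using q by (simp add: powr_divide powr_minus field_simps)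
    finally have 1: "r powr (- (real DIM('a) / 2)) \<le> \<dots>" .
    have "(norm z)\<^sup>2 / q \<le> (norm z)\<^sup>2 / r"
      using q r by (intro divide_left_mono) auto
    then have 2: "exp (- pi * (norm z)\<^sup>2 / r) \<le> exp (- pi * (norm z)\<^sup>2 / q)"
      using mult_left_mono[of "(norm z)\<^sup>2 / q" "(norm z)\<^sup>2 / r" pi] by simp
    show ?thesis unfolding heat_def
      using mult_mono[OF 1 2] by (simp add: mult.assoc)
  qed
  then have "hconv r f x \<le> (\<integral>\<^sup>+y. ennreal (2 powr (real DIM('a) / 2)) * (ennreal (heat q (x - y)) * f y) \<partial>lborel)"
    unfolding hconv_def mult.assoc[symmetric]
    by (intro nn_integral_mono mult_right_mono) (auto simp flip: ennreal_mult)
  also have "\<dots> = ennreal (2 powr (real DIM('a) / 2)) * hconv q f x"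
    unfolding hconv_def by (rule nn_integral_cmult) measurable
  finally have "(hconv r f x)\<^sup>2 \<le> (ennreal (2 powr (real DIM('a) / 2)) * hconv q f x)\<^sup>2"
    by (intro power_mono) auto
  also have "\<dots> = ennreal (2 powr real DIM('a)) * (hconv q f x)\<^sup>2"
    by (simp add: power_mult_distrib ennreal_power) (simp add: power2_eq_square flip: powr_add)
  also have "\<dots> \<le> ennreal (2 powr real DIM('a)) * heat_max2 f x"
    unfolding heat_max2_def q_def by (intro mult_left_mono SUP_upper) auto
  finally show ?thesis .
qed

section \<open>Bessel functions as entire functions of the square\<close>

definition bcoeff :: "real \<Rightarrow> nat \<Rightarrow> real" where
  "bcoeff a k = rGamma (real k + a + 1) / (fact k * (- 4) ^ k)"

text \<open>
  This entire function is the Bessel function without its power factor: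
  \<open>J\<^sub>a x = (x / 2) powr a * besselB a (x\<^sup>2)\<close> for \<open>x > 0\<close>. As a function of \<open>r = x\<^sup>2\<close> it satisfies
  \<open>r B'' + (a + 1) B' + B / 4 = 0\<close>.
\<close>

definition besselB :: "real \<Rightarrow> real \<Rightarrow> real" where
  "besselB a r = (\<Sum>k. bcoeff a k * r ^ k)"

definition besselB' :: "real \<Rightarrow> real \<Rightarrow> real" where
  "besselB' a r = - besselB (a + 1) r / 4"

lemma rGamma_shift: "rGamma (real k + a + 1) = (real k + a + 1) * rGamma (real k + (a + 1) + 1)"
  using rGamma_plus1[of "real k + a + 1"] by (simp add: add.assoc)

lemma bcoeff_Suc: "bcoeff a (Suc k) = - bcoeff (a + 1) k / (4 * (real k + 1))"
  by (simp add: bcoeff_def add_ac)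

lemma bcoeff_shift: "bcoeff a k = (real k + a + 1) * bcoeff (a + 1) k"
  unfolding bcoeff_def by (subst rGamma_shift) simp

lemma bcoeff_ratio: "bcoeff a k = - (4 * (real k + 1) * (real k + a + 1)) * bcoeff a (Suc k)"
  unfolding bcoeff_Suc by (subst bcoeff_shift) (simp add: field_simps)

lemma summable_besselB: "summable (\<lambda>k. bcoeff a k * r ^ k)"
proof (rule summable_ratio_test)
  fix k assume k: "k \<ge> nat \<lceil>\<bar>r\<bar>\<rceil> + nat \<lceil>\<bar>a\<bar>\<rceil> + 1"
  then have k': "real k \<ge> \<bar>r\<bar> + \<bar>a\<bar> + 1" by linarith
  have "\<bar>r\<bar> * 1 \<le> (real k + 1) * (real k + a + 1)"
    using k' by (intro mult_mono) linarith+
  then have "2 * \<bar>r\<bar> \<le> 4 * (real k + 1) * (real k + a + 1)" by linarith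
  then have "2 * \<bar>r\<bar> * \<bar>bcoeff a (Suc k)\<bar> \<le> 4 * (real k + 1) * (real k + a + 1) * \<bar>bcoeff a (Suc k)\<bar>"
    by (rule mult_right_mono) auto
  also have "\<dots> = \<bar>bcoeff a k\<bar>"
    unfolding bcoeff_ratio[of a k] using k' by (simp add: abs_mult)
  finally have "2 * (\<bar>r\<bar> * \<bar>bcoeff a (Suc k)\<bar>) \<le> \<bar>bcoeff a k\<bar>"
    by (simp add: mult.assoc)
  then show "norm (bcoeff a (Suc k) * r ^ Suc k) \<le> (1 / 2) * norm (bcoeff a k * r ^ k)"
    using mult_right_mono[of "2 * (\<bar>r\<bar> * \<bar>bcoeff a (Suc k)\<bar>)" "\<bar>bcoeff a k\<bar>" "\<bar>r\<bar> ^ k"]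
    by (simp add: abs_mult power_abs field_simps)
qed simp

lemma summable_abs_besselB: "summable (\<lambda>k. \<bar>bcoeff a k\<bar> * \<bar>r\<bar> ^ k)"
  using powser_insidea[OF summable_besselB[of a "\<bar>r\<bar> + 1"], of r]
  by (simp add: abs_mult power_abs)

lemma besselB_deriv:
  "(besselB a has_field_derivative besselB' a r) (at r)"
proof -
  have "diffs (bcoeff a) k = - (1 / 4) * bcoeff (a + 1) k" for k
    by (simp add: diffs_def bcoeff_Suc field_simps)
  then have "(\<Sum>k. diffs (bcoeff a) k * r ^ k) = - (1 / 4) * besselB (a + 1) r"
    unfolding besselB_def by (subst suminf_mult[symmetric]) (auto simp: summable_besselB mult.assoc)
  then show ?thesis
    using termdiffs_strong_converges_everywhere[of "bcoeff a" r] summable_besselB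
    unfolding besselB_def[abs_def] besselB'_def by simp
qed

lemma besselB'_deriv: "(besselB' a has_field_derivative (besselB (a + 2) r / 16)) (at r)"
  unfolding besselB'_def[abs_def]
  by (auto intro!: derivative_eq_intros besselB_deriv simp: besselB'_def add.assoc)

text \<open>
  Differentiation shifts the order by one, so \<open>besselB (a + 2) r / 16\<close> is the second derivative
  and this is the Bessel equation in the variable \<open>r = x\<^sup>2\<close>.
\<close>

lemma besselB_ODE: "r * (besselB (a + 2) r / 16) = - ((a + 1) * besselB' a r + besselB a r / 4)"
proof -
  have 0: "bcoeff a 0 = (a + 1) * bcoeff (a + 1) 0"
    by (subst bcoeff_shift) simp
  have S: "bcoeff a (Suc k) = (a + 1) * bcoeff (a + 1) (Suc k) - bcoeff (a + 2) k / 4" for k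
  proof -
    have "bcoeff a (Suc k) = (real (Suc k) + a + 1) * bcoeff (a + 1) (Suc k)"
      by (rule bcoeff_shift)
    also have "real (Suc k) * bcoeff (a + 1) (Suc k) = - bcoeff (a + 2) k / 4"
      by (subst bcoeff_Suc) (simp add: field_simps)
    then have "(real (Suc k) + a + 1) * bcoeff (a + 1) (Suc k) = (a + 1) * bcoeff (a + 1) (Suc k) - bcoeff (a + 2) k / 4"
      by (simp only: distrib_right add.assoc)
    finally show ?thesis .
  qed
  have sh: "summable (\<lambda>k. bcoeff b (Suc k) * r ^ k)" for b
    using summable_besselB[of b r] by (simp add: summable_powser_split_head)
  have "(\<Sum>k. bcoeff a (Suc k) * r ^ k) = (\<Sum>k. (a + 1) * (bcoeff (a + 1) (Suc k) * r ^ k) - (bcoeff (a + 2) k * r ^ k) / 4)"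
    by (simp add: S algebra_simps)
  also have "\<dots> = (a + 1) * (\<Sum>k. bcoeff (a + 1) (Suc k) * r ^ k) - besselB (a + 2) r / 4"
    unfolding besselB_def
    by (subst suminf_diff[symmetric]) (auto intro!: sh summable_besselB summable_mult summable_divide
        simp: suminf_mult[OF sh] suminf_divide[OF summable_besselB])
  finally have *: "(\<Sum>k. bcoeff a (Suc k) * r ^ k) = \<dots>" .
  have B0: "besselB a r = bcoeff a 0 + (\<Sum>k. bcoeff a (Suc k) * r ^ k) * r"
    unfolding besselB_def by (rule powser_split_head(1)[OF summable_besselB])
  have B1: "besselB (a + 1) r = bcoeff (a + 1) 0 + (\<Sum>k. bcoeff (a + 1) (Suc k) * r ^ k) * r"
    unfolding besselB_def by (rule powser_split_head(1)[OF summable_besselB])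
  have "besselB a r = (a + 1) * besselB (a + 1) r - r / 4 * besselB (a + 2) r"
    unfolding B0 * B1 0 by (simp add: algebra_simps)
  then show ?thesis by (simp add: besselB'_def field_simps)
qed

lemma besselB_continuous: "continuous_on S (besselB a)"
  using besselB_deriv[of a] DERIV_isCont continuous_at_imp_continuous_on by blast

lemma besselB_measurable[measurable]: "besselB a \<in> borel_measurable borel"
  by (intro borel_measurable_continuous_onI besselB_continuous)

lemma besselB'_measurable[measurable]: "besselB' a \<in> borel_measurable borel"
  unfolding besselB'_def[abs_def] by measurable

lemma Bessel_J_eq:
  assumes x: "x > 0"
  shows "Bessel_J \<nu> x = (x / 2) powr \<nu> * besselB \<nu> (x\<^sup>2)"
proof -
  have "(-1) ^ k / fact k * rGamma (real k + \<nu> + 1) * (x / 2) powr (2 * real k + \<nu>)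
      = (x / 2) powr \<nu> * (bcoeff \<nu> k * (x\<^sup>2) ^ k)" for k
  proof -
    have "(x / 2) powr (2 * real k) = (x / 2) ^ (2 * k)"
      using x by (subst powr_realpow[symmetric]) auto
    also have "\<dots> = (x\<^sup>2 / 4) ^ k" by (simp add: power_mult power_divide)
    finally have "(x / 2) powr (2 * real k + \<nu>) = (x / 2) powr \<nu> * (x\<^sup>2 / 4) ^ k"
      by (simp add: powr_add)
    moreover have "(- 4) ^ k = (- 1) ^ k * (4::real) ^ k"
      by (simp add: power_mult_distrib[symmetric])
    ultimately show ?thesis by (simp add: bcoeff_def power_divide field_simps)
  qed
  then show ?thesis
    unfolding Bessel_J_def besselB_def by (simp add: suminf_mult summable_besselB)
qed

lemma omega_eq_besselB:
  assumes t: "t > 0"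
  shows "omega n \<mu> t = Gamma (\<mu> + real n + 1) / 2 * besselB (\<mu> + real n) t"
proof -
  define \<nu> where "\<nu> = \<mu> + real n"
  have "(t powr (1 / 2) / 2) powr \<nu> = t powr (\<nu> / 2) / 2 powr \<nu>"
    using t by (simp add: powr_divide powr_powr)
  moreover have "(t powr (1 / 2))\<^sup>2 = t" using t by (simp add: powr_half_sqrt)
  ultimately have J: "Bessel_J \<nu> (t powr (1 / 2)) = t powr (\<nu> / 2) / 2 powr \<nu> * besselB \<nu> t"
    using t by (simp add: Bessel_J_eq)
  have "2 powr (\<nu> - 1) * G * (t powr (\<nu> / 2) / 2 powr \<nu> * x / t powr (\<nu> / 2)) = G / 2 * x" for G x :: real
    using t by (simp add: powr_diff)
  then show ?thesis
    using t unfolding omega_def \<nu>_def[symmetric] by (simp only: abs_of_pos J)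
qed

section \<open>The energy of Bessel's equation\<close>

text \<open>
  By the differential equation, \<open>B\<^sup>2 / 4 + r B'\<^sup>2\<close> has the derivative \<open>- (2 a + 1) B'\<^sup>2\<close>.
\<close>

lemma bessel_energy_antimono:
  assumes a: "a \<ge> - 1 / 2" and "p \<le> q"
  shows "(besselB a q)\<^sup>2 / 4 + q * (besselB' a q)\<^sup>2 \<le> (besselB a p)\<^sup>2 / 4 + p * (besselB' a p)\<^sup>2"
proof (rule DERIV_nonpos_imp_nonincreasing[OF assms(2)])
  fix x
  let ?E = "\<lambda>r. (besselB a r)\<^sup>2 / 4 + r * (besselB' a r)\<^sup>2"
  define b where "b = besselB (a + 2) x / 16"
  have d1: "(?E has_field_derivative (besselB a x * besselB' a x / 2
      + ((besselB' a x)\<^sup>2 + 2 * besselB' a x * (x * b)))) (at x)"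
    unfolding b_def
    by (auto intro!: derivative_eq_intros besselB_deriv besselB'_deriv)
  have d2: "besselB a x * besselB' a x / 2 + ((besselB' a x)\<^sup>2 + 2 * besselB' a x * (x * b))
      = - (2 * a + 1) * (besselB' a x)\<^sup>2"
    unfolding b_def besselB_ODE by (simp add: algebra_simps power2_eq_square)
  have d3: "- (2 * a + 1) * (besselB' a x)\<^sup>2 \<le> 0"
    using a by (intro mult_nonpos_nonneg) auto
  show "\<exists>y. (?E has_field_derivative y) (at x) \<and> y \<le> 0"
    using d1[unfolded d2] d3 by blast
qed

lemma bessel_energy_le:
  assumes a: "a \<ge> - 1 / 2" and r: "r \<ge> 0"
  shows "(besselB a r)\<^sup>2 / 4 + r * (besselB' a r)\<^sup>2 \<le> (besselB a 0)\<^sup>2 / 4"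
  using bessel_energy_antimono[OF a r] by simp

lemma besselB_bound:
  assumes a: "a \<ge> - 1 / 2" and r: "r \<ge> 0"
  shows "\<bar>besselB a r\<bar> \<le> \<bar>besselB a 0\<bar>"
proof -
  have "0 \<le> r * (besselB' a r)\<^sup>2" using r by simp
  with bessel_energy_le[OF a r] have "(besselB a r)\<^sup>2 \<le> (besselB a 0)\<^sup>2" by linarith
  then show ?thesis by (rule abs_le_square_iff[THEN iffD2])
qed

lemma nn_integral_atLeast1_bounded:
  fixes f F h :: "real \<Rightarrow> real"
  assumes [measurable]: "f \<in> borel_measurable borel" "h \<in> borel_measurable borel"
    and deriv: "\<And>x. x \<ge> 1 \<Longrightarrow> (F has_field_derivative f x) (at x)"
    and nn: "\<And>x. x \<ge> 1 \<Longrightarrow> 0 \<le> f x" "\<And>x. x \<ge> 1 \<Longrightarrow> h x \<le> f x"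
    and bd: "\<And>x. x \<ge> 1 \<Longrightarrow> \<bar>F x\<bar> \<le> C"
  shows "(\<integral>\<^sup>+x. ennreal (h x) * indicator {1..} x \<partial>lborel) \<le> ennreal (2 * C)"
proof -
  have "(SUP n::nat. ennreal (f x) * indicator {1..1 + real n} x) = ennreal (f x) * indicator {1..} x" for x
  proof (rule antisym)
    show "(SUP n::nat. ennreal (f x) * indicator {1..1 + real n} x) \<le> ennreal (f x) * indicator {1..} x"
      by (intro SUP_least) (auto split: split_indicator)
    show "ennreal (f x) * indicator {1..} x \<le> (SUP n::nat. ennreal (f x) * indicator {1..1 + real n} x)"
      by (rule SUP_upper2[of "nat \<lceil>x\<rceil>"]) (auto split: split_indicator, linarith)
  qed
  then have "(\<integral>\<^sup>+x. ennreal (f x) * indicator {1..} x \<partial>lborel)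
      = (\<integral>\<^sup>+x. (SUP n::nat. ennreal (f x) * indicator {1..1 + real n} x) \<partial>lborel)" by simp
  also have "\<dots> = (SUP n::nat. \<integral>\<^sup>+x. ennreal (f x) * indicator {1..1 + real n} x \<partial>lborel)"
    by (rule nn_integral_monotone_convergence_SUP)
       (auto simp: incseq_def le_fun_def split: split_indicator)
  also have "\<dots> \<le> ennreal (2 * C)"
  proof (rule SUP_least)
    fix n :: nat
    have "(\<integral>\<^sup>+x. ennreal (f x) * indicator {1..1 + real n} x \<partial>lborel) = ennreal (F (1 + real n) - F 1)"
      by (rule nn_integral_FTC_Icc) (auto intro!: deriv nn)
    also have "\<dots> \<le> ennreal (2 * C)"
      using bd[of "1 + real n"] bd[of 1] by (intro ennreal_leI) auto
    finally show "(\<integral>\<^sup>+x. ennreal (f x) * indicator {1..1 + real n} x \<partial>lborel) \<le> ennreal (2 * C)" .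
  qed
  finally have *: "(\<integral>\<^sup>+x. ennreal (f x) * indicator {1..} x \<partial>lborel) \<le> ennreal (2 * C)" .
  have "(\<integral>\<^sup>+x. ennreal (h x) * indicator {1..} x \<partial>lborel) \<le> (\<integral>\<^sup>+x. ennreal (f x) * indicator {1..} x \<partial>lborel)"
    by (intro nn_integral_mono) (auto split: split_indicator intro: ennreal_leI nn)
  with * show ?thesis by (rule order_trans[rotated])
qed

text \<open>
  The part of the multiplier that remains when the Gaussian with the same value at the origin is
  removed.
\<close>

definition besselD :: "real \<Rightarrow> real \<Rightarrow> real" where
  "besselD a r = besselB a r - besselB a 0 * exp (- pi * r)"

lemma besselD_measurable[measurable]: "besselD a \<in> borel_measurable borel"
  unfolding besselD_def by measurable

text \<open>
  With \<open>E\<close> the energy above, the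
  function \<open>- B B' - K E\<close> is bounded on \<open>r \<ge> 1\<close>, since \<open>E\<close> is. By the differential equation its
  derivative is
  \<open>B\<^sup>2 / (4 r) + (a + 1) B B' / r + (K (2 a + 1) - 1) B'\<^sup>2\<close>. For large \<open>K\<close> the last term absorbs the mixed
  one, up to half of the first, and so \<open>B\<^sup>2 / r\<close> is integrable. The additional exponential in \<open>F\<close>
  takes care of the Gaussian.
\<close>

lemma besselD_square_integrable_tail:
  assumes a: "a > - 1 / 2"
  shows "(\<integral>\<^sup>+r. ennreal ((besselD a r)\<^sup>2 / r) * indicator {1..} r \<partial>lborel) < \<infinity>"
proof -
  define b0 where "b0 = besselB a 0"
  define K where "K = (1 + 2 * (a + 1)\<^sup>2) / (2 * a + 1)"
  define B B1 where "B = besselB a" and "B1 = besselB' a"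
  define F where "F r = 16 * (- B r * B1 r - K * ((B r)\<^sup>2 / 4 + r * (B1 r)\<^sup>2)) - 2 * b0\<^sup>2 * exp (- r)" for r
  define f where "f r = 16 * (- (B1 r)\<^sup>2 + ((a + 1) * (B r * B1 r) + (B r)\<^sup>2 / 4) / r + K * (2 * a + 1) * (B1 r)\<^sup>2)
    + 2 * b0\<^sup>2 * exp (- r)" for r
  have "0 < 1 + 2 * (a + 1)\<^sup>2" by (intro add_pos_nonneg) auto
  then have K0: "K > 0" using a unfolding K_def by (intro divide_pos_pos) auto
  have K1: "K * (2 * a + 1) = 1 + 2 * (a + 1)\<^sup>2" using a by (simp add: K_def)
  have [measurable]: "f \<in> borel_measurable borel"
    unfolding f_def B_def B1_def by measurable
  have dF: "(F has_field_derivative f r) (at r)" if r: "r \<ge> 1" for r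
  proof -
    define b where "b = besselB (a + 2) r / 16"
    have dB: "(B has_field_derivative B1 r) (at r)" and dB1: "(B1 has_field_derivative b) (at r)"
      unfolding B_def B1_def b_def by (rule besselB_deriv besselB'_deriv)+
    have b: "b = - ((a + 1) * B1 r + B r / 4) / r"
      using besselB_ODE[of r a] r by (simp add: B_def B1_def b_def field_simps)
    have "(F has_field_derivative (16 * (- (B1 r * B1 r + B r * b)
        - K * (B r * B1 r / 2 + ((B1 r)\<^sup>2 + 2 * B1 r * (r * b)))) + 2 * b0\<^sup>2 * exp (- r))) (at r)"
      unfolding F_def
      by (auto intro!: derivative_eq_intros dB dB1)
    also have "16 * (- (B1 r * B1 r + B r * b)
        - K * (B r * B1 r / 2 + ((B1 r)\<^sup>2 + 2 * B1 r * (r * b)))) + 2 * b0\<^sup>2 * exp (- r) = f r"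
    proof -
      have 1: "r * b = - ((a + 1) * B1 r + B r / 4)" using b r by simp
      define q where "q = ((a + 1) * (B r * B1 r) + (B r)\<^sup>2 / 4) / r"
      have 2: "B r * b = - q"
        unfolding b q_def using r by (simp add: power2_eq_square field_simps)
      show ?thesis unfolding 1 2 f_def q_def[symmetric] by (simp add: algebra_simps power2_eq_square)
    qed
    finally show ?thesis .
  qed
  have f_ge: "2 * (B r)\<^sup>2 / r + 2 * b0\<^sup>2 * exp (- r) \<le> f r" if r: "r \<ge> 1" for r
  proof -
    \<comment> \<open>Completing the square absorbs the mixed term.\<close>
    have "0 \<le> (B r + 4 * (a + 1) * B1 r)\<^sup>2 / (8 * r)" using r by simp
    also have "\<dots> = (a + 1) * (B r * B1 r) / r + (B r)\<^sup>2 / r / 8 + 2 * (a + 1)\<^sup>2 * (B1 r)\<^sup>2 / r"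
      using r by (simp add: field_simps power2_eq_square)
    also have "2 * (a + 1)\<^sup>2 * (B1 r)\<^sup>2 / r \<le> 2 * (a + 1)\<^sup>2 * (B1 r)\<^sup>2"
      using r mult_left_mono[of 1 r "2 * (a + 1)\<^sup>2 * (B1 r)\<^sup>2"] by (simp add: divide_le_eq)
    finally have sq: "0 \<le> (a + 1) * (B r * B1 r) / r + (B r)\<^sup>2 / r / 8 + 2 * (a + 1)\<^sup>2 * (B1 r)\<^sup>2" by simp
    have f_eq: "f r = 16 * ((a + 1) * (B r * B1 r) / r + (B r)\<^sup>2 / r / 4 + 2 * (a + 1)\<^sup>2 * (B1 r)\<^sup>2)
        + 2 * b0\<^sup>2 * exp (- r)"
      unfolding f_def K1 by (simp add: algebra_simps add_divide_distrib)
    have lin: "2 * y + e \<le> 16 * (x + y / 4 + z) + e" if "0 \<le> x + y / 8 + z" for x y z e :: real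
      using that by (simp add: field_simps)
    from lin[OF sq] show ?thesis unfolding f_eq by simp
  qed
  have F_bd: "\<bar>F r\<bar> \<le> 16 * (b0\<^sup>2 / 4 + K * (b0\<^sup>2 / 4)) + 2 * b0\<^sup>2" if r: "r \<ge> 1" for r
  proof -
    define E where "E = (B r)\<^sup>2 / 4 + r * (B1 r)\<^sup>2"
    have E: "E \<le> b0\<^sup>2 / 4" "0 \<le> E"
      using bessel_energy_le[of a r] a r by (auto simp: E_def B_def B1_def b0_def)
    have "\<bar>B r * B1 r\<bar> \<le> (B r)\<^sup>2 / 4 + (B1 r)\<^sup>2"
      using sum_squares_bound[of "\<bar>B r\<bar> / 2" "\<bar>B1 r\<bar>"] by (simp add: abs_mult power_divide)
    also have "\<dots> \<le> E" unfolding E_def using r mult_right_mono[of 1 r "(B1 r)\<^sup>2"] by simp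
    finally have 1: "\<bar>B r * B1 r\<bar> \<le> b0\<^sup>2 / 4" using E by linarith
    have 2: "0 \<le> K * E" "K * E \<le> K * (b0\<^sup>2 / 4)" using E K0 by (auto intro!: mult_left_mono)
    have 3: "0 \<le> 2 * b0\<^sup>2 * exp (- r)" "2 * b0\<^sup>2 * exp (- r) \<le> 2 * b0\<^sup>2"
      using r mult_left_mono[of "exp (- r)" 1 "2 * b0\<^sup>2"] by auto
    have "F r = 16 * (- (B r * B1 r) - K * E) - 2 * b0\<^sup>2 * exp (- r)"
      unfolding F_def E_def by simp
    moreover have "\<bar>16 * (- x - y) - z\<bar> \<le> 16 * (c + d) + w"
      if "\<bar>x\<bar> \<le> c" "0 \<le> y" "y \<le> d" "0 \<le> z" "z \<le> w" for x y z c d w :: real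
      using that by (auto simp: abs_le_iff)
    from this[OF 1 2 3] have "\<bar>16 * (- (B r * B1 r) - K * E) - 2 * b0\<^sup>2 * exp (- r)\<bar>
        \<le> 16 * (b0\<^sup>2 / 4 + K * (b0\<^sup>2 / 4)) + 2 * b0\<^sup>2" .
    ultimately show ?thesis by simp
  qed
  have h_le: "(besselD a r)\<^sup>2 / r \<le> f r" if r: "r \<ge> 1" for r
  proof -
    have "(besselD a r)\<^sup>2 \<le> 2 * (B r)\<^sup>2 + 2 * (b0 * exp (- pi * r))\<^sup>2"
      using zero_le_power2[of "B r + b0 * exp (- pi * r)"]
      unfolding besselD_def b0_def[symmetric] power2_sum power2_diff by (simp add: B_def)
    then have "(besselD a r)\<^sup>2 / r \<le> (2 * (B r)\<^sup>2 + 2 * (b0 * exp (- pi * r))\<^sup>2) / r"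
      using r by (intro divide_right_mono) auto
    also have "\<dots> = 2 * (B r)\<^sup>2 / r + 2 * (b0 * exp (- pi * r))\<^sup>2 / r" by (rule add_divide_distrib)
    also have "2 * (b0 * exp (- pi * r))\<^sup>2 / r \<le> 2 * (b0 * exp (- pi * r))\<^sup>2"
      using r mult_left_mono[of 1 r "2 * (b0 * exp (- pi * r))\<^sup>2"] by (simp add: divide_le_eq)
    also have "\<dots> = 2 * b0\<^sup>2 * exp (- (2 * pi * r))"
      by (simp add: power_mult_distrib flip: exp_double)
    also have "\<dots> \<le> 2 * b0\<^sup>2 * exp (- r)"
      using r pi_gt3 mult_right_mono[of 1 "2 * pi" r] by (intro mult_left_mono) auto
    finally show ?thesis using f_ge[OF r] by simp
  qed
  have "(\<integral>\<^sup>+r. ennreal ((besselD a r)\<^sup>2 / r) * indicator {1..} r \<partial>lborel)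
      \<le> ennreal (2 * (16 * (b0\<^sup>2 / 4 + K * (b0\<^sup>2 / 4)) + 2 * b0\<^sup>2))"
  proof (rule nn_integral_atLeast1_bounded[where f = f and F = F])
    fix x :: real assume x: "x \<ge> 1"
    then have "0 \<le> (besselD a x)\<^sup>2 / x" by simp
    then show "0 \<le> f x" using h_le[OF x] by linarith
  qed (use dF h_le F_bd in auto)
  also have "\<dots> < \<infinity>" by simp
  finally show ?thesis .
qed

lemma besselD_lipschitz_01: "\<exists>C. \<forall>r\<in>{0..1}. \<bar>besselD a r\<bar> \<le> C * r"
proof -
  define d where "d r = besselB' a r - besselB a 0 * (exp (- pi * r) * (- pi))" for r
  have der: "(besselD a has_field_derivative d r) (at r)" for r
    unfolding besselD_def[abs_def] d_def
    by (rule derivative_eq_intros besselB_deriv refl)+ simp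
  have "continuous_on {0..1} d"
    unfolding d_def besselB'_def by (auto intro!: continuous_intros besselB_continuous)
  then have "bounded (d ` {0..1})"
    by (intro compact_imp_bounded compact_continuous_image) auto
  then obtain C where "\<forall>r\<in>{0..1}. \<bar>d r\<bar> \<le> C"
    unfolding bounded_iff by auto
  then have C: "\<And>r. r \<in> {0..1} \<Longrightarrow> \<bar>d r\<bar> \<le> C" by blast
  have "\<bar>besselD a r\<bar> \<le> C * r" if r: "r \<in> {0..1}" for r
  proof -
    have "norm (besselD a r - besselD a 0) \<le> C * norm (r - 0)"
      using r C by (intro field_differentiable_bound[of "{0..1}" _ d]) (auto intro: der[THEN has_field_derivative_at_within])
    then show ?thesis using r by (simp add: besselD_def)
  qed
  then show ?thesis by blast
qed

text \<open>
  The measure \<open>dr / r\<close> is invariant under dilations. This number is therefore also the integral of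
  \<open>(besselD a (c * r))\<^sup>2\<close> against it, for every \<open>c > 0\<close>.
\<close>

definition besselD_norm :: "real \<Rightarrow> ennreal" where
  "besselD_norm a = (\<integral>\<^sup>+r. ennreal ((besselD a r)\<^sup>2 / r) * indicator {0<..} r \<partial>lborel)"

text \<open>
  Near the origin \<open>besselD\<close> vanishes to first order, which compensates the singularity of \<open>1 / r\<close>.
\<close>

lemma besselD_norm_finite:
  assumes a: "a > - 1 / 2"
  shows "besselD_norm a < \<infinity>"
proof -
  obtain C where C: "\<And>r. r \<in> {0..1} \<Longrightarrow> \<bar>besselD a r\<bar> \<le> C * r"
    using besselD_lipschitz_01[of a] by blast
  have "ennreal ((besselD a r)\<^sup>2 / r) * indicator {0<..} r
      \<le> ennreal (C\<^sup>2) * indicator {0..1} r + ennreal ((besselD a r)\<^sup>2 / r) * indicator {1..} r" for r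
  proof (cases "0 < r \<and> r < 1")
    case True
    have "(besselD a r)\<^sup>2 \<le> (C * r)\<^sup>2"
      using C[of r] True by (simp add: abs_le_square_iff[symmetric])
    then have "(besselD a r)\<^sup>2 / r \<le> (C * r)\<^sup>2 / r" using True by (intro divide_right_mono) auto
    also have "\<dots> = C\<^sup>2 * r" using True by (simp add: power2_eq_square)
    also have "\<dots> \<le> C\<^sup>2" using True mult_left_mono[of r 1 "C\<^sup>2"] by simp
    finally show ?thesis using True by (auto intro: ennreal_leI)
  qed (auto split: split_indicator)
  then have "besselD_norm a \<le> (\<integral>\<^sup>+r. ennreal (C\<^sup>2) * indicator {0..1} r + ennreal ((besselD a r)\<^sup>2 / r) * indicator {1..} r \<partial>lborel)"
    unfolding besselD_norm_def by (rule nn_integral_mono)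
  also have "\<dots> = ennreal (C\<^sup>2) + (\<integral>\<^sup>+r. ennreal ((besselD a r)\<^sup>2 / r) * indicator {1..} r \<partial>lborel)"
    by (subst nn_integral_add) (auto simp: nn_integral_cmult)
  also have "\<dots> < \<infinity>" using besselD_square_integrable_tail[OF a] by simp
  finally show ?thesis .
qed

lemma nn_integral_dilation_invariant:
  fixes f :: "real \<Rightarrow> real"
  assumes [measurable]: "f \<in> borel_measurable borel" and c: "c > 0"
  shows "(\<integral>\<^sup>+r. ennreal (f (c * r) / r) * indicator {0<..} r \<partial>lborel)
    = (\<integral>\<^sup>+r. ennreal (f r / r) * indicator {0<..} r \<partial>lborel)"
proof -
  have "(\<integral>\<^sup>+r. ennreal (f r / r) * indicator {0<..} r \<partial>lborel)
      = ennreal \<bar>c\<bar> * (\<integral>\<^sup>+r. ennreal (f (0 + c * r) / (0 + c * r)) * indicator {0<..} (0 + c * r) \<partial>lborel)"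
    using c by (intro nn_integral_real_affine) auto
  also have "\<dots> = (\<integral>\<^sup>+r. ennreal c * (ennreal (f (c * r) / (c * r)) * indicator {0<..} (c * r)) \<partial>lborel)"
    using c by (subst nn_integral_cmult) auto
  also have "\<dots> = (\<integral>\<^sup>+r. ennreal (f (c * r) / r) * indicator {0<..} r \<partial>lborel)"
    using c by (intro nn_integral_cong)
      (auto simp: zero_less_mult_iff ennreal_mult'[symmetric] split: split_indicator)
  finally show ?thesis ..
qed

section \<open>Sonine's integral\<close>

definition beta_weight :: "real \<Rightarrow> real \<Rightarrow> real" where
  "beta_weight a u = indicator {0..1} u * (u powr a * (1 - u) powr a)"

lemma beta_weight_measurable[measurable]: "beta_weight a \<in> borel_measurable borel"
  unfolding beta_weight_def by measurable

lemma beta_weight_nonneg: "0 \<le> beta_weight a u"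
  unfolding beta_weight_def by simp

lemma
  assumes a: "a > - 1"
  shows beta_weight_power_integrable: "integrable lborel (\<lambda>u. u ^ i * (1 - u) ^ j * beta_weight a u)"
    and beta_weight_power_integral:
      "(\<integral>u. u ^ i * (1 - u) ^ j * beta_weight a u \<partial>lborel) = Beta (real i + a + 1) (real j + a + 1)"
proof -
  let ?f = "\<lambda>t. t powr (real i + a + 1 - 1) * (1 - t) powr (real j + a + 1 - 1)"
  have pos: "real i + a + 1 > 0" "real j + a + 1 > 0" using a by auto
  have pw: "x ^ k * x powr a = x powr (real k + a)" if "x \<ge> 0" for x :: real and k
    using that by (cases "x = 0") (auto simp: powr_add powr_realpow)
  have eq: "indicator {0..1} u *\<^sub>R ?f u = u ^ i * (1 - u) ^ j * beta_weight a u" for u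
  proof (cases "u \<in> {0..1}")
    case True
    then have "?f u = (u ^ i * u powr a) * ((1 - u) ^ j * (1 - u) powr a)"
      by (simp add: pw)
    then show ?thesis using True by (simp add: beta_weight_def)
  qed (simp add: beta_weight_def)
  have set: "set_integrable lborel {0..1} ?f"
    using integrable_Beta[OF pos] .
  then show "integrable lborel (\<lambda>u. u ^ i * (1 - u) ^ j * beta_weight a u)"
    unfolding set_integrable_def eq .
  have "(\<integral>u. u ^ i * (1 - u) ^ j * beta_weight a u \<partial>lborel) = integral {0..1} ?f"
    using set_borel_integral_eq_integral(2)[OF set] unfolding set_lebesgue_integral_def eq .
  also have "\<dots> = Beta (real i + a + 1) (real j + a + 1)"
    using has_integral_Beta_real[OF pos] by (rule integral_unique)
  finally show "(\<integral>u. u ^ i * (1 - u) ^ j * beta_weight a u \<partial>lborel) = Beta (real i + a + 1) (real j + a + 1)" .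
qed

text \<open>
  The Beta integral cancels exactly the Gamma factors of the two coefficients.
\<close>

lemma bcoeff_Beta:
  assumes a: "a > - 1" and i: "i \<le> k"
  shows "bcoeff a i * bcoeff a (k - i) * Beta (real i + a + 1) (real (k - i) + a + 1)
    = bcoeff (2 * a + 1) k * real (k choose i)"
proof -
  have nz: "Gamma (real m + a + 1) \<noteq> 0" for m
  proof -
    have "0 < real m + a + 1" using a by linarith
    then show ?thesis using Gamma_real_pos by fastforce
  qed
  have idx: "real i + a + 1 + (real (k - i) + a + 1) = real k + (2 * a + 1) + 1"
    using i by (simp add: of_nat_diff)
  have rG: "rGamma (real m + a + 1) * Gamma (real m + a + 1) = 1" for m
    using nz[of m] by (simp add: rGamma_inverse_Gamma)
  have R: "rGamma (real i + a + 1) * rGamma (real (k - i) + a + 1) * Beta (real i + a + 1) (real (k - i) + a + 1)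
      = rGamma (real k + (2 * a + 1) + 1)"
  proof -
    have g: "x1 * x2 * (y1 * y2 * z) = (x1 * y1) * (x2 * y2) * z" for x1 x2 y1 y2 z :: real
      by (simp only: ac_simps)
    show ?thesis unfolding Beta_altdef g idx rG by simp
  qed
  have p: "(- 4) ^ i * (- 4) ^ (k - i) = (- 4 :: real) ^ k"
    using i by (simp flip: power_add)
  have "bcoeff a i * bcoeff a (k - i) * Beta (real i + a + 1) (real (k - i) + a + 1)
      = (rGamma (real i + a + 1) * rGamma (real (k - i) + a + 1) * Beta (real i + a + 1) (real (k - i) + a + 1))
        / ((fact i * fact (k - i)) * ((- 4) ^ i * (- 4) ^ (k - i)))"
    by (simp add: bcoeff_def)
  also have "\<dots> = bcoeff (2 * a + 1) k * (fact k / (fact i * fact (k - i)))"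
    unfolding R p bcoeff_def by simp
  also have "fact k / (fact i * fact (k - i)) = real (k choose i)"
    using i by (rule binomial_fact[symmetric])
  finally show ?thesis .
qed

text \<open>
  Sonine's second integral. Both series on the right are multiplied out and integrated term by
  term. The Beta integrals turn the terms of total degree \<open>k\<close> into the binomial expansion of
  \<open>(p + q)\<^sup>k\<close>.
\<close>

lemma besselB_sonine:
  assumes a: "a > - 1"
  shows "besselB (2 * a + 1) (p + q)
    = (\<integral>u. besselB a (p * u) * besselB a (q * (1 - u)) * beta_weight a u \<partial>lborel)"
proof -
  define T where "T k u = (\<Sum>i\<le>k. (bcoeff a i * p ^ i) * (bcoeff a (k - i) * q ^ (k - i)) * (u ^ i * (1 - u) ^ (k - i) * beta_weight a u))" for k u
  define m where "m k = (\<Sum>i\<le>k. (\<bar>bcoeff a i\<bar> * \<bar>p\<bar> ^ i) * (\<bar>bcoeff a (k - i)\<bar> * \<bar>q\<bar> ^ (k - i)))" for k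
  have int_w: "integrable lborel (beta_weight a)"
    using beta_weight_power_integrable[OF a, of 0 0] by simp
  have int_T: "integrable lborel (T k)" for k
    unfolding T_def by (intro Bochner_Integration.integrable_sum integrable_mult_right beta_weight_power_integrable a)
  have sum_m: "summable m"
    unfolding m_def
    using Cauchy_product_sums[of "\<lambda>i. \<bar>bcoeff a i\<bar> * \<bar>p\<bar> ^ i" "\<lambda>i. \<bar>bcoeff a i\<bar> * \<bar>q\<bar> ^ i"]
    by (simp add: abs_mult power_abs summable_abs_besselB sums_iff)
  have T_le: "norm (T k u) \<le> m k * beta_weight a u" for k u
  proof (cases "u \<in> {0..1}")
    case True
    have "norm (T k u) \<le> (\<Sum>i\<le>k. (\<bar>bcoeff a i\<bar> * \<bar>p\<bar> ^ i) * (\<bar>bcoeff a (k - i)\<bar> * \<bar>q\<bar> ^ (k - i)) * beta_weight a u)"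
      unfolding T_def
    proof (intro order_trans[OF norm_sum] sum_mono)
      fix i
      have "u ^ i * (1 - u) ^ (k - i) \<le> 1 * 1"
        using True by (intro mult_mono power_le_one) auto
      then have "u ^ i * (1 - u) ^ (k - i) * beta_weight a u \<le> beta_weight a u"
        using mult_right_mono[OF _ beta_weight_nonneg[of a u], of _ 1] by simp
      then show "norm ((bcoeff a i * p ^ i) * (bcoeff a (k - i) * q ^ (k - i)) * (u ^ i * (1 - u) ^ (k - i) * beta_weight a u))
        \<le> (\<bar>bcoeff a i\<bar> * \<bar>p\<bar> ^ i) * (\<bar>bcoeff a (k - i)\<bar> * \<bar>q\<bar> ^ (k - i)) * beta_weight a u"
        using True beta_weight_nonneg[of a u] by (auto simp: abs_mult power_abs intro!: mult_left_mono)
    qed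
    then show ?thesis by (simp add: m_def sum_distrib_right)
  qed (simp add: T_def beta_weight_def)
  have T_sums: "(\<lambda>k. T k u) sums (besselB a (p * u) * besselB a (q * (1 - u)) * beta_weight a u)" for u
  proof -
    have "(\<lambda>k. \<Sum>i\<le>k. (bcoeff a i * (p * u) ^ i) * (bcoeff a (k - i) * (q * (1 - u)) ^ (k - i)))
        sums (besselB a (p * u) * besselB a (q * (1 - u)))"
      unfolding besselB_def
      by (intro Cauchy_product_sums) (use summable_abs_besselB[of a "p * u"] summable_abs_besselB[of a "q * (1 - u)"] in
          \<open>simp_all add: abs_mult power_abs\<close>)
    from sums_mult2[OF this, of "beta_weight a u"] show ?thesis
      unfolding T_def by (simp add: sum_distrib_left sum_distrib_right power_mult_distrib ac_simps)
  qed
  have "(\<lambda>k. \<integral>u. T k u \<partial>lborel) sums (\<integral>u. (\<Sum>k. T k u) \<partial>lborel)"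
  proof (rule sums_integral[OF int_T])
    have "summable (\<lambda>k. norm (T k u))" for u
      using T_le by (intro summable_comparison_test'[OF summable_mult2[OF sum_m, of "beta_weight a u"], of 0]) auto
    then show "AE u in lborel. summable (\<lambda>k. norm (T k u))" by simp
    have "norm (\<integral>u. norm (T k u) \<partial>lborel) \<le> m k * (\<integral>u. beta_weight a u \<partial>lborel)" for k
    proof -
      have "(\<integral>u. norm (T k u) \<partial>lborel) \<le> (\<integral>u. m k * beta_weight a u \<partial>lborel)"
        by (intro integral_mono integrable_norm int_T integrable_mult_right int_w T_le)
      then show ?thesis by simp
    qed
    then show "summable (\<lambda>k. \<integral>u. norm (T k u) \<partial>lborel)"
      by (intro summable_comparison_test'[OF summable_mult2[OF sum_m, of "\<integral>u. beta_weight a u \<partial>lborel"], of 0]) auto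
  qed
  moreover have "(\<integral>u. T k u \<partial>lborel) = bcoeff (2 * a + 1) k * (p + q) ^ k" for k
  proof -
    have "(\<integral>u. T k u \<partial>lborel) = (\<Sum>i\<le>k. (bcoeff a i * p ^ i) * (bcoeff a (k - i) * q ^ (k - i)) * Beta (real i + a + 1) (real (k - i) + a + 1))"
      unfolding T_def
      by (subst Bochner_Integration.integral_sum)
         (auto intro!: beta_weight_power_integrable a integrable_mult_right simp: beta_weight_power_integral[OF a])
    also have "\<dots> = (\<Sum>i\<le>k. bcoeff (2 * a + 1) k * (real (k choose i) * p ^ i * q ^ (k - i)))"
    proof (intro sum.cong refl)
      fix i assume "i \<in> {..k}"
      then show "(bcoeff a i * p ^ i) * (bcoeff a (k - i) * q ^ (k - i)) * Beta (real i + a + 1) (real (k - i) + a + 1)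
        = bcoeff (2 * a + 1) k * (real (k choose i) * p ^ i * q ^ (k - i))"
        using arg_cong[OF bcoeff_Beta[OF a, of i k], of "\<lambda>x. x * p ^ i * q ^ (k - i)"] by (simp add: ac_simps)
    qed
    also have "\<dots> = bcoeff (2 * a + 1) k * (p + q) ^ k"
      by (simp add: binomial_ring sum_distrib_left)
    finally show ?thesis .
  qed
  ultimately have "(\<lambda>k. bcoeff (2 * a + 1) k * (p + q) ^ k) sums (\<integral>u. (\<Sum>k. T k u) \<partial>lborel)" by simp
  then have "besselB (2 * a + 1) (p + q) = (\<integral>u. (\<Sum>k. T k u) \<partial>lborel)"
    unfolding besselB_def by (rule sums_unique[symmetric])
  also have "(\<lambda>u. \<Sum>k. T k u) = (\<lambda>u. besselB a (p * u) * besselB a (q * (1 - u)) * beta_weight a u)"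
    using T_sums by (auto simp: sums_iff)
  finally show ?thesis .
qed

section \<open>Fourier transforms of Schwartz functions\<close>

text \<open>
  The exponent is twice the dimension because \<open>(1 + |x|)\<close> to this power dominates the product of
  \<open>1 + x\<^sub>b\<^sup>2\<close> over all coordinates, whose inverse is integrable.
\<close>

definition decay :: "'a::euclidean_space \<Rightarrow> real" where
  "decay x = 1 / (1 + norm x) ^ (2 * DIM('a))"

lemma decay_measurable[measurable]: "decay \<in> borel_measurable borel"
  unfolding decay_def by measurable

lemma decay_pos: "0 < decay x"
  unfolding decay_def by (intro divide_pos_pos zero_less_power add_pos_nonneg) auto

lemma decay_le_1: "decay (x :: 'a::euclidean_space) \<le> 1"
proof -
  have "1 \<le> (1 + norm x) ^ (2 * DIM('a))" by (rule one_le_power) simp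
  then show ?thesis by (simp add: decay_def divide_le_eq)
qed

lemma integrable_decay: "integrable lborel (decay :: 'a::euclidean_space \<Rightarrow> real)"
proof -
  have "integrable lborel (\<lambda>t::real. inverse (1 + t\<^sup>2))"
    using integrable_inverse_1_plus_square unfolding set_integrable_def by simp
  then have int: "integrable lborel (\<lambda>t::real. complex_of_real (inverse (1 + t\<^sup>2)))"
    by (rule integrable_of_real)
  have "integrable lborel (\<lambda>x::'a. \<Prod>b\<in>Basis. complex_of_real (inverse (1 + (x \<bullet> b)\<^sup>2)))"
    by (rule lborel_integrable_prod_Basis[OF int])
  then show ?thesis
  proof (rule Bochner_Integration.integrable_bound)
    show "AE x in lborel. norm (decay x) \<le> norm (\<Prod>b\<in>Basis. complex_of_real (inverse (1 + ((x::'a) \<bullet> b)\<^sup>2)))"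
    proof (rule AE_I2)
      fix x :: 'a
      have "(\<Prod>b\<in>Basis. 1 + (x \<bullet> b)\<^sup>2) \<le> (\<Prod>b\<in>(Basis::'a set). (1 + norm x)\<^sup>2)"
      proof (rule prod_mono)
        fix b :: 'a assume "b \<in> Basis"
        then have "(x \<bullet> b)\<^sup>2 \<le> (norm x)\<^sup>2"
          using Basis_le_norm[of b x] by (simp add: abs_le_square_iff[symmetric])
        then show "0 \<le> 1 + (x \<bullet> b)\<^sup>2 \<and> 1 + (x \<bullet> b)\<^sup>2 \<le> (1 + norm x)\<^sup>2"
          using norm_ge_zero[of x] zero_le_power2[of "x \<bullet> b"]
          by (simp add: power2_sum del: zero_le_power2 norm_ge_zero)
      qed
      then have le: "(\<Prod>b\<in>Basis. 1 + (x \<bullet> b)\<^sup>2) \<le> (1 + norm x) ^ (2 * DIM('a))"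
        by (simp add: power_mult)
      have pos: "0 < (\<Prod>b\<in>(Basis::'a set). 1 + (x \<bullet> b)\<^sup>2)"
        by (intro prod_pos) (auto intro: add_pos_nonneg)
      have "decay x \<le> inverse (\<Prod>b\<in>(Basis::'a set). 1 + (x \<bullet> b)\<^sup>2)"
        unfolding decay_def using le_imp_inverse_le[OF le pos] by (simp add: inverse_eq_divide)
      moreover have "norm (\<Prod>b\<in>(Basis::'a set). complex_of_real (inverse (1 + (x \<bullet> b)\<^sup>2)))
          = inverse (\<Prod>b\<in>(Basis::'a set). 1 + (x \<bullet> b)\<^sup>2)"
      proof -
        have "norm (complex_of_real (inverse (1 + t\<^sup>2))) = inverse (1 + t\<^sup>2)" for t
          unfolding norm_of_real by (simp add: add_nonneg_nonneg)
        then show ?thesis unfolding prod_norm[symmetric] by (simp only: prod_inversef[symmetric] comp_def)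
      qed
      ultimately show "norm (decay x) \<le> norm (\<Prod>b\<in>Basis. complex_of_real (inverse (1 + (x \<bullet> b)\<^sup>2)))"
        using decay_pos[of x] by simp
    qed
  qed measurable
qed

definition rapid :: "('a::euclidean_space \<Rightarrow> complex) \<Rightarrow> bool" where
  "rapid F \<longleftrightarrow> F \<in> borel_measurable borel \<and> (\<exists>C. \<forall>x. norm (F x) \<le> C * decay x)"

lemma one_plus_power_le:
  fixes t :: real
  assumes "t \<ge> 0"
  shows "(1 + t) ^ m \<le> 2 ^ m * (1 + t ^ m)"
proof -
  have "(1 + t) ^ m \<le> (2 * max 1 t) ^ m" using assms by (intro power_mono) auto
  also have "\<dots> = 2 ^ m * (max 1 t) ^ m" by (rule power_mult_distrib)
  also have "(max 1 t) ^ m \<le> 1 + t ^ m"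
    using assms by (cases "t \<le> 1") (auto simp: max_def)
  finally show ?thesis by simp
qed

lemma rapidI:
  fixes F :: "'a::euclidean_space \<Rightarrow> complex"
  assumes "F \<in> borel_measurable borel"
    and "\<And>x. norm (F x) \<le> C0" "\<And>x. norm x ^ (2 * DIM('a)) * norm (F x) \<le> C1"
  shows "rapid F"
  unfolding rapid_def
proof (intro conjI exI allI)
  fix x
  let ?m = "2 * DIM('a)"
  have "(1 + norm x) ^ ?m * norm (F x) \<le> 2 ^ ?m * (1 + norm x ^ ?m) * norm (F x)"
    by (intro mult_right_mono one_plus_power_le) auto
  also have "\<dots> = 2 ^ ?m * (norm (F x) + norm x ^ ?m * norm (F x))" by (simp add: algebra_simps)
  also have "\<dots> \<le> 2 ^ ?m * (C0 + C1)" by (intro mult_left_mono add_mono assms) auto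
  finally show "norm (F x) \<le> 2 ^ ?m * (C0 + C1) * decay x"
    unfolding decay_def by (simp add: pos_le_divide_eq add_pos_nonneg mult.commute)
qed fact

lemma rapid_integrable:
  assumes "rapid F"
  shows "integrable lborel F"
proof -
  obtain C where C: "\<And>x. norm (F x) \<le> C * decay x" using assms unfolding rapid_def by blast
  show ?thesis
  proof (rule Bochner_Integration.integrable_bound[OF integrable_mult_right[OF integrable_decay, of C]])
    show "AE x in lborel. norm (F x) \<le> norm (C * decay x)"
      by (intro AE_I2) (simp add: order_trans[OF C abs_ge_self])
  qed (use assms in \<open>simp add: rapid_def\<close>)
qed

lemma rapid_square_integrable:
  assumes "rapid F"
  shows "integrable lborel (\<lambda>x. (norm (F x))\<^sup>2)"
proof -
  obtain C where C: "\<And>x. norm (F x) \<le> C * decay x" using assms unfolding rapid_def by blast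
  have [measurable]: "F \<in> borel_measurable borel" using assms by (simp add: rapid_def)
  show ?thesis
  proof (rule Bochner_Integration.integrable_bound[OF integrable_mult_right[OF integrable_decay, of "C\<^sup>2"]])
    show "AE x in lborel. norm ((norm (F x))\<^sup>2) \<le> norm (C\<^sup>2 * decay x)"
    proof (rule AE_I2)
      fix x
      have "(norm (F x))\<^sup>2 \<le> (C * decay x)\<^sup>2" using C[of x] by (intro power_mono) auto
      also have "\<dots> = C\<^sup>2 * decay x * decay x" by (simp add: power2_eq_square)
      also have "\<dots> \<le> C\<^sup>2 * decay x * 1"
        using decay_pos[of x] decay_le_1[of x] by (intro mult_left_mono) (auto simp: less_imp_le)
      finally show "norm ((norm (F x))\<^sup>2) \<le> norm (C\<^sup>2 * decay x)"
        using decay_pos[of x] by simp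
    qed
  qed measurable
qed

lemma decay_shift:
  fixes x e :: "'a::euclidean_space"
  assumes "norm e \<le> 1"
  shows "decay (x + e) \<le> 2 ^ (2 * DIM('a)) * decay x"
proof -
  have "norm x \<le> norm (x + e) + norm e" using norm_triangle_ineq4[of "x + e" e] by simp
  then have "1 + norm x \<le> 2 * (1 + norm (x + e))" using assms norm_ge_zero[of "x + e"]
    unfolding distrib_left by linarith
  then have "(1 + norm x) ^ (2 * DIM('a)) \<le> (2 * (1 + norm (x + e))) ^ (2 * DIM('a))"
    by (intro power_mono) auto
  also have "\<dots> = 2 ^ (2 * DIM('a)) * (1 + norm (x + e)) ^ (2 * DIM('a))" by (rule power_mult_distrib)
  finally show ?thesis
    unfolding decay_def by (simp add: divide_simps add_pos_nonneg add_nonneg_eq_0_iff)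
qed

lemma lborel_integrable_translate:
  fixes g :: "'a::euclidean_space \<Rightarrow> complex"
  assumes "integrable lborel g"
  shows "integrable lborel (\<lambda>x. g (x + v))" "(\<integral>x. g (x + v) \<partial>lborel) = (\<integral>x. g x \<partial>lborel)"
proof -
  have [measurable]: "g \<in> borel_measurable borel" using assms by auto
  have "integrable (distr lborel borel ((+) v)) g" using assms by (simp add: lborel_distr_plus)
  then show "integrable lborel (\<lambda>x. g (x + v))"
    by (subst (asm) integrable_distr_eq) (auto simp: add.commute)
  have "(\<integral>x. g x \<partial>lborel) = (\<integral>x. g x \<partial>distr lborel borel ((+) v))" by (simp add: lborel_distr_plus)
  also have "\<dots> = (\<integral>x. g (x + v) \<partial>lborel)" by (subst integral_distr) (auto simp: add.commute)
  finally show "(\<integral>x. g (x + v) \<partial>lborel) = (\<integral>x. g x \<partial>lborel)" ..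
qed

text \<open>
  The difference quotients of \<open>g\<close> in the direction
  \<open>e\<close> have integral zero by translation invariance. They converge to \<open>D\<close> and, by the mean value
  inequality, are dominated by a multiple of \<open>decay\<close>, which changes only by a bounded factor under
  translations of length at most one.
\<close>

lemma integral_directional_derivative_eq_0:
  fixes g D :: "'a::euclidean_space \<Rightarrow> complex"
  assumes g: "integrable lborel g" and e: "norm e \<le> 1"
    and deriv: "\<And>x t. ((\<lambda>t. g (x + t *\<^sub>R e)) has_vector_derivative D (x + t *\<^sub>R e)) (at t)"
    and D: "rapid D"
  shows "(\<integral>x. D x \<partial>lborel) = 0"
proof -
  obtain C where C: "\<And>x. norm (D x) \<le> C * decay x" using D unfolding rapid_def by blast
  have C0: "C \<ge> 0"
    using C[of 0] decay_pos[of "0::'a"] norm_ge_zero[of "D 0"] by (smt (verit) zero_le_mult_iff)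
  have [measurable]: "D \<in> borel_measurable borel" using D by (simp add: rapid_def)
  have [measurable]: "g \<in> borel_measurable borel" using g by auto
  define h where "h n = 1 / real (Suc n)" for n
  have h: "0 < h n" "h n \<le> 1" for n by (auto simp: h_def)
  have h0: "h \<longlonglongrightarrow> 0" unfolding h_def by (rule LIMSEQ_Suc[OF lim_1_over_n])
  define s where "s n x = (1 / h n) *\<^sub>R (g (x + h n *\<^sub>R e) - g x)" for n x
  have [measurable]: "s n \<in> borel_measurable borel" for n unfolding s_def by measurable
  have s0: "(\<integral>x. s n x \<partial>lborel) = 0" for n
    unfolding s_def using lborel_integrable_translate[OF g, of "h n *\<^sub>R e"] g by simp
  have lim: "(\<lambda>n. s n x) \<longlonglongrightarrow> D x" for x
  proof -
    have "((\<lambda>t. g (x + t *\<^sub>R e)) has_derivative (\<lambda>t. t *\<^sub>R D x)) (at 0)"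
      using deriv[of x 0] by (simp add: has_vector_derivative_def)
    then have "(\<lambda>t. norm (g (x + t *\<^sub>R e) - g x - t *\<^sub>R D x) / norm t) \<midarrow>0\<rightarrow> 0"
      by (simp add: has_derivative_at)
    then have "(\<lambda>n. norm (g (x + h n *\<^sub>R e) - g x - h n *\<^sub>R D x) / norm (h n)) \<longlonglongrightarrow> 0"
      by (rule filterlim_compose) (use h0 h(1) in \<open>auto simp: filterlim_at less_imp_neq[symmetric]\<close>)
    moreover have "norm (g (x + h n *\<^sub>R e) - g x - h n *\<^sub>R D x) / norm (h n) = norm (s n x - D x)" for n
    proof -
      have "s n x - D x = (1 / h n) *\<^sub>R (g (x + h n *\<^sub>R e) - g x - h n *\<^sub>R D x)"
        using h(1)[of n] by (simp add: s_def scaleR_diff_right)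
      then show ?thesis using h(1)[of n] by simp
    qed
    ultimately show ?thesis by (simp add: tendsto_norm_zero_iff LIM_zero_iff)
  qed
  have bd: "norm (s n x) \<le> C * 2 ^ (2 * DIM('a)) * decay x" for n x
  proof -
    have "norm (g (x + h n *\<^sub>R e) - g (x + 0 *\<^sub>R e)) \<le> (C * 2 ^ (2 * DIM('a)) * decay x) * norm (h n - 0)"
    proof (rule differentiable_bound[of "{0..h n}" "\<lambda>t. g (x + t *\<^sub>R e)" "\<lambda>t r. r *\<^sub>R D (x + t *\<^sub>R e)"])
      fix t assume t: "t \<in> {0..h n}"
      show "((\<lambda>t. g (x + t *\<^sub>R e)) has_derivative (\<lambda>r. r *\<^sub>R D (x + t *\<^sub>R e))) (at t within {0..h n})"
        using deriv[of x t] unfolding has_vector_derivative_def by (rule has_derivative_at_withinI)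
      have "norm (t *\<^sub>R e) \<le> 1 * 1" using t h(2)[of n] e unfolding norm_scaleR by (intro mult_mono) auto
      then have "norm (D (x + t *\<^sub>R e)) \<le> C * (2 ^ (2 * DIM('a)) * decay x)"
        using C[of "x + t *\<^sub>R e"] mult_left_mono[OF decay_shift[of "t *\<^sub>R e" x] C0] by simp
      then show "onorm (\<lambda>r. r *\<^sub>R D (x + t *\<^sub>R e)) \<le> C * 2 ^ (2 * DIM('a)) * decay x"
        using mult_left_mono[of "norm (D (x + t *\<^sub>R e))" "C * (2 ^ (2 * DIM('a)) * decay x)" "\<bar>r\<bar>" for r]
        by (intro onorm_le) (simp add: ac_simps)
    qed (use h(1)[of n] in auto)
    then have "norm (g (x + h n *\<^sub>R e) - g x) / h n \<le> C * 2 ^ (2 * DIM('a)) * decay x"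
      using h(1)[of n] by (simp add: pos_divide_le_eq)
    then show ?thesis using h(1)[of n] by (simp add: s_def)
  qed
  have "(\<lambda>n. \<integral>x. s n x \<partial>lborel) \<longlonglongrightarrow> (\<integral>x. D x \<partial>lborel)"
    by (rule integral_dominated_convergence[where w = "\<lambda>x. C * 2 ^ (2 * DIM('a)) * decay x"])
       (auto intro!: integrable_mult_right integrable_decay lim bd)
  then show ?thesis unfolding s0 by (simp add: LIMSEQ_const_iff)
qed

lemma schwartz_partial_deriv:
  assumes "schwartz f"
  shows "schwartz (partial_deriv i f)"
proof -
  have "iter_partial_deriv is (partial_deriv i f) = iter_partial_deriv (is @ [i]) f" for "is"
    by (simp add: iter_partial_deriv_def)
  then show ?thesis using assms unfolding schwartz_def by metis
qed

lemma schwartz_differentiable: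
  assumes "schwartz f"
  shows "f differentiable (at x)"
  using assms unfolding schwartz_def by (auto simp: iter_partial_deriv_def dest!: spec[of _ "[]"])

lemma schwartz_rapid:
  fixes f :: "real ^ 'n::finite \<Rightarrow> complex"
  assumes "schwartz f"
  shows "rapid f"
proof -
  have "continuous_on UNIV f"
    using schwartz_differentiable[OF assms]
    by (intro continuous_at_imp_continuous_on ballI differentiable_imp_continuous_within)
  then have m: "f \<in> borel_measurable borel" by (rule borel_measurable_continuous_onI)
  have "bounded (range (\<lambda>x. norm x ^ k *\<^sub>R f x))" for k
    using assms unfolding schwartz_def
    by (auto simp: iter_partial_deriv_def dest!: spec[of _ "[]"])
  then have "\<exists>C. \<forall>x. norm x ^ k * norm (f x) \<le> C" for k
    unfolding bounded_iff by fastforce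
  then obtain C where C: "\<And>k x. norm x ^ k * norm (f x) \<le> C k" by metis
  show ?thesis
    using C[of _ 0] C by (intro rapidI[OF m, of "C 0" "C (2 * DIM(real ^ 'n))"]) auto
qed

lemma schwartz_integrable: "schwartz f \<Longrightarrow> integrable lborel f"
  by (intro rapid_integrable schwartz_rapid)

lemma rapid_add: "rapid F \<Longrightarrow> rapid G \<Longrightarrow> rapid (\<lambda>x. F x + G x)"
  unfolding rapid_def
proof (elim conjE exE, intro conjI)
  fix C C' assume 1: "\<forall>x. norm (F x) \<le> C * decay x" "\<forall>x. norm (G x) \<le> C' * decay x"
  have "norm (F x + G x) \<le> (C + C') * decay x" for x
    using 1 by (auto simp: distrib_right intro!: order_trans[OF norm_triangle_ineq] add_mono)
  then show "\<exists>C. \<forall>x. norm (F x + G x) \<le> C * decay x" by blast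
qed measurable

lemma rapid_mult_bounded:
  assumes F: "rapid F" and [measurable]: "k \<in> borel_measurable borel" and k: "\<And>x. norm (k x) \<le> B"
  shows "rapid (\<lambda>x. F x * k x)"
  unfolding rapid_def
proof (intro conjI)
  have [measurable]: "F \<in> borel_measurable borel" using F by (simp add: rapid_def)
  show "(\<lambda>x. F x * k x) \<in> borel_measurable borel" by measurable
  obtain C where C: "\<And>x. norm (F x) \<le> C * decay x" using F unfolding rapid_def by blast
  have "norm (F x * k x) \<le> (C * B) * decay x" for x
  proof -
    have "norm (F x) * norm (k x) \<le> (C * decay x) * B"
      using C[of x] k[of x] norm_ge_zero[of "F x"] norm_ge_zero[of "k x"] by (intro mult_mono) linarith+
    then show ?thesis by (simp add: norm_mult ac_simps)
  qed
  then show "\<exists>C. \<forall>x. norm (F x * k x) \<le> C * decay x" by blast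
qed

lemma fourier_transform_cis:
  "fourier_transform f \<xi> = (\<integral>x. f x * cis (- (2 * pi * (x \<bullet> \<xi>))) \<partial>lborel)"
proof -
  have "- 2 * of_real pi * \<i> * of_real y = \<i> * complex_of_real (- (2 * pi * y))" for y
    by simp
  then show ?thesis unfolding fourier_transform_def cis_conv_exp by (simp only:)
qed

text \<open>
  The integral of the partial derivative of \<open>f x * cis (- 2 \<pi> x \<bullet> \<xi>)\<close> vanishes. The product rule splits
  it into the two sides of the claim.
\<close>

lemma fourier_partial_deriv:
  fixes f :: "real ^ 'n::finite \<Rightarrow> complex"
  assumes f: "schwartz f"
  shows "fourier_transform (partial_deriv i f) \<xi> = 2 * pi * \<i> * (\<xi> $ i) * fourier_transform f \<xi>"
proof -
  define c where "c x = cis (- (2 * pi * (x \<bullet> \<xi>)))" for x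
  define k where "k = - (2 * pi * (\<xi> $ i))"
  define D where "D x = partial_deriv i f x * c x + f x * (c x * (\<i> * k))" for x
  have [measurable]: "c \<in> borel_measurable borel" unfolding c_def by measurable
  have nc: "norm (c x) = 1" for x by (simp add: c_def)
  have r1: "rapid (\<lambda>x. partial_deriv i f x * c x)"
    by (rule rapid_mult_bounded[OF schwartz_rapid[OF schwartz_partial_deriv[OF f]], of _ 1]) (auto simp: nc)
  have r2: "rapid (\<lambda>x. f x * (c x * (\<i> * k)))"
    by (rule rapid_mult_bounded[OF schwartz_rapid[OF f], of _ "\<bar>k\<bar>"]) (auto simp: nc norm_mult)
  have D: "rapid D" unfolding D_def by (rule rapid_add[OF r1 r2])
  have g: "integrable lborel (\<lambda>x. f x * c x)"
    by (intro rapid_integrable rapid_mult_bounded[OF schwartz_rapid[OF f], of _ 1]) (auto simp: nc)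
  have "(\<integral>x. D x \<partial>lborel) = 0"
  proof (rule integral_directional_derivative_eq_0[OF g _ _ D, of "axis i 1"])
    fix x t
    let ?y = "x + t *\<^sub>R axis i (1::real)"
    have l: "((\<lambda>t. x + t *\<^sub>R axis i (1::real)) has_vector_derivative axis i 1) (at t)"
      by (auto intro!: derivative_eq_intros)
    have "(f has_derivative frechet_derivative f (at ?y)) (at ?y)"
      using schwartz_differentiable[OF f] by (simp add: frechet_derivative_works)
    then have d1: "((\<lambda>t. f (x + t *\<^sub>R axis i 1)) has_vector_derivative partial_deriv i f ?y) (at t)"
      unfolding partial_deriv_def
      using vector_derivative_diff_chain_within[of "\<lambda>t. x + t *\<^sub>R axis i (1::real)" "axis i 1" t UNIV f] l
      by (auto simp: o_def intro: has_derivative_at_withinI)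
    have eq: "- (2 * pi * ((x + t *\<^sub>R axis i 1) \<bullet> \<xi>)) = - (2 * pi * (x \<bullet> \<xi>)) + t * k" for t
      by (simp add: inner_add_left inner_axis' k_def algebra_simps)
    have d2: "((\<lambda>t. c (x + t *\<^sub>R axis i 1)) has_vector_derivative (c ?y * (\<i> * k))) (at t)"
      unfolding c_def eq cis_conv_exp
      by (auto intro!: derivative_eq_intros has_vector_derivative_real_field simp: algebra_simps)
    show "((\<lambda>t. f (x + t *\<^sub>R axis i 1) * c (x + t *\<^sub>R axis i 1)) has_vector_derivative D ?y) (at t)"
      unfolding D_def using has_vector_derivative_mult[OF d1 d2] by (simp add: add.commute)
  qed simp
  also have "(\<integral>x. D x \<partial>lborel) = fourier_transform (partial_deriv i f) \<xi> + fourier_transform f \<xi> * (\<i> * k)"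
    unfolding D_def fourier_transform_cis c_def[symmetric]
    using rapid_integrable[OF r1] rapid_integrable[OF r2]
    by (subst Bochner_Integration.integral_add) (auto simp flip: mult.assoc)
  finally show ?thesis by (simp add: k_def add_eq_0_iff ac_simps)
qed

lemma fourier_transform_measurable[measurable (raw)]:
  assumes [measurable]: "f \<in> borel_measurable borel"
  shows "fourier_transform f \<in> borel_measurable borel"
  unfolding fourier_transform_cis[abs_def] by measurable

lemma fourier_transform_bound:
  "norm (fourier_transform f \<xi>) \<le> (\<integral>x. norm (f x) \<partial>lborel)"
  unfolding fourier_transform_cis
  using integral_norm_bound[of lborel "\<lambda>x. f x * cis (- (2 * pi * (x \<bullet> \<xi>)))"] by (simp add: norm_mult)

lemma schwartz_fourier_coordinate_decay:
  fixes f :: "real ^ 'n::finite \<Rightarrow> complex"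
  assumes f: "schwartz f"
  shows "\<exists>C. \<forall>\<xi>. \<bar>\<xi> $ i\<bar> ^ k * norm (fourier_transform f \<xi>) \<le> C"
  using f
proof (induction k arbitrary: f)
  case 0
  then show ?case using fourier_transform_bound by auto
next
  case (Suc k)
  then obtain C where C: "\<And>\<xi>. \<bar>\<xi> $ i\<bar> ^ k * norm (fourier_transform (partial_deriv i f) \<xi>) \<le> C"
    using schwartz_partial_deriv by blast
  have "\<bar>\<xi> $ i\<bar> ^ Suc k * norm (fourier_transform f \<xi>) \<le> C" for \<xi>
  proof -
    have "1 * (\<bar>\<xi> $ i\<bar> ^ Suc k * norm (fourier_transform f \<xi>)) \<le> (2 * pi) * (\<bar>\<xi> $ i\<bar> ^ Suc k * norm (fourier_transform f \<xi>))"
      using pi_gt3 by (intro mult_right_mono) auto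
    also have "\<dots> = \<bar>\<xi> $ i\<bar> ^ k * norm (fourier_transform (partial_deriv i f) \<xi>)"
      unfolding fourier_partial_deriv[OF Suc.prems] by (simp add: norm_mult)
    also have "\<dots> \<le> C" by (rule C)
    finally show ?thesis by simp
  qed
  then show ?case by blast
qed

lemma schwartz_fourier_rapid:
  fixes f :: "real ^ 'n::finite \<Rightarrow> complex"
  assumes f: "schwartz f"
  shows "rapid (fourier_transform f)"
proof -
  let ?m = "2 * DIM(real ^ 'n)"
  let ?F = "fourier_transform f"
  obtain C where C: "\<And>i \<xi>. \<bar>\<xi> $ i\<bar> ^ ?m * norm (?F \<xi>) \<le> C i"
  proof -
    have "\<exists>C. \<forall>i \<xi>. \<bar>\<xi> $ i\<bar> ^ ?m * norm (?F \<xi>) \<le> C i"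
      by (intro choice allI schwartz_fourier_coordinate_decay f)
    then show thesis using that by blast
  qed
  have [measurable]: "f \<in> borel_measurable borel" using schwartz_rapid[OF f] by (simp add: rapid_def)
  have "norm \<xi> ^ ?m * norm (?F \<xi>) \<le> real CARD('n) ^ ?m * (\<Sum>i\<in>UNIV. C i)" for \<xi>
  proof -
    define M where "M = Max (range (\<lambda>i. \<bar>\<xi> $ i\<bar>))"
    have M: "\<bar>\<xi> $ i\<bar> \<le> M" for i unfolding M_def by (rule Max_ge) auto
    have "M \<in> range (\<lambda>i. \<bar>\<xi> $ i\<bar>)" unfolding M_def by (rule Max_in) auto
    then obtain j where j: "M = \<bar>\<xi> $ j\<bar>" by auto
    have "norm \<xi> \<le> (\<Sum>i\<in>UNIV. \<bar>\<xi> $ i\<bar>)" by (rule norm_le_l1_cart)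
    also have "\<dots> \<le> (\<Sum>i\<in>(UNIV::'n set). M)" by (intro sum_mono M)
    also have "\<dots> = real CARD('n) * M" by simp
    finally have "norm \<xi> ^ ?m \<le> (real CARD('n) * M) ^ ?m" by (intro power_mono) auto
    then have "norm \<xi> ^ ?m * norm (?F \<xi>) \<le> (real CARD('n) * M) ^ ?m * norm (?F \<xi>)"
      by (rule mult_right_mono) auto
    also have "\<dots> = real CARD('n) ^ ?m * (\<bar>\<xi> $ j\<bar> ^ ?m * norm (?F \<xi>))"
      by (simp add: power_mult_distrib j)
    also have "\<bar>\<xi> $ j\<bar> ^ ?m * norm (?F \<xi>) \<le> C j" by (rule C)
    also have "C j \<le> (\<Sum>i\<in>UNIV. C i)"
    proof (rule member_le_sum)
      fix i show "0 \<le> C i" by (rule order_trans[OF _ C[of 0 i]]) simp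
    qed auto
    finally show ?thesis by (simp add: mult_left_mono)
  qed
  then show ?thesis
    by (intro rapidI[OF _ fourier_transform_bound]) auto
qed

lemma fourier_transform_L2_le:
  fixes f :: "real ^ 'n::finite \<Rightarrow> complex"
  assumes "integrable lborel f"
  shows "(\<integral>\<^sup>+\<xi>. (ennreal (norm (fourier_transform f \<xi>)))\<^sup>2 \<partial>lborel) \<le> (\<integral>\<^sup>+x. (ennreal (norm (f x)))\<^sup>2 \<partial>lborel)"
proof -
  have "fourier_transform f \<xi> = cnj (ift (\<lambda>x. cnj (f x)) \<xi>)" for \<xi>
    unfolding ift_def fourier_transform_cis
    using Bochner_Integration.integral_cnj[of lborel "\<lambda>x. cnj (f x) * cis (2 * pi * (\<xi> \<bullet> x))"]
    by (simp only: complex_cnj_mult cis_cnj complex_cnj_cnj inner_commute)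
  then show ?thesis
    using plancherel_le[OF integrable_cnj[OF assms]] by simp
qed

lemma norm_L2_square:
  fixes f :: "real ^ 'n::finite \<Rightarrow> complex"
  assumes "schwartz f"
  shows "(\<integral>\<^sup>+x. (ennreal (norm (f x)))\<^sup>2 \<partial>lborel) = ennreal ((norm_L2 f)\<^sup>2)"
proof -
  have "(\<integral>\<^sup>+x. ennreal ((norm (f x))\<^sup>2) \<partial>lborel) = ennreal (\<integral>x. (norm (f x))\<^sup>2 \<partial>lborel)"
    by (rule nn_integral_eq_integral[OF rapid_square_integrable[OF schwartz_rapid[OF assms]]]) auto
  then show ?thesis by (simp add: norm_L2_def ennreal_power)
qed

section \<open>Slicing the bilinear means\<close>

text \<open>
  The argument \<open>F\<close> stands for the Fourier transform of the function on which the multiplier operator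
  acts.
\<close>

definition bessel_mean :: "real \<Rightarrow> real \<Rightarrow> ('a::euclidean_space \<Rightarrow> complex) \<Rightarrow> 'a \<Rightarrow> complex" where
  "bessel_mean a r F x = ift (\<lambda>\<xi>. of_real (besselB a (r * (norm \<xi>)\<^sup>2)) * F \<xi>) x"

lemma bessel_mean_measurable[measurable (raw)]:
  assumes [measurable]: "F \<in> borel_measurable borel" "p \<in> borel_measurable M" "q \<in> borel_measurable M"
  shows "(\<lambda>z. bessel_mean a (p z) F (q z)) \<in> borel_measurable M"
  unfolding bessel_mean_def by measurable

lemma integrable_bounded_mult:
  fixes F :: "'a::euclidean_space \<Rightarrow> complex" and k :: "'a \<Rightarrow> real"
  assumes F: "integrable lborel F" and [measurable]: "k \<in> borel_measurable borel"
    and k: "\<And>\<xi>. \<bar>k \<xi>\<bar> \<le> C"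
  shows "integrable lborel (\<lambda>\<xi>. of_real (k \<xi>) * F \<xi>)"
proof -
  have [measurable]: "F \<in> borel_measurable borel" using F by auto
  show ?thesis
  proof (rule Bochner_Integration.integrable_bound[OF integrable_mult_right[OF integrable_norm[OF F], of C]])
    show "AE x in lborel. norm (of_real (k x) * F x) \<le> norm (C * norm (F x))"
      by (intro AE_I2) (simp add: norm_mult abs_mult mult_right_mono order_trans[OF k abs_ge_self])
  qed measurable
qed

lemma bessel_mean_bound:
  assumes a: "a \<ge> - 1 / 2" and r: "r \<ge> 0" and F: "integrable lborel F"
  shows "norm (bessel_mean a r F x) \<le> \<bar>besselB a 0\<bar> * (\<integral>\<xi>. norm (F \<xi>) \<partial>lborel)"
proof -
  have k: "\<bar>besselB a (r * (norm \<xi>)\<^sup>2)\<bar> \<le> \<bar>besselB a 0\<bar>" for \<xi> :: 'a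
    using besselB_bound[OF a] r by simp
  have int: "integrable lborel (\<lambda>\<xi>. of_real (besselB a (r * (norm \<xi>)\<^sup>2)) * F \<xi>)"
    by (rule integrable_bounded_mult[OF F _ k]) measurable
  have "norm (bessel_mean a r F x) \<le> (\<integral>\<xi>. norm (of_real (besselB a (r * (norm \<xi>)\<^sup>2)) * F \<xi>) \<partial>lborel)"
    unfolding bessel_mean_def by (rule norm_ift_le_real[OF int])
  also have "\<dots> \<le> (\<integral>\<xi>. \<bar>besselB a 0\<bar> * norm (F \<xi>) \<partial>lborel)"
    using F int k by (intro integral_mono integrable_norm integrable_mult_right) (auto simp: norm_mult intro!: mult_right_mono)
  finally show ?thesis by simp
qed

lemma integrable_beta_weight: "a > - 1 \<Longrightarrow> integrable lborel (beta_weight a)"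
  using beta_weight_power_integrable[of a 0 0] by simp

text \<open>
  Sonine's integral with \<open>p = t |\<xi>|\<^sup>2\<close> and \<open>q = t |\<eta>|\<^sup>2\<close> decouples the two frequencies. For fixed \<open>u\<close>
  the integrals in \<open>\<xi>\<close> and \<open>\<eta>\<close> then separate into two linear means.
\<close>

lemma bessel_bilinear_slicing:
  fixes F G :: "'a::euclidean_space \<Rightarrow> complex"
  assumes a: "a \<ge> - 1 / 2" and t: "t \<ge> 0" and F: "integrable lborel F" and G: "integrable lborel G"
  shows "(\<integral>\<xi>. (\<integral>\<eta>. of_real (besselB (2 * a + 1) (t * (norm \<xi>)\<^sup>2 + t * (norm \<eta>)\<^sup>2)) * F \<xi> * G \<eta> *
        cis (2 * pi * (x \<bullet> (\<xi> + \<eta>))) \<partial>lborel) \<partial>lborel)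
    = (\<integral>u. bessel_mean a (t * u) F x * (bessel_mean a (t * (1 - u)) G x * of_real (beta_weight a u)) \<partial>lborel)"
proof -
  let ?B = "\<lambda>p. complex_of_real (besselB a p)"
  let ?w = "\<lambda>u. complex_of_real (beta_weight a u)"
  \<comment> \<open>The Bessel factors are bounded for nonnegative arguments only, so the kernels are cut off to \<open>{0..1}\<close>.\<close>
  let ?i = "\<lambda>u. complex_of_real (indicator {0..1::real} u)"
  define b0 where "b0 = \<bar>besselB a 0\<bar>"
  define A where "A F \<xi> = F \<xi> * cis (2 * pi * (x \<bullet> \<xi>))" for F :: "'a \<Rightarrow> complex" and \<xi>
  have a1: "a > - 1" using a by simp
  have [measurable]: "F \<in> borel_measurable borel" "G \<in> borel_measurable borel" using F G by auto
  have sf: "sigma_finite_measure (lborel :: 'a measure)" "sigma_finite_measure (lborel :: real measure)"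
    by (rule lborel.sigma_finite_measure_axioms)+
  have iA: "integrable lborel (A F)" "integrable lborel (A G)"
    unfolding A_def by (auto intro!: integrable_mult_cis F G)
  have iw: "integrable lborel ?w" by (intro integrable_of_real integrable_beta_weight a1)
  have wi: "?i u * ?w u = ?w u" for u by (simp add: beta_weight_def indicator_def)
  have B: "norm (?B p) \<le> b0" if "p \<ge> 0" for p
    unfolding norm_of_real b0_def by (rule besselB_bound[OF a that])
  have b0: "0 \<le> b0" by (simp add: b0_def)
  have bm: "bessel_mean a r F' x = (\<integral>\<xi>. A F' \<xi> * ?B (r * (norm \<xi>)\<^sup>2) \<partial>lborel)" for r F'
    unfolding bessel_mean_def ift_def A_def by (simp add: ac_simps)
  have inner: "(\<integral>\<eta>. of_real (besselB (2 * a + 1) (t * (norm \<xi>)\<^sup>2 + t * (norm \<eta>)\<^sup>2)) * F \<xi> * G \<eta> *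
        cis (2 * pi * (x \<bullet> (\<xi> + \<eta>))) \<partial>lborel)
      = A F \<xi> * (\<integral>u. (?i u * ?B (t * u * (norm \<xi>)\<^sup>2)) * (bessel_mean a (t * (1 - u)) G x * ?w u) \<partial>lborel)" for \<xi>
  proof -
    define K where "K = (\<lambda>(\<eta>::'a, u). ?i u * ?B (t * u * (norm \<xi>)\<^sup>2) * ?B (t * (1 - u) * (norm \<eta>)\<^sup>2))"
    have Km: "K \<in> borel_measurable (lborel \<Otimes>\<^sub>M lborel)" unfolding K_def by measurable
    have Kb: "norm (K (\<eta>, u)) \<le> b0 * b0" for \<eta> u
    proof (cases "u \<in> {0..1}")
      case True
      then show ?thesis
        unfolding K_def using t b0 by (auto simp: norm_mult simp del: norm_of_real intro!: mult_mono B)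
    qed (simp add: K_def b0)
    have "of_real (besselB (2 * a + 1) (t * (norm \<xi>)\<^sup>2 + t * (norm \<eta>)\<^sup>2)) = (\<integral>u. K (\<eta>, u) * ?w u \<partial>lborel)" for \<eta>
    proof -
      have "K (\<eta>, u) * ?w u = of_real (besselB a (t * (norm \<xi>)\<^sup>2 * u) * besselB a (t * (norm \<eta>)\<^sup>2 * (1 - u)) * beta_weight a u)" for u
        using wi[of u] by (auto simp: K_def ac_simps)
      then show ?thesis
        unfolding besselB_sonine[OF a1] by (simp only: integral_complex_of_real)
    qed
    then have "(\<integral>\<eta>. of_real (besselB (2 * a + 1) (t * (norm \<xi>)\<^sup>2 + t * (norm \<eta>)\<^sup>2)) * F \<xi> * G \<eta> *
        cis (2 * pi * (x \<bullet> (\<xi> + \<eta>))) \<partial>lborel)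
        = (\<integral>\<eta>. A F \<xi> * (A G \<eta> * (\<integral>u. K (\<eta>, u) * ?w u \<partial>lborel)) \<partial>lborel)"
      by (simp add: A_def inner_add_right distrib_left cis_mult[symmetric] ac_simps)
    also have "\<dots> = A F \<xi> * (\<integral>\<eta>. A G \<eta> * (\<integral>u. K (\<eta>, u) * ?w u \<partial>lborel) \<partial>lborel)" by simp
    also have "(\<integral>\<eta>. A G \<eta> * (\<integral>u. K (\<eta>, u) * ?w u \<partial>lborel) \<partial>lborel)
        = (\<integral>u. (\<integral>\<eta>. A G \<eta> * K (\<eta>, u) \<partial>lborel) * ?w u \<partial>lborel)"
      by (rule fubini_bounded_kernel[OF sf iA(2) iw Km Kb])
    also have "(\<lambda>u. \<integral>\<eta>. A G \<eta> * K (\<eta>, u) \<partial>lborel)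
        = (\<lambda>u. (?i u * ?B (t * u * (norm \<xi>)\<^sup>2)) * bessel_mean a (t * (1 - u)) G x)"
    proof
      fix u
      have "(\<integral>\<eta>. A G \<eta> * K (\<eta>, u) \<partial>lborel)
          = (\<integral>\<eta>. (?i u * ?B (t * u * (norm \<xi>)\<^sup>2)) * (A G \<eta> * ?B (t * (1 - u) * (norm \<eta>)\<^sup>2)) \<partial>lborel)"
        by (simp add: K_def ac_simps)
      then show "(\<integral>\<eta>. A G \<eta> * K (\<eta>, u) \<partial>lborel)
          = (?i u * ?B (t * u * (norm \<xi>)\<^sup>2)) * bessel_mean a (t * (1 - u)) G x"
        unfolding bm by (simp only: integral_mult_right_zero)
    qed
    finally show ?thesis by (simp add: mult.assoc)
  qed
  define b where "b u = bessel_mean a (t * (1 - u)) G x * ?w u" for u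
  have ib: "integrable lborel b"
  proof (rule Bochner_Integration.integrable_bound[OF integrable_mult_right[OF integrable_beta_weight[OF a1],
          of "b0 * (\<integral>\<xi>. norm (G \<xi>) \<partial>lborel)"]])
    show "b \<in> borel_measurable lborel" unfolding b_def by measurable
    have "norm (b u) \<le> b0 * (\<integral>\<xi>. norm (G \<xi>) \<partial>lborel) * beta_weight a u" for u
    proof (cases "u \<in> {0..1}")
      case True
      then have "norm (bessel_mean a (t * (1 - u)) G x) \<le> b0 * (\<integral>\<xi>. norm (G \<xi>) \<partial>lborel)"
        unfolding b0_def using t by (intro bessel_mean_bound a G) auto
      then show ?thesis
        using mult_right_mono[OF _ beta_weight_nonneg[of a u]] beta_weight_nonneg[of a u] by (simp add: b_def norm_mult)
    qed (simp add: b_def beta_weight_def)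
    then show "AE u in lborel. norm (b u) \<le> norm (b0 * (\<integral>\<xi>. norm (G \<xi>) \<partial>lborel) * beta_weight a u)"
      by (intro AE_I2) (auto intro: order_trans[OF _ abs_ge_self])
  qed
  define K where "K = (\<lambda>(\<xi>::'a, u). ?i u * ?B (t * u * (norm \<xi>)\<^sup>2))"
  have Km: "K \<in> borel_measurable (lborel \<Otimes>\<^sub>M lborel)" unfolding K_def by measurable
  have Kb: "norm (K (\<eta>, u)) \<le> b0" for \<eta> u
  proof (cases "u \<in> {0..1}")
    case True
    then show ?thesis
      unfolding K_def using t b0 B[of "t * u * (norm \<eta>)\<^sup>2"] by (simp add: norm_mult del: norm_of_real)
  qed (simp add: K_def b0)
  have "(\<integral>\<xi>. A F \<xi> * (\<integral>u. K (\<xi>, u) * b u \<partial>lborel) \<partial>lborel) = (\<integral>u. (\<integral>\<xi>. A F \<xi> * K (\<xi>, u) \<partial>lborel) * b u \<partial>lborel)"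
    by (rule fubini_bounded_kernel[OF sf iA(1) ib Km Kb])
  also have "(\<lambda>u. (\<integral>\<xi>. A F \<xi> * K (\<xi>, u) \<partial>lborel) * b u) = (\<lambda>u. bessel_mean a (t * u) F x * b u)"
  proof
    fix u
    have "(\<integral>\<xi>. A F \<xi> * K (\<xi>, u) \<partial>lborel) = (\<integral>\<xi>. ?i u * (A F \<xi> * ?B (t * u * (norm \<xi>)\<^sup>2)) \<partial>lborel)"
      by (simp add: K_def ac_simps)
    then have "(\<integral>\<xi>. A F \<xi> * K (\<xi>, u) \<partial>lborel) = ?i u * bessel_mean a (t * u) F x"
      unfolding bm by (simp only: integral_mult_right_zero)
    moreover have "?i u * b u = b u" unfolding b_def using wi[of u] by (metis mult.left_commute)
    ultimately show "(\<integral>\<xi>. A F \<xi> * K (\<xi>, u) \<partial>lborel) * b u = bessel_mean a (t * u) F x * b u"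
      by (metis mult.assoc mult.commute)
  qed
  finally show ?thesis unfolding inner b_def K_def by simp
qed

lemma omega_eq_indicator:
  assumes "t \<ge> 0"
  shows "omega n \<mu> t = (if t = 0 then 0 else Gamma (\<mu> + real n + 1) / 2 * besselB (\<mu> + real n) t)"
  using assms omega_eq_besselB[of t n \<mu>] by (auto simp: omega_def)

lemma bilinear_mean_eq:
  fixes f g :: "real ^ 'n::finite \<Rightarrow> complex"
  assumes f: "schwartz f" and g: "schwartz g" and s: "s > 0"
    and a: "a \<ge> - 1 / 2" and \<mu>: "\<mu> + real CARD('n) = 2 * a + 1"
  shows "bilinear_mean \<mu> s f g x = of_real (Gamma (2 * a + 2) / 2) *
    (\<integral>u. bessel_mean a (s\<^sup>2 * u) (fourier_transform f) x *
      (bessel_mean a (s\<^sup>2 * (1 - u)) (fourier_transform g) x * of_real (beta_weight a u)) \<partial>lborel)"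
proof -
  let ?F = "fourier_transform f" and ?G = "fourier_transform g"
  let ?c = "Gamma (2 * a + 2) / 2"
  have F: "integrable lborel ?F" and G: "integrable lborel ?G"
    using rapid_integrable[OF schwartz_fourier_rapid] f g by auto
  have [measurable]: "?F \<in> borel_measurable borel" "?G \<in> borel_measurable borel" using F G by auto
  have e: "exp (2 * of_real pi * \<i> * of_real y) = cis (2 * pi * y)" for y
    by (simp add: cis_conv_exp ac_simps)
  have np: "s\<^sup>2 * (norm (\<xi>, \<eta>))\<^sup>2 = s\<^sup>2 * (norm \<xi>)\<^sup>2 + s\<^sup>2 * (norm \<eta>)\<^sup>2" for \<xi> \<eta> :: "real ^ 'n"
    by (simp add: norm_Pair distrib_left)
  let ?B = "\<lambda>\<xi> \<eta>. besselB (2 * a + 1) (s\<^sup>2 * (norm \<xi>)\<^sup>2 + s\<^sup>2 * (norm \<eta>)\<^sup>2)"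
  have om: "omega CARD('n) \<mu> (s\<^sup>2 * (norm (\<xi>, \<eta>))\<^sup>2) = (if \<xi> = 0 \<and> \<eta> = 0 then 0 else ?c * ?B \<xi> \<eta>)" for \<xi> \<eta> :: "real ^ 'n"
  proof -
    show ?thesis
      using s omega_eq_indicator[of "s\<^sup>2 * (norm (\<xi>, \<eta>))\<^sup>2" "CARD('n)" \<mu>]
      unfolding np \<mu> by (simp add: add_nonneg_eq_0_iff add.commute[of 2])
  qed
  have "(\<integral>\<eta>. of_real (omega CARD('n) \<mu> (s\<^sup>2 * (norm (\<xi>, \<eta>))\<^sup>2)) * ?F \<xi> * ?G \<eta> * cis (2 * pi * (x \<bullet> (\<xi> + \<eta>))) \<partial>lborel)
      = (\<integral>\<eta>. of_real ?c * (of_real (?B \<xi> \<eta>) * ?F \<xi> * ?G \<eta> * cis (2 * pi * (x \<bullet> (\<xi> + \<eta>)))) \<partial>lborel)" for \<xi>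
    unfolding om
  proof (rule integral_cong_AE)
    \<comment> \<open>The definition of \<open>omega\<close> gives \<open>0\<close> instead of the limit when \<open>\<xi> = \<eta> = 0\<close>.\<close>
    show "AE \<eta> in lborel. of_real (if \<xi> = 0 \<and> \<eta> = 0 then 0 else ?c * ?B \<xi> \<eta>) * ?F \<xi> * ?G \<eta> * cis (2 * pi * (x \<bullet> (\<xi> + \<eta>)))
        = of_real ?c * (of_real (?B \<xi> \<eta>) * ?F \<xi> * ?G \<eta> * cis (2 * pi * (x \<bullet> (\<xi> + \<eta>))))"
      using AE_lborel_singleton[of "0 :: real ^ 'n"] by eventually_elim (simp add: mult.assoc)
  qed measurable
  then have "bilinear_mean \<mu> s f g x
      = (\<integral>\<xi>. of_real ?c * (\<integral>\<eta>. of_real (?B \<xi> \<eta>) * ?F \<xi> * ?G \<eta> * cis (2 * pi * (x \<bullet> (\<xi> + \<eta>))) \<partial>lborel) \<partial>lborel)"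
    unfolding bilinear_mean_def e by (simp only: integral_mult_right_zero)
  also have "\<dots> = of_real ?c * (\<integral>\<xi>. (\<integral>\<eta>. of_real (?B \<xi> \<eta>) * ?F \<xi> * ?G \<eta> * cis (2 * pi * (x \<bullet> (\<xi> + \<eta>))) \<partial>lborel) \<partial>lborel)"
    by (simp only: integral_mult_right_zero)
  also have "(\<integral>\<xi>. (\<integral>\<eta>. of_real (?B \<xi> \<eta>) * ?F \<xi> * ?G \<eta> * cis (2 * pi * (x \<bullet> (\<xi> + \<eta>))) \<partial>lborel) \<partial>lborel)
      = (\<integral>u. bessel_mean a (s\<^sup>2 * u) ?F x * (bessel_mean a (s\<^sup>2 * (1 - u)) ?G x * of_real (beta_weight a u)) \<partial>lborel)"
    by (rule bessel_bilinear_slicing[OF a _ F G]) simp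
  finally show ?thesis .
qed

text \<open>
  Up to a constant this is the mean of \<open>|bessel_mean a (t v\<^sup>2) F x|\<^sup>2\<close> over \<open>0 < v < 1\<close>, in the variable
  \<open>u = v\<^sup>2\<close>.
\<close>

definition square_mean :: "real \<Rightarrow> ('a::euclidean_space \<Rightarrow> complex) \<Rightarrow> real \<Rightarrow> 'a \<Rightarrow> ennreal" where
  "square_mean a F t x = (\<integral>\<^sup>+u. (ennreal (norm (bessel_mean a (t * u) F x)))\<^sup>2 *
     ennreal (u powr (- 1 / 2)) * indicator {0<..<1} u \<partial>lborel)"

lemma square_mean_reflect:
  fixes F :: "'a::euclidean_space \<Rightarrow> complex"
  assumes [measurable]: "F \<in> borel_measurable borel"
  shows "square_mean a F t x = (\<integral>\<^sup>+u. (ennreal (norm (bessel_mean a (t * (1 - u)) F x)))\<^sup>2 *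
     ennreal ((1 - u) powr (- 1 / 2)) * indicator {0<..<1} u \<partial>lborel)"
proof -
  have "square_mean a F t x = ennreal \<bar>- 1\<bar> * (\<integral>\<^sup>+u. (ennreal (norm (bessel_mean a (t * (1 + (- 1) * u)) F x)))\<^sup>2 *
     ennreal ((1 + (- 1) * u) powr (- 1 / 2)) * indicator {0<..<1} (1 + (- 1) * u) \<partial>lborel)"
    unfolding square_mean_def by (rule nn_integral_real_affine) measurable
  also have "\<dots> = (\<integral>\<^sup>+u. (ennreal (norm (bessel_mean a (t * (1 - u)) F x)))\<^sup>2 *
     ennreal ((1 - u) powr (- 1 / 2)) * indicator {0<..<1} u \<partial>lborel)"
    by (auto intro!: nn_integral_cong split: split_indicator)
  finally show ?thesis .
qed

text \<open>
  This is where \<open>a \<ge> - 1 / 4\<close> enters, that is, \<open>\<mu> + n \<ge> 1 / 2\<close>. The squares of the two factors are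
  the weight \<open>u powr (- 1 / 2)\<close> of \<open>square_mean\<close> and its reflection.
\<close>

lemma beta_weight_le:
  assumes a: "a \<ge> - 1 / 4"
  shows "beta_weight a u \<le> (u powr (- 1 / 4) * indicator {0<..<1} u) * ((1 - u) powr (- 1 / 4) * indicator {0<..<1} u)"
proof (cases "u \<in> {0<..<1}")
  case True
  have "v powr a \<le> v powr (- 1 / 4)" if "0 < v" "v < 1" for v
    using that a by (intro powr_mono') auto
  then show ?thesis using True by (auto simp: beta_weight_def intro!: mult_mono)
next
  case False
  then have "u = 0 \<or> u = 1 \<or> u \<notin> {0..1}" by auto
  then show ?thesis by (auto simp: beta_weight_def)
qed

text \<open>
  The Cauchy-Schwarz inequality in \<open>u\<close>, as a family of weighted arithmetic-geometric means. The
  parameter \<open>l\<close> can be the same for all \<open>x\<close> and \<open>s\<close>, so it is optimised after integrating in \<open>x\<close>.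
\<close>

lemma bilinear_mean_le:
  fixes f g :: "real ^ 'n::finite \<Rightarrow> complex"
  assumes f: "schwartz f" and g: "schwartz g" and s: "s > 0"
    and a: "a \<ge> - 1 / 4" and \<mu>: "\<mu> + real CARD('n) = 2 * a + 1" and l: "l > 0"
  shows "2 * ennreal (norm (bilinear_mean \<mu> s f g x)) \<le> ennreal (Gamma (2 * a + 2) / 2) *
    (ennreal l * square_mean a (fourier_transform f) (s\<^sup>2) x + ennreal (1 / l) * square_mean a (fourier_transform g) (s\<^sup>2) x)"
proof -
  let ?F = "fourier_transform f" and ?G = "fourier_transform g"
  let ?c = "Gamma (2 * a + 2) / 2"
  have c: "?c > 0" using a by (auto intro!: Gamma_real_pos)
  have [measurable]: "?F \<in> borel_measurable borel" "?G \<in> borel_measurable borel"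
    using schwartz_fourier_rapid[OF f] schwartz_fourier_rapid[OF g] by (auto simp: rapid_def)
  let ?P = "\<lambda>u. ennreal (norm (bessel_mean a (s\<^sup>2 * u) ?F x)) * ennreal (u powr (- 1 / 4) * indicator {0<..<1} u)"
  let ?Q = "\<lambda>u. ennreal (norm (bessel_mean a (s\<^sup>2 * (1 - u)) ?G x)) * ennreal ((1 - u) powr (- 1 / 4) * indicator {0<..<1} u)"
  have sq: "(ennreal p * ennreal (v powr (- 1 / 4) * indicator {0<..<1} u))\<^sup>2
      = (ennreal p)\<^sup>2 * ennreal (v powr (- 1 / 2)) * indicator {0<..<1} u" for p u v :: real
  proof -
    have "(v powr (- 1 / 4))\<^sup>2 = v powr (- 1 / 2)" by (simp add: power2_eq_square flip: powr_add)
    then have "(ennreal (v powr (- 1 / 4) * indicator {0<..<1} u))\<^sup>2 = ennreal (v powr (- 1 / 2)) * indicator {0<..<1} u"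
      by (auto simp: ennreal_power split: split_indicator)
    then show ?thesis by (simp only: power_mult_distrib mult.assoc)
  qed
  let ?I = "\<integral>u. bessel_mean a (s\<^sup>2 * u) ?F x * (bessel_mean a (s\<^sup>2 * (1 - u)) ?G x * of_real (beta_weight a u)) \<partial>lborel"
  have "bilinear_mean \<mu> s f g x = of_real ?c * ?I"
    using a by (intro bilinear_mean_eq[OF f g s _ \<mu>]) auto
  then have "norm (bilinear_mean \<mu> s f g x) = ?c * norm ?I"
    by (simp only: norm_mult norm_of_real abs_of_pos[OF c])
  then have "ennreal (norm (bilinear_mean \<mu> s f g x)) = ennreal ?c * ennreal (norm ?I)"
    using c by (simp only: ennreal_mult[OF less_imp_le] norm_ge_zero)
  also have "\<dots> \<le> ennreal ?c * (\<integral>\<^sup>+u. ?P u * ?Q u \<partial>lborel)"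
  proof (intro mult_left_mono order_trans[OF norm_integral_le_nn] nn_integral_mono)
    fix u :: real
    let ?p = "norm (bessel_mean a (s\<^sup>2 * u) ?F x)" and ?q = "norm (bessel_mean a (s\<^sup>2 * (1 - u)) ?G x)"
    have "norm (bessel_mean a (s\<^sup>2 * u) ?F x * (bessel_mean a (s\<^sup>2 * (1 - u)) ?G x * of_real (beta_weight a u)))
        = ?p * ?q * beta_weight a u"
      using beta_weight_nonneg[of a u] by (simp add: norm_mult)
    also have "\<dots> \<le> ?p * ?q * ((u powr (- 1 / 4) * indicator {0<..<1} u) * ((1 - u) powr (- 1 / 4) * indicator {0<..<1} u))"
      using a by (intro mult_left_mono beta_weight_le) auto
    also have "\<dots> = (?p * (u powr (- 1 / 4) * indicator {0<..<1} u)) * (?q * ((1 - u) powr (- 1 / 4) * indicator {0<..<1} u))"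
      by (simp only: ac_simps)
    finally show "ennreal (norm (bessel_mean a (s\<^sup>2 * u) ?F x * (bessel_mean a (s\<^sup>2 * (1 - u)) ?G x * of_real (beta_weight a u))))
        \<le> ?P u * ?Q u"
      by (subst ennreal_mult[symmetric], simp, simp)+ (rule ennreal_leI)
  qed simp
  finally have "ennreal (norm (bilinear_mean \<mu> s f g x)) \<le> ennreal ?c * (\<integral>\<^sup>+u. ?P u * ?Q u \<partial>lborel)" .
  then have "2 * ennreal (norm (bilinear_mean \<mu> s f g x)) \<le> 2 * (ennreal ?c * (\<integral>\<^sup>+u. ?P u * ?Q u \<partial>lborel))"
    by (rule mult_left_mono) simp
  also have "\<dots> = ennreal ?c * (2 * (\<integral>\<^sup>+u. ?P u * ?Q u \<partial>lborel))"
    by (rule mult.left_commute)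
  also have "\<dots> \<le> ennreal ?c * (ennreal l * (\<integral>\<^sup>+u. (?P u)\<^sup>2 \<partial>lborel) + ennreal (1 / l) * (\<integral>\<^sup>+u. (?Q u)\<^sup>2 \<partial>lborel))"
    by (intro mult_left_mono nn_integral_am_gm l) auto
  also have "(\<integral>\<^sup>+u. (?P u)\<^sup>2 \<partial>lborel) = square_mean a ?F (s\<^sup>2) x"
    unfolding sq square_mean_def ..
  also have "(\<integral>\<^sup>+u. (?Q u)\<^sup>2 \<partial>lborel) = square_mean a ?G (s\<^sup>2) x"
    unfolding sq by (rule square_mean_reflect[symmetric]) measurable
  finally show ?thesis .
qed

section \<open>Maximal bounds for the linear means\<close>

text \<open>
  Inserting the definition of the Fourier transform and integrating in \<open>\<xi>\<close> first leaves the Fourier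
  transform of the Gaussian, which is the heat kernel.
\<close>

lemma heat_mean_eq:
  fixes f :: "real ^ 'n::finite \<Rightarrow> complex"
  assumes f: "integrable lborel f" and r: "r > 0"
  shows "ift (\<lambda>\<xi>. of_real (exp (- pi * r * (norm \<xi>)\<^sup>2)) * fourier_transform f \<xi>) x
    = (\<integral>y. of_real (heat r (x - y)) * f y \<partial>lborel)"
proof -
  let ?g = "\<lambda>\<xi>. of_real (exp (- pi * r * (norm \<xi>)\<^sup>2)) * cis (2 * pi * (x \<bullet> \<xi>))"
  have [measurable]: "f \<in> borel_measurable borel" using f by auto
  have "ift (\<lambda>\<xi>. of_real (exp (- pi * r * (norm \<xi>)\<^sup>2)) * fourier_transform f \<xi>) x
      = (\<integral>\<xi>. ?g \<xi> * (\<integral>y. cis (- (2 * pi * (y \<bullet> \<xi>))) * f y \<partial>lborel) \<partial>lborel)"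
    unfolding ift_def fourier_transform_cis by (simp add: ac_simps)
  also have "\<dots> = (\<integral>y. (\<integral>\<xi>. ?g \<xi> * cis (- (2 * pi * (y \<bullet> \<xi>))) \<partial>lborel) * f y \<partial>lborel)"
    using fubini_bounded_kernel[OF lborel.sigma_finite_measure_axioms lborel.sigma_finite_measure_axioms
        gaussian_integrable[OF r, of x] f, of "\<lambda>(\<xi>, y). cis (- (2 * pi * (y \<bullet> \<xi>)))" 1]
    by simp
  also have "(\<lambda>y. \<integral>\<xi>. ?g \<xi> * cis (- (2 * pi * (y \<bullet> \<xi>))) \<partial>lborel) = (\<lambda>y. of_real (heat r (x - y)))"
  proof
    fix y
    have e: "?g \<xi> * cis (- (2 * pi * (y \<bullet> \<xi>)))
        = of_real (exp (- pi * r * (norm \<xi>)\<^sup>2)) * cis (2 * pi * ((x - y) \<bullet> \<xi>))" for \<xi>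
      by (simp add: cis_mult inner_diff_left algebra_simps)
    show "(\<integral>\<xi>. ?g \<xi> * cis (- (2 * pi * (y \<bullet> \<xi>))) \<partial>lborel) = of_real (heat r (x - y))"
      unfolding e by (rule gaussian_fourier[OF r])
  qed
  finally show ?thesis .
qed

definition bessel_rest :: "real \<Rightarrow> real \<Rightarrow> ('a::euclidean_space \<Rightarrow> complex) \<Rightarrow> 'a \<Rightarrow> complex" where
  "bessel_rest a r F x = ift (\<lambda>\<xi>. of_real (besselD a (r * (norm \<xi>)\<^sup>2)) * F \<xi>) x"

lemma bessel_rest_measurable[measurable (raw)]:
  assumes [measurable]: "F \<in> borel_measurable borel" "p \<in> borel_measurable M" "q \<in> borel_measurable M"
  shows "(\<lambda>z. bessel_rest a (p z) F (q z)) \<in> borel_measurable M"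
  unfolding bessel_rest_def by measurable

lemma besselD_bound:
  assumes a: "a \<ge> - 1 / 2" and r: "r \<ge> 0"
  shows "\<bar>besselD a r\<bar> \<le> 2 * \<bar>besselB a 0\<bar>"
proof -
  have "\<bar>besselB a 0 * exp (- pi * r)\<bar> \<le> \<bar>besselB a 0\<bar> * 1"
    unfolding abs_mult using r by (intro mult_left_mono) auto
  then show ?thesis using besselB_bound[OF a r] unfolding besselD_def by linarith
qed

lemma integrable_besselD_mult:
  fixes F :: "'a::euclidean_space \<Rightarrow> complex"
  assumes a: "a \<ge> - 1 / 2" and r: "r \<ge> 0" and F: "integrable lborel F"
  shows "integrable lborel (\<lambda>\<xi>. of_real (besselD a (r * (norm \<xi>)\<^sup>2)) * F \<xi>)"
  by (rule integrable_bounded_mult[OF F, of _ "2 * \<bar>besselB a 0\<bar>"]) (use besselD_bound[OF a] r in auto)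

lemma bessel_mean_split:
  fixes f :: "real ^ 'n::finite \<Rightarrow> complex"
  assumes f: "schwartz f" and a: "a \<ge> - 1 / 2" and r: "r > 0"
  shows "bessel_mean a r (fourier_transform f) x
    = bessel_rest a r (fourier_transform f) x + of_real (besselB a 0) * (\<integral>y. of_real (heat r (x - y)) * f y \<partial>lborel)"
proof -
  let ?F = "fourier_transform f"
  have F: "integrable lborel ?F" by (rule rapid_integrable[OF schwartz_fourier_rapid[OF f]])
  have i1: "integrable lborel (\<lambda>\<xi>. of_real (besselD a (r * (norm \<xi>)\<^sup>2)) * ?F \<xi> * cis (2 * pi * (x \<bullet> \<xi>)))"
    using r by (intro integrable_mult_cis integrable_besselD_mult a F) auto
  have i2: "integrable lborel (\<lambda>\<xi>. of_real (exp (- pi * r * (norm \<xi>)\<^sup>2)) * ?F \<xi> * cis (2 * pi * (x \<bullet> \<xi>)))"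
    by (intro integrable_mult_cis integrable_bounded_mult[OF F, of _ 1]) (use r in auto)
  have "bessel_mean a r ?F x = (\<integral>\<xi>. of_real (besselD a (r * (norm \<xi>)\<^sup>2)) * ?F \<xi> * cis (2 * pi * (x \<bullet> \<xi>))
      + of_real (besselB a 0) * (of_real (exp (- pi * r * (norm \<xi>)\<^sup>2)) * ?F \<xi> * cis (2 * pi * (x \<bullet> \<xi>))) \<partial>lborel)"
    unfolding bessel_mean_def ift_def besselD_def by (simp add: algebra_simps)
  also have "\<dots> = bessel_rest a r ?F x
      + of_real (besselB a 0) * ift (\<lambda>\<xi>. of_real (exp (- pi * r * (norm \<xi>)\<^sup>2)) * ?F \<xi>) x"
    unfolding bessel_rest_def ift_def using i1 i2
    by (subst Bochner_Integration.integral_add) auto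
  finally show ?thesis unfolding heat_mean_eq[OF schwartz_integrable[OF f] r] .
qed

lemma bessel_mean_square_le:
  fixes f :: "real ^ 'n::finite \<Rightarrow> complex"
  assumes f: "schwartz f" and a: "a \<ge> - 1 / 2" and r: "r > 0"
  shows "(ennreal (norm (bessel_mean a r (fourier_transform f) x)))\<^sup>2
    \<le> 2 * (ennreal (norm (bessel_rest a r (fourier_transform f) x)))\<^sup>2
      + ennreal (2 * (besselB a 0)\<^sup>2 * 2 powr real CARD('n)) * heat_max2 (\<lambda>y. ennreal (norm (f y))) x"
proof -
  let ?E = "bessel_rest a r (fourier_transform f) x"
  let ?H = "\<integral>y. of_real (heat r (x - y)) * f y \<partial>lborel"
  let ?b = "besselB a 0"
  have [measurable]: "f \<in> borel_measurable borel" using schwartz_rapid[OF f] by (simp add: rapid_def)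
  have "norm (bessel_mean a r (fourier_transform f) x) \<le> norm ?E + \<bar>?b\<bar> * norm ?H"
    unfolding bessel_mean_split[OF f a r]
    by (rule order_trans[OF norm_triangle_ineq]) (simp add: norm_mult)
  then have "(norm (bessel_mean a r (fourier_transform f) x))\<^sup>2 \<le> (norm ?E + \<bar>?b\<bar> * norm ?H)\<^sup>2"
    by (intro power_mono) auto
  also have "\<dots> \<le> 2 * (norm ?E)\<^sup>2 + 2 * ?b\<^sup>2 * (norm ?H)\<^sup>2"
    using sum_squares_bound[of "norm ?E" "\<bar>?b\<bar> * norm ?H"] by (simp add: power2_sum power_mult_distrib)
  finally have "(ennreal (norm (bessel_mean a r (fourier_transform f) x)))\<^sup>2
      \<le> ennreal (2 * (norm ?E)\<^sup>2 + 2 * ?b\<^sup>2 * (norm ?H)\<^sup>2)"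
    by (simp add: ennreal_power ennreal_leI del: ennreal_plus)
  also have "\<dots> = 2 * (ennreal (norm ?E))\<^sup>2 + ennreal (2 * ?b\<^sup>2) * (ennreal (norm ?H))\<^sup>2"
    by (simp add: ennreal_mult ennreal_power)
  also have "ennreal (norm ?H) \<le> hconv r (\<lambda>y. ennreal (norm (f y))) x"
    using norm_integral_le_nn[of lborel "\<lambda>y. of_real (heat r (x - y)) * f y"]
    by (simp add: hconv_def norm_mult ennreal_mult)
  then have "(ennreal (norm ?H))\<^sup>2 \<le> (hconv r (\<lambda>y. ennreal (norm (f y))) x)\<^sup>2" by (rule power_mono) simp
  also have "\<dots> \<le> ennreal (2 powr real CARD('n)) * heat_max2 (\<lambda>y. ennreal (norm (f y))) x"
    using hconv_le_heat_max2[OF r, of "\<lambda>y. ennreal (norm (f y))" x] by simp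
  finally show ?thesis
    by (simp add: ennreal_mult mult.assoc add_left_mono mult_left_mono)
qed

text \<open>
  A square function in the style of Littlewood and Paley: it dominates the means of \<open>bessel_rest\<close> at
  all scales simultaneously.
\<close>

definition rest_square :: "real \<Rightarrow> ('a::euclidean_space \<Rightarrow> complex) \<Rightarrow> 'a \<Rightarrow> ennreal" where
  "rest_square a F x = (\<integral>\<^sup>+r. ennreal ((norm (bessel_rest a r F x))\<^sup>2 / r) * indicator {0<..} r \<partial>lborel)"

lemma rest_square_measurable[measurable (raw)]:
  assumes [measurable]: "F \<in> borel_measurable borel"
  shows "rest_square a F \<in> borel_measurable borel"
  unfolding rest_square_def by measurable

text \<open>
  Plancherel's inequality in \<open>x\<close> for each fixed \<open>r\<close>, followed by integration in \<open>r\<close> first: for every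
  \<open>\<xi>\<close> the dilation invariance of \<open>dr / r\<close> gives the same constant.
\<close>

lemma rest_square_L1:
  fixes F :: "'a::euclidean_space \<Rightarrow> complex"
  assumes a: "a \<ge> - 1 / 2" and F: "integrable lborel F"
  shows "(\<integral>\<^sup>+x. rest_square a F x \<partial>lborel) \<le> besselD_norm a * (\<integral>\<^sup>+\<xi>. (ennreal (norm (F \<xi>)))\<^sup>2 \<partial>lborel)"
proof -
  have [measurable]: "F \<in> borel_measurable borel" using F by auto
  have "(\<integral>\<^sup>+x. rest_square a F x \<partial>lborel)
      = (\<integral>\<^sup>+r. (\<integral>\<^sup>+x. ennreal ((norm (bessel_rest a r F x))\<^sup>2 / r) * indicator {0<..} r \<partial>lborel) \<partial>lborel)"
    unfolding rest_square_def by (rule lborel_pair.Fubini') measurable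
  also have "\<dots> \<le> (\<integral>\<^sup>+r. (\<integral>\<^sup>+\<xi>. (ennreal (norm (F \<xi>)))\<^sup>2 * (ennreal ((besselD a (r * (norm \<xi>)\<^sup>2))\<^sup>2 / r) * indicator {0<..} r) \<partial>lborel) \<partial>lborel)"
  proof (rule nn_integral_mono)
    fix r :: real
    show "(\<integral>\<^sup>+x. ennreal ((norm (bessel_rest a r F x))\<^sup>2 / r) * indicator {0<..} r \<partial>lborel)
        \<le> (\<integral>\<^sup>+\<xi>. (ennreal (norm (F \<xi>)))\<^sup>2 * (ennreal ((besselD a (r * (norm \<xi>)\<^sup>2))\<^sup>2 / r) * indicator {0<..} r) \<partial>lborel)"
    proof (cases "r > 0")
      case True
      have "(\<integral>\<^sup>+x. ennreal ((norm (bessel_rest a r F x))\<^sup>2 / r) * indicator {0<..} r \<partial>lborel)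
          = (\<integral>\<^sup>+x. ennreal (1 / r) * (ennreal (norm (bessel_rest a r F x)))\<^sup>2 \<partial>lborel)"
        using True by (simp add: ennreal_power flip: ennreal_mult)
      also have "\<dots> = ennreal (1 / r) * (\<integral>\<^sup>+x. (ennreal (norm (bessel_rest a r F x)))\<^sup>2 \<partial>lborel)"
        by (rule nn_integral_cmult) measurable
      also have "\<dots> \<le> ennreal (1 / r) * (\<integral>\<^sup>+\<xi>. (ennreal (norm (of_real (besselD a (r * (norm \<xi>)\<^sup>2)) * F \<xi>)))\<^sup>2 \<partial>lborel)"
        unfolding bessel_rest_def using True
        by (intro mult_left_mono plancherel_le integrable_besselD_mult a F) auto
      also have "\<dots> = (\<integral>\<^sup>+\<xi>. ennreal (1 / r) * (ennreal (norm (of_real (besselD a (r * (norm \<xi>)\<^sup>2)) * F \<xi>)))\<^sup>2 \<partial>lborel)"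
        by (rule nn_integral_cmult[symmetric]) measurable
      also have "\<dots> = (\<integral>\<^sup>+\<xi>. (ennreal (norm (F \<xi>)))\<^sup>2 * (ennreal ((besselD a (r * (norm \<xi>)\<^sup>2))\<^sup>2 / r) * indicator {0<..} r) \<partial>lborel)"
        using True by (intro nn_integral_cong)
          (simp add: ennreal_power norm_mult power_mult_distrib mult.commute flip: ennreal_mult)
      finally show ?thesis .
    qed simp
  qed
  also have "\<dots> = (\<integral>\<^sup>+\<xi>. (\<integral>\<^sup>+r. (ennreal (norm (F \<xi>)))\<^sup>2 * (ennreal ((besselD a (r * (norm \<xi>)\<^sup>2))\<^sup>2 / r) * indicator {0<..} r) \<partial>lborel) \<partial>lborel)"
    by (rule lborel_pair.Fubini') measurable
  also have "\<dots> = (\<integral>\<^sup>+\<xi>. (ennreal (norm (F \<xi>)))\<^sup>2 * (\<integral>\<^sup>+r. ennreal ((besselD a (r * (norm \<xi>)\<^sup>2))\<^sup>2 / r) * indicator {0<..} r \<partial>lborel) \<partial>lborel)"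
    by (intro nn_integral_cong nn_integral_cmult) measurable
  also have "\<dots> \<le> (\<integral>\<^sup>+\<xi>. (ennreal (norm (F \<xi>)))\<^sup>2 * besselD_norm a \<partial>lborel)"
  proof (intro nn_integral_mono mult_left_mono)
    fix \<xi> :: 'a
    show "(\<integral>\<^sup>+r. ennreal ((besselD a (r * (norm \<xi>)\<^sup>2))\<^sup>2 / r) * indicator {0<..} r \<partial>lborel) \<le> besselD_norm a"
    proof (cases "\<xi> = 0")
      case False
      then show ?thesis
        using nn_integral_dilation_invariant[of "\<lambda>r. (besselD a r)\<^sup>2" "(norm \<xi>)\<^sup>2"]
        by (simp add: besselD_norm_def mult.commute)
    qed (simp add: besselD_def)
  qed simp
  also have "\<dots> = besselD_norm a * (\<integral>\<^sup>+\<xi>. (ennreal (norm (F \<xi>)))\<^sup>2 \<partial>lborel)"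
    by (simp add: nn_integral_cmult mult.commute)
  finally show ?thesis .
qed

lemma nn_integral_inverse_sqrt_finite:
  "(\<integral>\<^sup>+u. ennreal (u powr (- 1 / 2)) * indicator {0<..<1} u \<partial>lborel) < \<infinity>"
proof -
  have "set_integrable lborel {0..1} (\<lambda>t. t powr (1 / 2 - 1) * (1 - t) powr (1 - 1) :: real)"
    by (rule integrable_Beta) auto
  then have "(\<integral>\<^sup>+u. ennreal (norm (indicator {0..1} u *\<^sub>R (u powr (1 / 2 - 1) * (1 - u) powr (1 - 1)) :: real)) \<partial>lborel) < \<infinity>"
    unfolding set_integrable_def integrable_iff_bounded by blast
  moreover have "(\<integral>\<^sup>+u. ennreal (u powr (- 1 / 2)) * indicator {0<..<1} u \<partial>lborel)
      \<le> (\<integral>\<^sup>+u. ennreal (norm (indicator {0..1} u *\<^sub>R (u powr (1 / 2 - 1) * (1 - u) powr (1 - 1)) :: real)) \<partial>lborel)"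
    by (intro nn_integral_mono) (auto split: split_indicator)
  ultimately show ?thesis by (rule le_less_trans[rotated])
qed

definition square_majorant :: "real \<Rightarrow> (real ^ 'n::finite \<Rightarrow> complex) \<Rightarrow> real ^ 'n \<Rightarrow> ennreal" where
  "square_majorant a f x = 2 * rest_square a (fourier_transform f) x
    + ennreal (2 * (besselB a 0)\<^sup>2 * 2 powr real CARD('n)) *
      (\<integral>\<^sup>+u. ennreal (u powr (- 1 / 2)) * indicator {0<..<1} u \<partial>lborel) * heat_max2 (\<lambda>y. ennreal (norm (f y))) x"

text \<open>
  The Gaussian part is estimated by the heat maximal function, uniformly in \<open>u\<close>. For the rest,
  \<open>u powr (- 1 / 2) \<le> 1 / u\<close> on the unit interval makes the bound invariant under dilations and hence
  independent of \<open>t\<close>.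
\<close>

lemma square_mean_le_majorant:
  fixes f :: "real ^ 'n::finite \<Rightarrow> complex"
  assumes f: "schwartz f" and a: "a \<ge> - 1 / 2" and t: "t > 0"
  shows "square_mean a (fourier_transform f) t x \<le> square_majorant a f x"
proof -
  let ?F = "fourier_transform f"
  let ?c = "ennreal (2 * (besselB a 0)\<^sup>2 * 2 powr real CARD('n))"
  let ?H = "heat_max2 (\<lambda>y. ennreal (norm (f y))) x"
  let ?E = "\<lambda>r. (norm (bessel_rest a r ?F x))\<^sup>2"
  have [measurable]: "?F \<in> borel_measurable borel"
    using schwartz_fourier_rapid[OF f] by (simp add: rapid_def)
  have "square_mean a ?F t x \<le> (\<integral>\<^sup>+u. 2 * (ennreal (?E (t * u) / u) * indicator {0<..} u)
      + ?c * ?H * (ennreal (u powr (- 1 / 2)) * indicator {0<..<1} u) \<partial>lborel)"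
    unfolding square_mean_def
  proof (rule nn_integral_mono)
    fix u :: real
    show "(ennreal (norm (bessel_mean a (t * u) ?F x)))\<^sup>2 * ennreal (u powr (- 1 / 2)) * indicator {0<..<1} u
        \<le> 2 * (ennreal (?E (t * u) / u) * indicator {0<..} u)
          + ?c * ?H * (ennreal (u powr (- 1 / 2)) * indicator {0<..<1} u)"
    proof (cases "u \<in> {0<..<1}")
      case True
      have "u powr (- 1 / 2) \<le> u powr (- 1)" using True by (intro powr_mono') auto
      also have "u powr (- 1) = 1 / u" using True by (simp add: powr_minus_divide)
      finally have "?E (t * u) * u powr (- 1 / 2) \<le> ?E (t * u) * (1 / u)"
        by (intro mult_left_mono) auto
      then have "?E (t * u) * u powr (- 1 / 2) \<le> ?E (t * u) / u" by simp
      then have E: "(ennreal (norm (bessel_rest a (t * u) ?F x)))\<^sup>2 * ennreal (u powr (- 1 / 2)) \<le> ennreal (?E (t * u) / u)"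
        by (simp add: ennreal_power ennreal_leI flip: ennreal_mult)
      have "(ennreal (norm (bessel_mean a (t * u) ?F x)))\<^sup>2 * ennreal (u powr (- 1 / 2))
          \<le> (2 * (ennreal (norm (bessel_rest a (t * u) ?F x)))\<^sup>2 + ?c * ?H) * ennreal (u powr (- 1 / 2))"
        using True t by (intro mult_right_mono bessel_mean_square_le f a) auto
      also have "\<dots> = 2 * ((ennreal (norm (bessel_rest a (t * u) ?F x)))\<^sup>2 * ennreal (u powr (- 1 / 2)))
          + ?c * ?H * ennreal (u powr (- 1 / 2))"
        by (simp only: distrib_right mult.assoc)
      also have "\<dots> \<le> 2 * ennreal (?E (t * u) / u) + ?c * ?H * ennreal (u powr (- 1 / 2))"
        by (intro add_right_mono mult_left_mono E) auto
      finally show ?thesis using True by simp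
    qed simp
  qed
  also have "\<dots> = 2 * (\<integral>\<^sup>+u. ennreal (?E (t * u) / u) * indicator {0<..} u \<partial>lborel)
      + ?c * ?H * (\<integral>\<^sup>+u. ennreal (u powr (- 1 / 2)) * indicator {0<..<1} u \<partial>lborel)"
    by (simp add: nn_integral_add nn_integral_cmult)
  also have "(\<integral>\<^sup>+u. ennreal (?E (t * u) / u) * indicator {0<..} u \<partial>lborel) = rest_square a ?F x"
    unfolding rest_square_def by (rule nn_integral_dilation_invariant[OF _ t]) measurable
  finally show ?thesis unfolding square_majorant_def by (simp add: ac_simps)
qed

lemma square_majorant_L1:
  fixes a :: real
  assumes a: "a > - 1 / 2"
  shows "\<exists>K::real. K \<ge> 0 \<and> (\<forall>f :: real ^ 'n::finite \<Rightarrow> complex. schwartz f \<longrightarrow>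
    (\<integral>\<^sup>+x. square_majorant a f x \<partial>lborel) \<le> ennreal (K * (norm_L2 f)\<^sup>2))"
proof -
  define I where "I = (\<integral>\<^sup>+u. ennreal (u powr (- 1 / 2)) * indicator {0<..<1::real} u \<partial>lborel)"
  define c where "c = ennreal (2 * (besselB a 0)\<^sup>2 * 2 powr real CARD('n)) * I"
  define M where "M = ennreal (16 * (8 powr (real DIM(real ^ 'n) / 2))\<^sup>2)"
  have "2 * besselD_norm a + c * M < \<infinity>"
    using besselD_norm_finite[OF a] nn_integral_inverse_sqrt_finite
    unfolding c_def M_def I_def by (simp add: ennreal_mult_less_top)
  then obtain K where K: "2 * besselD_norm a + c * M = ennreal K" "K \<ge> 0"
    by (cases "2 * besselD_norm a + c * M") auto
  have "(\<integral>\<^sup>+x. square_majorant a f x \<partial>lborel) \<le> ennreal (K * (norm_L2 f)\<^sup>2)" if f: "schwartz f" for f :: "real ^ 'n \<Rightarrow> complex"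
  proof -
    let ?F = "fourier_transform f"
    have F: "integrable lborel ?F" by (rule rapid_integrable[OF schwartz_fourier_rapid[OF f]])
    have [measurable]: "f \<in> borel_measurable borel" using schwartz_rapid[OF f] by (simp add: rapid_def)
    have [measurable]: "?F \<in> borel_measurable borel" using F by auto
    have "(\<integral>\<^sup>+x. square_majorant a f x \<partial>lborel)
        = 2 * (\<integral>\<^sup>+x. rest_square a ?F x \<partial>lborel) + c * (\<integral>\<^sup>+x. heat_max2 (\<lambda>y. ennreal (norm (f y))) x \<partial>lborel)"
      unfolding square_majorant_def I_def[symmetric] c_def[symmetric]
      by (subst nn_integral_add) (simp_all add: nn_integral_cmult)
    also have "\<dots> \<le> 2 * (besselD_norm a * (\<integral>\<^sup>+\<xi>. (ennreal (norm (?F \<xi>)))\<^sup>2 \<partial>lborel))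
        + c * (M * (\<integral>\<^sup>+y. (ennreal (norm (f y)))\<^sup>2 \<partial>lborel))"
      using a unfolding M_def by (intro add_mono mult_left_mono rest_square_L1 heat_max2_L1 F) auto
    also have "\<dots> \<le> 2 * (besselD_norm a * (\<integral>\<^sup>+y. (ennreal (norm (f y)))\<^sup>2 \<partial>lborel))
        + c * (M * (\<integral>\<^sup>+y. (ennreal (norm (f y)))\<^sup>2 \<partial>lborel))"
      by (intro add_right_mono mult_left_mono fourier_transform_L2_le schwartz_integrable f) auto
    also have "\<dots> = ennreal K * ennreal ((norm_L2 f)\<^sup>2)"
      unfolding norm_L2_square[OF f] K(1)[symmetric] by (simp only: distrib_right mult.assoc)
    finally show ?thesis using K(2) by (simp add: ennreal_mult)
  qed
  with K(2) show ?thesis by blast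
qed

section \<open>The bilinear maximal inequality\<close>

text \<open>
  The optimal choice is \<open>l = B / A\<close>. The perturbation \<open>(B + d) / (A + d)\<close> with \<open>d \<rightarrow> 0\<close> also
  covers the cases where \<open>A\<close> or \<open>B\<close> is zero.
\<close>

lemma ennreal_le_geometric_mean:
  fixes X :: ennreal and A B M :: real
  assumes nn: "A \<ge> 0" "B \<ge> 0" "M \<ge> 0"
    and le: "\<And>l. l > 0 \<Longrightarrow> 2 * X \<le> ennreal (M * (l * A\<^sup>2 + 1 / l * B\<^sup>2))"
  shows "X \<le> ennreal (M * A * B)"
proof -
  have "2 * X < \<infinity>" by (rule le_less_trans[OF le[of 1]]) auto
  then obtain x where x: "X = ennreal x" "x \<ge> 0" by (cases X) (auto simp: ennreal_mult_top)
  have le': "2 * x \<le> M * (l * A\<^sup>2 + 1 / l * B\<^sup>2)" if l: "l > 0" for l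
  proof -
    have "2 * X = ennreal (2 * x)" using x by (simp add: ennreal_mult)
    with le[OF l] show ?thesis using nn l by (simp add: ennreal_le_iff)
  qed
  have "x \<le> M * A * B + e" if e: "e > 0" for e
  proof -
    define d where "d = e / (M * (A + B) + 1)"
    have pos: "M * (A + B) + 1 > 0" using nn by (intro add_nonneg_pos) auto
    have d: "d > 0" using e pos by (simp add: d_def)
    have "M * (A + B) * d \<le> e"
      using e pos nn by (simp add: d_def pos_divide_le_eq mult_left_mono algebra_simps)
    moreover have "2 * x \<le> M * (A * (B + d) + B * (A + d))"
    proof -
      let ?l = "(B + d) / (A + d)"
      have "A\<^sup>2 / (A + d) \<le> A" using nn d by (simp add: pos_divide_le_eq power2_eq_square algebra_simps)
      then have 1: "?l * A\<^sup>2 \<le> A * (B + d)"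
        using nn d mult_left_mono[of "A\<^sup>2 / (A + d)" A "B + d"] by (simp add: mult.commute)
      have "B\<^sup>2 / (B + d) \<le> B" using nn d by (simp add: pos_divide_le_eq power2_eq_square algebra_simps)
      then have 2: "1 / ?l * B\<^sup>2 \<le> B * (A + d)"
        using nn d mult_left_mono[of "B\<^sup>2 / (B + d)" B "A + d"] by (simp add: mult.commute)
      have "2 * x \<le> M * (?l * A\<^sup>2 + 1 / ?l * B\<^sup>2)" using nn d by (intro le') auto
      also have "\<dots> \<le> M * (A * (B + d) + B * (A + d))"
        using 1 2 nn by (intro mult_left_mono add_mono) auto
      finally show ?thesis .
    qed
    moreover have "M * (A * (B + d) + B * (A + d)) = 2 * (M * A * B) + M * (A + B) * d"
      by (simp add: algebra_simps)
    ultimately show ?thesis using e by linarith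
  qed
  then have "x \<le> M * A * B" by (rule field_le_epsilon)
  then show ?thesis using x by (simp add: ennreal_leI)
qed

theorem theorem2p11:
  fixes \<mu> :: real
  assumes "\<mu> > - real CARD('n::finite) + 1 / 2"
  shows "\<exists>C::real. C > 0 \<and>
           (\<forall>f g :: real ^ 'n \<Rightarrow> complex. schwartz f \<longrightarrow> schwartz g \<longrightarrow>
              norm_L1 (bilinear_maximal \<mu> f g) \<le> ennreal (C * norm_L2 f * norm_L2 g))"
proof -
  \<comment> \<open>The order \<open>\<mu> + n\<close> is split evenly between the two linear means.\<close>
  define a where "a = (\<mu> + real CARD('n) - 1) / 2"
  have a: "a \<ge> - 1 / 4" "a > - 1 / 2" "a \<ge> - 1 / 2" and \<mu>: "\<mu> + real CARD('n) = 2 * a + 1"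
    using assms by (auto simp: a_def field_simps)
  obtain K where K: "K \<ge> 0" and maj: "\<And>f :: real ^ 'n \<Rightarrow> complex. schwartz f \<Longrightarrow>
      (\<integral>\<^sup>+x. square_majorant a f x \<partial>lborel) \<le> ennreal (K * (norm_L2 f)\<^sup>2)"
    using square_majorant_L1[OF a(2), where 'n='n] by blast
  define c where "c = Gamma (2 * a + 2) / 2"
  have c: "c > 0" using a unfolding c_def by (auto intro!: Gamma_real_pos)
  have "norm_L1 (bilinear_maximal \<mu> f g) \<le> ennreal ((c * K + 1) * norm_L2 f * norm_L2 g)"
    if f: "schwartz f" and g: "schwartz g" for f g :: "real ^ 'n \<Rightarrow> complex"
  proof -
    have nn: "norm_L2 f \<ge> 0" "norm_L2 g \<ge> 0" by (auto simp: norm_L2_def)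
    have [measurable]: "square_majorant a f \<in> borel_measurable borel" if "schwartz f" for f :: "real ^ 'n \<Rightarrow> complex"
    proof -
      have [measurable]: "f \<in> borel_measurable borel" "fourier_transform f \<in> borel_measurable borel"
        using schwartz_rapid[OF that] schwartz_fourier_rapid[OF that] by (auto simp: rapid_def)
      show ?thesis unfolding square_majorant_def by measurable
    qed
    note [measurable] = this[OF f] this[OF g]
    have scaled: "2 * norm_L1 (bilinear_maximal \<mu> f g) \<le> ennreal (c * K * (l * (norm_L2 f)\<^sup>2 + 1 / l * (norm_L2 g)\<^sup>2))"
      if l: "l > 0" for l
    proof -
      let ?R = "\<lambda>x. ennreal c * (ennreal l * square_majorant a f x + ennreal (1 / l) * square_majorant a g x)"
      have pt: "ennreal (norm (bilinear_mean \<mu> s f g x)) \<le> ennreal (1 / 2) * ?R x" if s: "s > 0" for s x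
      proof -
        have "2 * ennreal (norm (bilinear_mean \<mu> s f g x)) \<le> ?R x"
          unfolding c_def
          by (rule order_trans[OF bilinear_mean_le[OF f g s a(1) \<mu> l]])
             (use s in \<open>intro mult_left_mono add_mono square_mean_le_majorant f g a; simp\<close>)
        from mult_left_mono[OF this, of "ennreal (1 / 2)"]
        have "(ennreal (1 / 2) * ennreal 2) * ennreal (norm (bilinear_mean \<mu> s f g x)) \<le> ennreal (1 / 2) * ?R x"
          by (simp only: mult.assoc ennreal_numeral zero_le)
        moreover have "ennreal (1 / 2) * ennreal 2 = 1" by (subst ennreal_mult[symmetric]) auto
        ultimately show ?thesis by simp
      qed
      have "norm_L1 (bilinear_maximal \<mu> f g) \<le> (\<integral>\<^sup>+x. ennreal (1 / 2) * ?R x \<partial>lborel)"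
        unfolding norm_L1_def bilinear_maximal_def
        by (intro nn_integral_mono SUP_least) (use pt in auto)
      also have "\<dots> = ennreal (1 / 2) * (ennreal c * (ennreal l * (\<integral>\<^sup>+x. square_majorant a f x \<partial>lborel)
          + ennreal (1 / l) * (\<integral>\<^sup>+x. square_majorant a g x \<partial>lborel)))"
        by (simp add: nn_integral_cmult nn_integral_add)
      also have "\<dots> \<le> ennreal (1 / 2) * (ennreal c * (ennreal l * ennreal (K * (norm_L2 f)\<^sup>2) + ennreal (1 / l) * ennreal (K * (norm_L2 g)\<^sup>2)))"
        by (intro mult_left_mono add_mono maj f g) auto
      also have "\<dots> = ennreal (1 / 2 * (c * (l * (K * (norm_L2 f)\<^sup>2) + 1 / l * (K * (norm_L2 g)\<^sup>2))))"
      proof -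
        have e1: "ennreal l * ennreal p + ennreal (1 / l) * ennreal q = ennreal (l * p + 1 / l * q)"
          if "p \<ge> 0" "q \<ge> 0" for p q
          using l that by (subst (1 2) ennreal_mult[symmetric]) auto
        have e2: "ennreal (1 / 2) * (ennreal c * ennreal p) = ennreal (1 / 2 * (c * p))" if "p \<ge> 0" for p
        proof -
          have "ennreal c * ennreal p = ennreal (c * p)"
            using c that by (intro ennreal_mult[symmetric]) auto
          also have "ennreal (1 / 2) * \<dots> = ennreal (1 / 2 * (c * p))"
            using c that by (intro ennreal_mult[symmetric]) auto
          finally show ?thesis .
        qed
        have pos: "K * (norm_L2 f)\<^sup>2 \<ge> 0" "K * (norm_L2 g)\<^sup>2 \<ge> 0" using K by auto
        show ?thesis unfolding e1[OF pos] using K l by (intro e2 add_nonneg_nonneg mult_nonneg_nonneg) auto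
      qed
      finally have "2 * norm_L1 (bilinear_maximal \<mu> f g)
          \<le> ennreal 2 * ennreal (1 / 2 * (c * (l * (K * (norm_L2 f)\<^sup>2) + 1 / l * (K * (norm_L2 g)\<^sup>2))))"
        by (simp only: ennreal_numeral mult_left_mono zero_le)
      also have "\<dots> = ennreal (2 * (1 / 2 * (c * (l * (K * (norm_L2 f)\<^sup>2) + 1 / l * (K * (norm_L2 g)\<^sup>2)))))"
        using c l K by (intro ennreal_mult[symmetric]) auto
      also have "2 * (1 / 2 * (c * (l * (K * (norm_L2 f)\<^sup>2) + 1 / l * (K * (norm_L2 g)\<^sup>2))))
          = c * K * (l * (norm_L2 f)\<^sup>2 + 1 / l * (norm_L2 g)\<^sup>2)"
        by (simp add: algebra_simps)
      finally show ?thesis .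
    qed
    have "norm_L1 (bilinear_maximal \<mu> f g) \<le> ennreal (c * K * norm_L2 f * norm_L2 g)"
      by (rule ennreal_le_geometric_mean[OF nn _ scaled]) (use c K in auto)
    also have "\<dots> \<le> ennreal ((c * K + 1) * norm_L2 f * norm_L2 g)"
      using nn by (intro ennreal_leI mult_right_mono) auto
    finally show ?thesis .
  qed
  moreover have "c * K + 1 > 0" using c K by (intro add_nonneg_pos) auto
  ultimately show ?thesis by blast
qed

end
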